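(* Let $\mathcal{F}$ be a class of real-valued functions on $\chi$ with $\Phi:=\sup_{f\in\mathcal{F}}\|f\|_\infty<\infty$, and suppose that for some $A>0$ and $\alpha\in[0,2)$, $$\log N_{[\,]}(\zeta,\mathcal{F},\|\cdot\|)\le A\zeta^{-\alpha}\quad\text{for all }\zeta>0 .$$ Suppose $f_0\in\mathcal{F}$ and that there is $\sigma>0$ with $\mathbb{E}(\epsilon^2\mid X)\le\sigma^2$ almost everywhere $P_X$. Let $q\ge 2$ be finite, and suppose there exists a constant $C_0>0$ such that $$\big\|(|\epsilon|+\Phi)F_\delta(X)\big\|_q\le C_0\,\Phi^2\delta^s\quad\text{for all }\delta>0,$$ for some $s\in[0,1]$. Let $$r_n:=\min\left\{\frac{(nA^{-1})^{1/(2+\alpha)}}{(\sigma+\Phi)^{2/(2+\alpha)}},\ \frac{n^{(q-1)/(q(2-s))}}{\Phi^{2/(2-s)}},\ \frac{n^{1/(2+\alpha+(2-qs)/(q-1))}}{(A^{q-1}\Phi^{2q})^{1/(2-qs+(2+\alpha)(q-1))}}\right\}.$$ Then there exists a constant $C$ depending only on $\alpha$, $s$ and $q$ such that for any $n\ge1$ and $D>0$, $$\mathbb{P}\big(r_n\|\widehat f-f_0\|\ge D\big)\le C\,D^{-q+\mathbf{1}\{s=1\}/10}.$$ Hence, the rate of convergence of $\widehat f$ is $r_n^{-1}$.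
   Context: Setting: $(X_1,Y_1),\dots,(X_n,Y_n)$ are i.i.d. copies of $(X,Y)\in\chi\times\mathbb{R}$, where $\chi$ is a metric space; $P_X$ is the distribution of $X$; $f_0(x):=\mathbb{E}(Y\mid X=x)$; $\epsilon:=Y-f_0(X)$ (so $\mathbb{E}(\epsilon\mid X)=0$; no independence between $\epsilon$ and $X$ is assumed). The least squares estimator is $\widehat f:=\arg\min_{f\in\mathcal{F}}\sum_{i=1}^n(Y_i-f(X_i))^2$. The estimator is said to converge at rate $\delta_n$ if $\|\widehat f-f_0\|=O_p(\delta_n)$. Norms: for $g:\chi\to\mathbb{R}$, $\|g\|^2:=\int_\chi g^2\,dP_X$, and $\|g\|_\infty:=\sup_{x\in\chi}|g(x)|$; for a random variable $Z$, $\|Z\|_q:=(\mathbb{E}|Z|^q)^{1/q}$. Bracketing number: $N_{[\,]}(\zeta,\mathcal{F},\|\cdot\|)$ is the smallest $m\ge1$ such that there are pairs of functions $(g_1^L,g_1^U),\dots,(g_m^L,g_m^U)$ with $\|g_j^U-g_j^L\|\le\zeta$ for all $j$, and such that for every $f\in\mathcal{F}$ there is $j\le m$ with $g_j^L(x)\le f(x)\le g_j^U(x)$ for every $x\in\chi$. Local envelope: $F_\delta(x):=\sup\{|f(x)-f_0(x)|:\ f\in\mathcal{F},\ \|f-f_0\|\le\delta\}$.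
   Formalization: The constant C may depend on C_0 as well as on α, s and q: with C_0 free (e.g. C_0 = √n+1, rare error spikes of size √n, indicators of windows of width n^{-1/2}) the stated bound fails. C is also fixed after the underlying sets of χ and of the sample space. *)

theory Defs
  imports "HOL-Probability.Probability"
begin

text \<open>
  The covariate space is an arbitrary metric space given by a carrier \<open>S\<close> and a distance \<open>d\<close>
  (locale \<^locale>\<open>Metric_space\<close>), not by a type class, so that it can be quantified over inside a
  statement.  Functions on \<open>S\<close> are total HOL functions whose values outside \<open>S\<close> are irrelevant.
\<close>

definition metric_borel :: "'x set \<Rightarrow> ('x \<Rightarrow> 'x \<Rightarrow> real) \<Rightarrow> 'x measure" where
  "metric_borel S d = sigma S {U. openin (Metric_space.mtopology S d) U}"

text \<open>
  The value is \<open>\<infinity>\<close> when the \<open>q\<close>-th absolute moment is infinite; a Bochner integral would silently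
  return 0 there.  Meaningful for measurable \<open>g\<close> and \<open>q \<ge> 1\<close>.
\<close>

definition Lq_norm :: "'a measure \<Rightarrow> real \<Rightarrow> ('a \<Rightarrow> real) \<Rightarrow> ennreal" where
  "Lq_norm M q g =
     (let I = (\<integral>\<^sup>+ x. ennreal (\<bar>g x\<bar> powr q) \<partial>M)
      in if I = \<infinity> then \<infinity> else ennreal (enn2real I powr (1 / q)))"

definition bracketing_cover ::
    "'x measure \<Rightarrow> real \<Rightarrow> ('x \<Rightarrow> real) set \<Rightarrow> nat \<Rightarrow> bool" where
  "bracketing_cover P \<zeta> F m \<longleftrightarrow>
     (\<exists>gL gU :: nat \<Rightarrow> 'x \<Rightarrow> real.
        (\<forall>j<m. gL j \<in> borel_measurable P \<and> gU j \<in> borel_measurable P \<and>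
               Lq_norm P 2 (\<lambda>x. gU j x - gL j x) \<le> ennreal \<zeta>) \<and>
        (\<forall>f\<in>F. \<exists>j<m. \<forall>x\<in>space P. gL j x \<le> f x \<and> f x \<le> gU j x))"

text \<open>The value is \<open>\<infinity>\<close> if no finite family of brackets exists.\<close>

definition bracketing_number :: "'x measure \<Rightarrow> real \<Rightarrow> ('x \<Rightarrow> real) set \<Rightarrow> enat" where
  "bracketing_number P \<zeta> F = Inf {enat m | m. 1 \<le> m \<and> bracketing_cover P \<zeta> F m}"

definition local_envelope ::
    "'x measure \<Rightarrow> ('x \<Rightarrow> real) set \<Rightarrow> ('x \<Rightarrow> real) \<Rightarrow> real \<Rightarrow> 'x \<Rightarrow> real" where
  "local_envelope P F f0 \<delta> x =
     Sup {\<bar>f x - f0 x\<bar> | f. f \<in> F \<and> Lq_norm P 2 (\<lambda>y. f y - f0 y) \<le> ennreal \<delta>}"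

text \<open>
  The sub-sigma-algebra generated by the covariate \<open>X\<close> is \<open>vimage_algebra (space M) X B\<close>.
\<close>

definition regression_model ::
    "'w measure \<Rightarrow> 'x measure \<Rightarrow> ('w \<Rightarrow> 'x) \<Rightarrow> ('w \<Rightarrow> real) \<Rightarrow> (nat \<Rightarrow> 'w \<Rightarrow> 'x) \<Rightarrow>
     (nat \<Rightarrow> 'w \<Rightarrow> real) \<Rightarrow> ('x \<Rightarrow> real) \<Rightarrow> bool" where
  "regression_model M B X Y Xs Ys f0 \<longleftrightarrow>
     prob_space M \<and>
     X \<in> measurable M B \<and> integrable M Y \<and>
     prob_space.indep_vars M (\<lambda>_. B \<Otimes>\<^sub>M borel) (\<lambda>i \<omega>. (Xs i \<omega>, Ys i \<omega>)) {1..} \<and>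
     (\<forall>i\<ge>1. distr M (B \<Otimes>\<^sub>M borel) (\<lambda>\<omega>. (Xs i \<omega>, Ys i \<omega>)) =
             distr M (B \<Otimes>\<^sub>M borel) (\<lambda>\<omega>. (X \<omega>, Y \<omega>))) \<and>
     f0 \<in> borel_measurable B \<and>
     (AE \<omega> in M. real_cond_exp M (vimage_algebra (space M) X B) Y \<omega> = f0 (X \<omega>))"

text \<open>
  \<open>fhat \<omega>\<close> is a minimiser over \<open>F\<close> (not assumed unique) for the sample of size \<open>n\<close>.  The
  measurability clause makes the estimation error a random variable, so that its tail
  probabilities are meaningful.
\<close>

definition least_squares_estimator ::
    "'w measure \<Rightarrow> 'x measure \<Rightarrow> (nat \<Rightarrow> 'w \<Rightarrow> 'x) \<Rightarrow> (nat \<Rightarrow> 'w \<Rightarrow> real) \<Rightarrow> ('x \<Rightarrow> real) set \<Rightarrow>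
     ('x \<Rightarrow> real) \<Rightarrow> nat \<Rightarrow> ('w \<Rightarrow> 'x \<Rightarrow> real) \<Rightarrow> bool" where
  "least_squares_estimator M P Xs Ys F f0 n fhat \<longleftrightarrow>
     (\<forall>\<omega>\<in>space M.
        is_arg_min (\<lambda>f. \<Sum>i=1..n. (Ys i \<omega> - f (Xs i \<omega>))\<^sup>2) (\<lambda>f. f \<in> F) (fhat \<omega>)) \<and>
     (\<lambda>\<omega>. Lq_norm P 2 (\<lambda>x. fhat \<omega> x - f0 x)) \<in> borel_measurable M"

definition bigO_prob :: "'w measure \<Rightarrow> (nat \<Rightarrow> 'w \<Rightarrow> ennreal) \<Rightarrow> (nat \<Rightarrow> real) \<Rightarrow> bool" where
  "bigO_prob M Z \<delta> \<longleftrightarrow>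
     (\<forall>\<eta>>0. \<exists>K>0. \<exists>N. \<forall>n\<ge>N. measure M {\<omega>\<in>space M. Z n \<omega> > ennreal (K * \<delta> n)} \<le> \<eta>)"

text \<open>
  All three terms are positive when \<open>\<Phi> > 0\<close>.  For \<open>\<Phi> = 0\<close> the class is \<open>{0}\<close> and the
  estimation error vanishes; the HOL convention \<open>x / 0 = 0\<close> is then harmless.
\<close>

definition lse_rate :: "real \<Rightarrow> real \<Rightarrow> real \<Rightarrow> real \<Rightarrow> real \<Rightarrow> real \<Rightarrow> nat \<Rightarrow> real" where
  "lse_rate \<alpha> s q A \<Phi> \<sigma> n =
     Min {(real n / A) powr (1 / (2 + \<alpha>)) / (\<sigma> + \<Phi>) powr (2 / (2 + \<alpha>)),
          real n powr ((q - 1) / (q * (2 - s))) / \<Phi> powr (2 / (2 - s)),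
          real n powr (1 / (2 + \<alpha> + (2 - q * s) / (q - 1))) /
            (A powr (q - 1) * \<Phi> powr (2 * q)) powr (1 / (2 - q * s + (2 + \<alpha>) * (q - 1)))}"

end

(*
  Write g = f - f0 and phi_f = 2 eps g - g^2, so that P phi_f = - |g|^2, while the empirical mean of
  phi_f is nonnegative at the least squares estimator.  On a shell delta/2 <= |g| <= delta with
  delta = D / r_n this forces an empirical deviation of order delta^2.  Put H = A delta^(-alpha) and
  R = H + 1 + q ln D.  After truncating the envelope at a level T of order n delta^2 / R, chaining along
  brackets with a Bernstein bound at every link excludes such a deviation outside an event of
  probability O(D^(-q)), by the first term of r_n.  The part above T is handled by Markov's
  inequality and the q-th moment of the envelope, which gives D^(-kappa) up to logarithms, where
  kappa = 2 - q s + (2 + alpha)(q - 1), by the third term of r_n.  A nonempty shell forces H >= 1/32, so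
  that R is at most H times a factor logarithmic in D; this is why the second term of r_n is never
  needed.  Summing over the shells D, 2D, 4D, ... gives the claim.
*)
theory Submission
  imports Defs
begin

section \<open>Exponential inequality for bounded functions of an i.i.d. sample\<close>

text \<open>The noise has only a conditional variance and, through the envelope, \<open>q\<close>
  moments, whereas Bernstein's bound needs bounded summands. The remedy is that everything unbounded
  is controlled by functions not depending on \<open>f\<close>: one indicator, built from the
  envelope, truncates all gains at once and costs no entropy, and the discarded part is dominated by
  a single function, so that Markov's inequality for one variable replaces a supremum over the
  class. L2 brackets say nothing about sup norms, so a link of the chain may still be as large as
  \<open>T\<close>. Hence each level has its own threshold: large links are dropped where a width
  first exceeds it, and what is dropped is paid for in the mean through second moments. Widths
  \<delta>/2^k, thresholds of order T w^k and entropies H u^k with u = 2^\<alpha> then contribute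
  variance terms of ratio 1/(4 w) and sup terms of ratio w u. Equal ratios mean w =
  2^(-1-\<alpha>/2), and the common ratio 2^(\<alpha>/2-1) is below 1 exactly for \<alpha> < 2. The
  chain therefore costs a constant factor over its coarsest level, which is the radius \<delta> of
  the shell itself.\<close>

lemma exp_le_quadratic:
  fixes x :: real
  assumes "\<bar>x\<bar> \<le> 1"
  shows "exp x \<le> 1 + x + x\<^sup>2"
proof (cases "0 \<le> x")
  case True
  then show ?thesis using exp_bound[of x] assms by simp
next
  case False
  \<comment> \<open>For negative \<open>x\<close> both sides are multiplied by \<open>1 - x\<close>
    > 0: the left becomes at most 1, the right equals 1 - x^3 \<ge> 1.\<close>
  have "1 - x \<le> exp (- x)" using exp_ge_add_one_self[of "- x"] by simp
  then have "exp x * (1 - x) \<le> exp x * exp (- x)"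
    by (intro mult_left_mono) auto
  then have "exp x * (1 - x) \<le> 1" by (simp add: exp_minus)
  moreover have "1 \<le> (1 + x + x\<^sup>2) * (1 - x)"
  proof -
    have "(1 + x + x\<^sup>2) * (1 - x) = 1 + x\<^sup>2 * (- x)"
      by (simp add: algebra_simps power2_eq_square)
    moreover have "0 \<le> x\<^sup>2 * (- x)" using False by (intro mult_nonneg_nonneg) auto
    ultimately show ?thesis by simp
  qed
  ultimately have "exp x * (1 - x) \<le> (1 + x + x\<^sup>2) * (1 - x)" by linarith
  then show ?thesis using False by simp
qed

text \<open>\<open>Q\<close> is both the sigma-algebra of the observations and their common law, so
  population means are integrals over \<open>Q\<close>.\<close>

locale iid_sample = prob_space M for M :: "'w measure" +
  fixes Q :: "'z measure" and Z :: "nat \<Rightarrow> 'w \<Rightarrow> 'z" and n :: nat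
  assumes indep: "indep_vars (\<lambda>_. Q) Z {1..n}"
    and law: "\<And>i. i \<in> {1..n} \<Longrightarrow> distr M Q (Z i) = Q"
    and n_pos: "1 \<le> n"
begin

lemma Z_measurable [measurable]: "i \<in> {1..n} \<Longrightarrow> Z i \<in> measurable M Q"
  using indep by (auto simp: indep_vars_def)

lemma Z_space: "i \<in> {1..n} \<Longrightarrow> \<omega> \<in> space M \<Longrightarrow> Z i \<omega> \<in> space Q"
  using Z_measurable[of i] by (rule measurable_space)

lemma prob_space_Q: "prob_space Q"
  using prob_space_distr[OF Z_measurable[of 1]] law[of 1] n_pos by simp

lemma sum_measurable [measurable]:
  "\<psi> \<in> borel_measurable Q \<Longrightarrow> (\<lambda>\<omega>. \<Sum>i=1..n. (\<psi> (Z i \<omega>) :: real)) \<in> borel_measurable M"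
  by (intro borel_measurable_sum) (rule measurable_compose[OF Z_measurable])

lemma integrable_bdd:
  fixes \<psi> :: "'z \<Rightarrow> real"
  assumes "\<psi> \<in> borel_measurable Q" "\<And>z. z \<in> space Q \<Longrightarrow> \<bar>\<psi> z\<bar> \<le> b"
  shows "integrable Q \<psi>"
proof -
  interpret Q: prob_space Q by (rule prob_space_Q)
  show ?thesis using assms by (intro Q.integrable_const_bound[of _ b]) auto
qed

text \<open>Chernoff's method with the quadratic bound on exp, which \<open>l * b \<le> 1\<close>
  makes available. The raw second moment avoids centring. The applications take
  \<open>l = 1 / b\<close>, so that the deviation is n v / b + b y: Bernstein's inequality in linear
  form.\<close>

lemma exp_tail:
  fixes \<psi> :: "'z \<Rightarrow> real"
  assumes [measurable]: "\<psi> \<in> borel_measurable Q"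
    and bdd: "\<And>z. z \<in> space Q \<Longrightarrow> \<bar>\<psi> z\<bar> \<le> b" and l: "0 < l" "l * b \<le> 1"
    and v: "(\<integral>z. (\<psi> z)\<^sup>2 \<partial>Q) \<le> v"
  shows "prob {\<omega> \<in> space M. (\<Sum>i=1..n. \<psi> (Z i \<omega>)) \<ge> n * ((\<integral>z. \<psi> z \<partial>Q) + l * v) + y / l} \<le> exp (- y)"
proof -
  interpret Q: prob_space Q by (rule prob_space_Q)
  have le1: "\<bar>l * \<psi> z\<bar> \<le> 1" if "z \<in> space Q" for z
  proof -
    have "l * \<bar>\<psi> z\<bar> \<le> l * b" using bdd[OF that] l by (intro mult_left_mono) auto
    then have "l * \<bar>\<psi> z\<bar> \<le> 1" using l(2) by linarith
    then show ?thesis using l(1) by (simp add: abs_mult)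
  qed
  have int2: "integrable Q (\<lambda>z. (\<psi> z)\<^sup>2)"
  proof (rule integrable_bdd[of _ "b\<^sup>2"])
    fix z assume "z \<in> space Q"
    from power_mono[OF bdd[OF this], of 2] show "\<bar>(\<psi> z)\<^sup>2\<bar> \<le> b\<^sup>2" by simp
  qed simp
  have int1: "integrable Q \<psi>" by (rule integrable_bdd[OF assms(1) bdd])
  have inte: "integrable Q (\<lambda>z. exp (l * \<psi> z))"
  proof (rule integrable_bdd[of _ "exp 1"])
    fix z assume "z \<in> space Q"
    from le1[OF this] show "\<bar>exp (l * \<psi> z)\<bar> \<le> exp 1" by simp
  qed simp
  define m where "m = (\<integral>z. exp (l * \<psi> z) \<partial>Q)"
  have m0: "0 \<le> m" unfolding m_def by (intro integral_nonneg_AE) auto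
  have "m \<le> (\<integral>z. 1 + l * \<psi> z + l\<^sup>2 * (\<psi> z)\<^sup>2 \<partial>Q)"
    unfolding m_def
  proof (rule integral_mono[OF inte])
    fix z assume "z \<in> space Q"
    from exp_le_quadratic[OF le1[OF this]]
    show "exp (l * \<psi> z) \<le> 1 + l * \<psi> z + l\<^sup>2 * (\<psi> z)\<^sup>2" by (simp add: power_mult_distrib)
  qed (use int1 int2 in auto)
  also have "\<dots> = 1 + l * (\<integral>z. \<psi> z \<partial>Q) + l\<^sup>2 * (\<integral>z. (\<psi> z)\<^sup>2 \<partial>Q)"
    using int1 int2 by (simp add: Q.prob_space)
  also have "\<dots> \<le> 1 + (l * (\<integral>z. \<psi> z \<partial>Q) + l\<^sup>2 * v)"
    using mult_left_mono[OF v, of "l\<^sup>2"] by simp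
  also have "\<dots> \<le> exp (l * (\<integral>z. \<psi> z \<partial>Q) + l\<^sup>2 * v)" by (rule exp_ge_add_one_self)
  finally have m: "m \<le> exp (l * (\<integral>z. \<psi> z \<partial>Q) + l\<^sup>2 * v)" .
  have iv: "indep_vars (\<lambda>_. borel) (\<lambda>i \<omega>. exp (l * \<psi> (Z i \<omega>))) {1..n}"
    by (rule indep_vars_compose2[OF indep]) simp
  have each: "integrable M (\<lambda>\<omega>. exp (l * \<psi> (Z i \<omega>)))"
      "(\<integral>\<omega>. exp (l * \<psi> (Z i \<omega>)) \<partial>M) = m" if i: "i \<in> {1..n}" for i
  proof -
    have "integrable (distr M Q (Z i)) (\<lambda>z. exp (l * \<psi> z))" using inte law[OF i] by simp
    then show "integrable M (\<lambda>\<omega>. exp (l * \<psi> (Z i \<omega>)))"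
      by (rule integrable_distr[OF Z_measurable[OF i]])
    have "m = (\<integral>z. exp (l * \<psi> z) \<partial>distr M Q (Z i))" by (simp add: law[OF i] m_def)
    also have "\<dots> = (\<integral>\<omega>. exp (l * \<psi> (Z i \<omega>)) \<partial>M)"
      by (rule integral_distr[OF Z_measurable[OF i]]) simp
    finally show "(\<integral>\<omega>. exp (l * \<psi> (Z i \<omega>)) \<partial>M) = m" by simp
  qed
  have prodeq: "(\<Prod>i=1..n. exp (l * \<psi> (Z i \<omega>))) = exp (l * (\<Sum>i=1..n. \<psi> (Z i \<omega>)))" for \<omega>
    by (simp add: exp_sum sum_distrib_left)
  have intp: "integrable M (\<lambda>\<omega>. exp (l * (\<Sum>i=1..n. \<psi> (Z i \<omega>))))"
    unfolding prodeq[symmetric] by (rule indep_vars_integrable[OF _ iv each(1)]) simp_all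
  have "(\<integral>\<omega>. exp (l * (\<Sum>i=1..n. \<psi> (Z i \<omega>))) \<partial>M) = (\<Prod>i=1..n. \<integral>\<omega>. exp (l * \<psi> (Z i \<omega>)) \<partial>M)"
    unfolding prodeq[symmetric] by (rule indep_vars_lebesgue_integral[OF _ iv each(1)]) simp_all
  also have "\<dots> = m ^ n" by (simp add: each(2))
  finally have "(\<integral>\<omega>. exp (l * (\<Sum>i=1..n. \<psi> (Z i \<omega>))) \<partial>M) = m ^ n" .
  moreover have "m ^ n \<le> exp (l * (\<integral>z. \<psi> z \<partial>Q) + l\<^sup>2 * v) ^ n" by (rule power_mono[OF m m0])
  moreover have "\<dots> = exp (n * (l * (\<integral>z. \<psi> z \<partial>Q) + l\<^sup>2 * v))"
    by (simp add: exp_of_nat_mult)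
  ultimately have Ele: "(\<integral>\<omega>. exp (l * (\<Sum>i=1..n. \<psi> (Z i \<omega>))) \<partial>M) \<le> exp (n * (l * (\<integral>z. \<psi> z \<partial>Q) + l\<^sup>2 * v))"
    by simp
  define t where "t = n * ((\<integral>z. \<psi> z \<partial>Q) + l * v) + y / l"
  have "prob {\<omega> \<in> space M. (\<Sum>i=1..n. \<psi> (Z i \<omega>)) \<ge> t}
      \<le> exp (- l * t) * (\<integral>\<omega>\<in>space M. exp (l * (\<Sum>i=1..n. \<psi> (Z i \<omega>))) \<partial>M)"
    by (rule Chernoff_ineq_ge[OF l(1) _ sets.top])
      (unfold set_integrable_def, rule integrable_mult_indicator[OF sets.top intp])
  also have "(\<integral>\<omega>\<in>space M. exp (l * (\<Sum>i=1..n. \<psi> (Z i \<omega>))) \<partial>M) = (\<integral>\<omega>. exp (l * (\<Sum>i=1..n. \<psi> (Z i \<omega>))) \<partial>M)"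
    by (rule set_integral_space[OF intp])
  also have "exp (- l * t) * \<dots> \<le> exp (- l * t) * exp (n * (l * (\<integral>z. \<psi> z \<partial>Q) + l\<^sup>2 * v))"
    using Ele by (intro mult_left_mono) auto
  also have "\<dots> = exp (- y)"
    using l by (simp add: t_def exp_add[symmetric] algebra_simps power2_eq_square)
  finally show ?thesis by (simp add: t_def)
qed

text \<open>The exceptional event is a finite union, hence measurable, even when the class is indexed
  by an uncountable set.\<close>

lemma exp_tail_union:
  fixes \<psi> :: "'i \<Rightarrow> 'z \<Rightarrow> real"
  assumes fin: "finite (\<psi> ` I)" and card: "card (\<psi> ` I) \<le> p"
    and meas: "\<And>f. f \<in> I \<Longrightarrow> \<psi> f \<in> borel_measurable Q"
    and bdd: "\<And>f z. f \<in> I \<Longrightarrow> z \<in> space Q \<Longrightarrow> \<bar>\<psi> f z\<bar> \<le> b" and l: "0 < l" "l * b \<le> 1"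
    and v: "\<And>f. f \<in> I \<Longrightarrow> (\<integral>z. (\<psi> f z)\<^sup>2 \<partial>Q) \<le> v"
  shows "\<exists>E\<in>sets M. prob E \<le> p * exp (- y) \<and>
    (\<forall>\<omega>\<in>space M - E. \<forall>f\<in>I. (\<Sum>i=1..n. \<psi> f (Z i \<omega>)) \<le> n * ((\<integral>z. \<psi> f z \<partial>Q) + l * v) + y / l)"
proof -
  define B where "B g = {\<omega> \<in> space M. (\<Sum>i=1..n. g (Z i \<omega>)) \<ge> n * ((\<integral>z. g z \<partial>Q) + l * v) + y / l}"
    for g :: "'z \<Rightarrow> real"
  define E where "E = (\<Union>g\<in>\<psi> ` I. B g)"
  have Bm: "B g \<in> sets M" if "g \<in> \<psi> ` I" for g
  proof -
    have [measurable]: "g \<in> borel_measurable Q" using that meas by auto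
    show ?thesis unfolding B_def by measurable
  qed
  have "prob E \<le> (\<Sum>g\<in>\<psi> ` I. prob (B g))"
    unfolding E_def by (rule finite_measure_subadditive_finite[OF fin]) (use Bm in auto)
  also have "\<dots> \<le> (\<Sum>g\<in>\<psi> ` I. exp (- y))"
  proof (rule sum_mono)
    fix g assume "g \<in> \<psi> ` I"
    then obtain f where f: "f \<in> I" "g = \<psi> f" by auto
    show "prob (B g) \<le> exp (- y)"
      unfolding B_def f(2) by (rule exp_tail[OF meas[OF f(1)] bdd[OF f(1)] l v[OF f(1)]])
  qed
  also have "\<dots> \<le> p * exp (- y)" using card by simp
  finally have "prob E \<le> p * exp (- y)" .
  moreover have "E \<in> sets M" unfolding E_def by (rule sets.finite_UN[OF fin Bm])
  moreover have "(\<Sum>i=1..n. \<psi> f (Z i \<omega>)) \<le> n * ((\<integral>z. \<psi> f z \<partial>Q) + l * v) + y / l"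
    if "\<omega> \<in> space M - E" "f \<in> I" for \<omega> f
    using that unfolding E_def B_def by auto
  ultimately show ?thesis by blast
qed

end

section \<open>Bracket chaining\<close>

text \<open>Brackets of successive levels are unrelated, so a function built along the chain is
  determined by all indices up to its level, and the number of such functions is a product over
  levels. Restricting the index path to \<open>{..k}\<close> makes it an element of a finite
  product.\<close>

lemma card_image_paths:
  fixes j :: "nat \<Rightarrow> 'i \<Rightarrow> nat" and m :: "nat \<Rightarrow> nat"
  assumes "\<And>f. f \<in> I \<Longrightarrow> \<psi> f = \<Psi> (\<lambda>i\<in>{..k}. j i f)" and "\<And>i f. f \<in> I \<Longrightarrow> j i f < m i"
  shows "finite (\<psi> ` I)" and "card (\<psi> ` I) \<le> (\<Prod>i\<le>k. m i)"
proof -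
  let ?P = "Pi\<^sub>E {..k} (\<lambda>i. {..<m i})"
  have fin: "finite ?P" by (intro finite_PiE) auto
  have sub: "\<psi> ` I \<subseteq> \<Psi> ` ?P"
  proof
    fix g assume "g \<in> \<psi> ` I"
    then obtain f where f: "f \<in> I" "g = \<psi> f" by auto
    have "(\<lambda>i\<in>{..k}. j i f) \<in> ?P" using assms(2)[OF f(1)] by auto
    then show "g \<in> \<Psi> ` ?P" using f assms(1)[OF f(1)] by auto
  qed
  show "finite (\<psi> ` I)" using finite_subset[OF sub] fin by auto
  have "card (\<psi> ` I) \<le> card (\<Psi> ` ?P)" using sub fin by (intro card_mono) auto
  also have "\<dots> \<le> card ?P" by (rule card_image_le[OF fin])
  also have "\<dots> = (\<Prod>i\<le>k. m i)" by (simp add: card_PiE)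
  finally show "card (\<psi> ` I) \<le> (\<Prod>i\<le>k. m i)" .
qed

text \<open>Summation by parts: on the part still kept the approximation moves from
  \<open>c k\<close> to \<open>c (Suc k)\<close>, and on the part that \<open>B\<close> loses the
  remainder \<open>\<phi> - c k\<close> is booked at once.\<close>

lemma chaining_telescope:
  fixes \<phi> :: real and c B :: "nat \<Rightarrow> real"
  assumes "B 0 = 1"
  shows "\<phi> = c 0 + (\<Sum>k<K. (c (Suc k) - c k) * B (Suc k) + (\<phi> - c k) * (B k - B (Suc k))) + (\<phi> - c K) * B K"
proof (induction K)
  case 0
  then show ?case using assms by simp
next
  case (Suc K)
  then show ?case by (simp add: algebra_simps)
qed

text \<open>Chaining along brackets without making them nested: the link from level \<open>k\<close> to level
  \<open>k + 1\<close> is kept only where the bracket widths of all levels up to \<open>k + 1\<close> are below their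
  thresholds \<open>a\<close>, and where level \<open>k + 1\<close> is the first to exceed its threshold the
  remainder is bounded by the width at level \<open>k\<close>.\<close>

lemma (in iid_sample) chaining_tail:
  fixes \<phi> :: "'i \<Rightarrow> 'z \<Rightarrow> real" and c \<Delta> :: "nat \<Rightarrow> nat \<Rightarrow> 'z \<Rightarrow> real"
    and j :: "nat \<Rightarrow> 'i \<Rightarrow> nat" and m :: "nat \<Rightarrow> nat" and a v h :: "nat \<Rightarrow> real"
  assumes \<phi>m: "\<And>f. f \<in> I \<Longrightarrow> \<phi> f \<in> borel_measurable Q"
    and cm [measurable]: "\<And>k i. c k i \<in> borel_measurable Q"
    and \<Delta>m [measurable]: "\<And>k i. \<Delta> k i \<in> borel_measurable Q"
    and near: "\<And>f k z. f \<in> I \<Longrightarrow> z \<in> space Q \<Longrightarrow> \<bar>\<phi> f z - c k (j k f) z\<bar> \<le> \<Delta> k (j k f) z"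
    and jm: "\<And>f k. f \<in> I \<Longrightarrow> j k f < m k"
    and mh: "\<And>k. real (m k) \<le> exp (h k)"
    and cb: "\<And>f k z. f \<in> I \<Longrightarrow> z \<in> space Q \<Longrightarrow> \<bar>c k (j k f) z\<bar> \<le> a 0"
    and \<Delta>b: "\<And>f k z. f \<in> I \<Longrightarrow> z \<in> space Q \<Longrightarrow> \<Delta> k (j k f) z \<le> a 0"
    and a: "\<And>k. 0 < a k" "\<And>k. a (Suc k) \<le> a k" "\<And>k. a k \<le> 4 * a (Suc k)"
    and \<Delta>v: "\<And>f k. f \<in> I \<Longrightarrow> (\<integral>z. (\<Delta> k (j k f) z)\<^sup>2 \<partial>Q) \<le> v k"
    and v: "\<And>k. v (Suc k) \<le> v k"
    and c0v: "\<And>f. f \<in> I \<Longrightarrow> (\<integral>z. (c 0 (j 0 f) z)\<^sup>2 \<partial>Q) \<le> 4 * v 0"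
    and y: "\<And>k. y k = L + real (Suc k) + (\<Sum>i\<le>k. h i)"
  shows "\<exists>E\<in>sets M. prob E \<le> 2 * exp (- L) \<and>
    (\<forall>\<omega>\<in>space M - E. \<forall>f\<in>I. (\<Sum>i=1..n. \<phi> f (Z i \<omega>)) \<le>
       n * (\<integral>z. \<phi> f z \<partial>Q) + (4 * n * v 0 / a 0 + a 0 * y 0)
       + (\<Sum>k<K. 11 * n * v k / a k + 4 * a k * y (Suc k)) + 2 * n * a K)"
proof -
  interpret Q: prob_space Q by (rule prob_space_Q)
  define B :: "nat \<Rightarrow> 'i \<Rightarrow> 'z \<Rightarrow> real" where "B k f z = of_bool (\<forall>i\<le>k. \<Delta> i (j i f) z \<le> a i)" for k f z
  define pa where "pa k f z = (c (Suc k) (j (Suc k) f) z - c k (j k f) z) * B (Suc k) f z" for k f z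
  \<comment> \<open>The true remainder involves \<open>\<phi> f\<close>, which may vary over an
    infinite class; its majorant \<open>pb\<close> depends on the index path alone, so a finite
    union bound applies to it.\<close>
  define pb where "pb k f z = \<Delta> k (j k f) z * (B k f z - B (Suc k) f z)" for k f z
  define c0 where "c0 f z = c 0 (j 0 f) z" for f z
  have Bm [measurable]: "B k f \<in> borel_measurable Q" for k f unfolding B_def by measurable
  have pam [measurable]: "pa k f \<in> borel_measurable Q" and pbm [measurable]: "pb k f \<in> borel_measurable Q"
    and c0m [measurable]: "c0 f \<in> borel_measurable Q" for k f
    unfolding pa_def pb_def c0_def by measurable
  have \<Delta>0: "0 \<le> \<Delta> k (j k f) z" if "f \<in> I" "z \<in> space Q" for f k z
    using near[OF that, of k] by linarith
  have B01: "B k f z = 0 \<or> B k f z = 1" for k f z unfolding B_def by (auto simp: of_bool_def)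
  have Ble: "B (Suc k) f z \<le> B k f z" for k f z unfolding B_def by auto
  have BD: "\<Delta> i (j i f) z \<le> a i" if "B k f z \<noteq> 0" "i \<le> k" for i k f z
    using that unfolding B_def by auto
  \<comment> \<open>\<open>a 0\<close> dominates all widths, so nothing is discarded at level 0, as
    the telescoping requires.\<close>
  have B0: "B 0 f z = 1" if "f \<in> I" "z \<in> space Q" for f z
    using \<Delta>b[OF that, of 0] unfolding B_def by simp
  have cdiff: "\<bar>c (Suc k) (j (Suc k) f) z - c k (j k f) z\<bar> \<le> \<Delta> (Suc k) (j (Suc k) f) z + \<Delta> k (j k f) z"
    if "f \<in> I" "z \<in> space Q" for f k z
    using near[OF that, of k] near[OF that, of "Suc k"] by linarith
  have pab: "\<bar>pa k f z\<bar> \<le> 2 * a k" if fz: "f \<in> I" "z \<in> space Q" for k f z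
  proof (cases "B (Suc k) f z = 0")
    case True then show ?thesis using a(1)[of k] by (simp add: pa_def)
  next
    case False
    then show ?thesis
      using cdiff[OF fz, of k] BD[OF False, of k] BD[OF False, of "Suc k"] a(2)[of k] B01[of "Suc k" f z]
      by (auto simp: pa_def)
  qed
  have pbb: "\<bar>pb k f z\<bar> \<le> 2 * a k" if fz: "f \<in> I" "z \<in> space Q" for k f z
  proof (cases "B k f z = 0")
    case True then show ?thesis using a(1)[of k] Ble[of k f z] B01[of "Suc k" f z] by (auto simp: pb_def)
  next
    case False
    then show ?thesis using BD[OF False, of k] \<Delta>0[OF fz, of k] B01[of k f z] B01[of "Suc k" f z] a(1)[of k]
      by (auto simp: pb_def)
  qed
  have D2int: "integrable Q (\<lambda>z. (\<Delta> k (j k f) z)\<^sup>2)" if f: "f \<in> I" for k f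
  proof (rule integrable_bdd[of _ "(a 0)\<^sup>2"])
    fix z assume z: "z \<in> space Q"
    from power_mono[OF \<Delta>b[OF f z] \<Delta>0[OF f z], of k 2] show "\<bar>(\<Delta> k (j k f) z)\<^sup>2\<bar> \<le> (a 0)\<^sup>2" by simp
  qed simp
  have v0: "0 \<le> v k" if "f \<in> I" for k f
    using order_trans[OF _ \<Delta>v[OF that, of k]] by (simp add: integral_nonneg_AE)
  have pav: "(\<integral>z. (pa k f z)\<^sup>2 \<partial>Q) \<le> 4 * v k" if f: "f \<in> I" for k f
  proof -
    have "(\<integral>z. (pa k f z)\<^sup>2 \<partial>Q) \<le> (\<integral>z. 2 * (\<Delta> (Suc k) (j (Suc k) f) z)\<^sup>2 + 2 * (\<Delta> k (j k f) z)\<^sup>2 \<partial>Q)"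
    proof (rule integral_mono')
      show "integrable Q (\<lambda>z. 2 * (\<Delta> (Suc k) (j (Suc k) f) z)\<^sup>2 + 2 * (\<Delta> k (j k f) z)\<^sup>2)"
        using D2int[OF f] by auto
      fix z assume z: "z \<in> space Q"
      have "(pa k f z)\<^sup>2 \<le> (c (Suc k) (j (Suc k) f) z - c k (j k f) z)\<^sup>2"
        using B01[of "Suc k" f z] by (auto simp: pa_def)
      also have "\<dots> \<le> (\<Delta> (Suc k) (j (Suc k) f) z + \<Delta> k (j k f) z)\<^sup>2"
        using power_mono[OF cdiff[OF f z], of k 2] by simp
      also have "\<dots> \<le> 2 * (\<Delta> (Suc k) (j (Suc k) f) z)\<^sup>2 + 2 * (\<Delta> k (j k f) z)\<^sup>2"
        using sum_squares_bound[of "\<Delta> (Suc k) (j (Suc k) f) z" "\<Delta> k (j k f) z"]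
        by (simp add: power2_sum)
      finally show "(pa k f z)\<^sup>2 \<le> \<dots>" .
    qed auto
    also have "\<dots> = 2 * (\<integral>z. (\<Delta> (Suc k) (j (Suc k) f) z)\<^sup>2 \<partial>Q) + 2 * (\<integral>z. (\<Delta> k (j k f) z)\<^sup>2 \<partial>Q)"
      using D2int[OF f] by simp
    also have "\<dots> \<le> 4 * v k" using \<Delta>v[OF f, of k] \<Delta>v[OF f, of "Suc k"] v[of k] by linarith
    finally show ?thesis .
  qed
  have pbv: "(\<integral>z. (pb k f z)\<^sup>2 \<partial>Q) \<le> v k" if f: "f \<in> I" for k f
  proof -
    have "(\<integral>z. (pb k f z)\<^sup>2 \<partial>Q) \<le> (\<integral>z. (\<Delta> k (j k f) z)\<^sup>2 \<partial>Q)"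
    proof (rule integral_mono'[OF D2int[OF f]])
      fix z assume "z \<in> space Q"
      have "pb k f z = 0 \<or> pb k f z = \<Delta> k (j k f) z"
        using B01[of k f z] B01[of "Suc k" f z] Ble[of k f z] by (auto simp: pb_def)
      then show "(pb k f z)\<^sup>2 \<le> (\<Delta> k (j k f) z)\<^sup>2" by auto
    qed simp
    then show ?thesis using \<Delta>v[OF f, of k] by linarith
  qed
  \<comment> \<open>\<open>pb\<close> is nonnegative, so its mean counts. Where it is nonzero the
    width at level \<open>k + 1\<close> exceeds \<open>a (Suc k)\<close>; multiplying by that width
    over its threshold only increases \<open>pb\<close>, and a product of two widths is controlled
    by second moments. The 4 is the largest ratio of successive thresholds.\<close>
  have bias: "(\<integral>z. pb k f z \<partial>Q) \<le> 4 * v k / a k" if f: "f \<in> I" for k f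
  proof -
    have "(\<integral>z. pb k f z \<partial>Q) \<le> (\<integral>z. ((\<Delta> k (j k f) z)\<^sup>2 + (\<Delta> (Suc k) (j (Suc k) f) z)\<^sup>2) / (2 * a (Suc k)) \<partial>Q)"
    proof (rule integral_mono')
      show "integrable Q (\<lambda>z. ((\<Delta> k (j k f) z)\<^sup>2 + (\<Delta> (Suc k) (j (Suc k) f) z)\<^sup>2) / (2 * a (Suc k)))"
        using D2int[OF f] by auto
      fix z assume z: "z \<in> space Q"
      let ?x = "\<Delta> k (j k f) z" and ?w = "\<Delta> (Suc k) (j (Suc k) f) z"
      show "pb k f z \<le> (?x\<^sup>2 + ?w\<^sup>2) / (2 * a (Suc k))"
      proof (cases "B k f z = 1 \<and> B (Suc k) f z = 0")
        case True
        then have "a (Suc k) \<le> ?w"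
          unfolding B_def by (auto simp: le_Suc_eq split: if_splits)
        then have "?x * a (Suc k) \<le> ?x * ?w" using \<Delta>0[OF f z] by (intro mult_left_mono) auto
        then have "2 * (?x * a (Suc k)) \<le> ?x\<^sup>2 + ?w\<^sup>2" using sum_squares_bound[of ?x ?w] by simp
        then have "?x \<le> (?x\<^sup>2 + ?w\<^sup>2) / (2 * a (Suc k))" using a(1)[of "Suc k"] by (simp add: field_simps)
        then show ?thesis using True by (simp add: pb_def)
      next
        case False
        then have "pb k f z = 0" using B01[of k f z] B01[of "Suc k" f z] Ble[of k f z] by (auto simp: pb_def)
        then show ?thesis using a(1)[of "Suc k"] by simp
      qed
    qed (use a(1)[of "Suc k"] in auto)
    also have "\<dots> = ((\<integral>z. (\<Delta> k (j k f) z)\<^sup>2 \<partial>Q) + (\<integral>z. (\<Delta> (Suc k) (j (Suc k) f) z)\<^sup>2 \<partial>Q)) / (2 * a (Suc k))"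
      using D2int[OF f] by simp
    also have "\<dots> \<le> (2 * v k) / (2 * a (Suc k))"
      using \<Delta>v[OF f, of k] \<Delta>v[OF f, of "Suc k"] v[of k] a(1)[of "Suc k"] by (intro divide_right_mono) auto
    also have "\<dots> = v k / a (Suc k)" by simp
    also have "\<dots> \<le> v k / (a k / 4)"
      using a(1)[of "Suc k"] a(1)[of k] a(3)[of k] v0[OF f, of k] by (intro divide_left_mono) auto
    finally show ?thesis by (simp add: mult.commute)
  qed
  \<comment> \<open>The entropies in \<open>y\<close> pay for the number of paths, and the summand
    \<open>real (Suc k)\<close> leaves a geometric factor, so the failure probabilities of all
    levels add up to a multiple of \<open>exp (- L)\<close> independent of \<open>K\<close>.\<close>
  have cardexp: "real (\<Prod>i\<le>k. m i) * exp (- y k) \<le> exp (- L) * (1/2) ^ Suc k" for k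
  proof -
    have "real (\<Prod>i\<le>k. m i) \<le> (\<Prod>i\<le>k. exp (h i))"
      unfolding of_nat_prod by (rule prod_mono) (use mh in auto)
    then have "real (\<Prod>i\<le>k. m i) \<le> exp (\<Sum>i\<le>k. h i)" by (simp add: exp_sum)
    then have "real (\<Prod>i\<le>k. m i) * exp (- y k) \<le> exp (\<Sum>i\<le>k. h i) * exp (- y k)"
      by (rule mult_right_mono) simp
    also have "\<dots> = exp (- L) * exp (- real (Suc k))" by (simp add: y exp_add[symmetric])
    also have "exp (- real (Suc k)) = exp (- 1) ^ Suc k" using exp_of_nat_mult[of "Suc k" "-1::real"] by simp
    also have "\<dots> \<le> (1/2) ^ Suc k"
    proof (rule power_mono)
      have "2 \<le> exp (1::real)" using exp_ge_add_one_self[of 1] by simp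
      then show "exp (- 1) \<le> (1 / 2 :: real)" by (simp add: exp_minus field_simps)
    qed simp
    finally show ?thesis by simp
  qed
  have "\<exists>E\<in>sets M. prob E \<le> real (\<Prod>i\<le>0. m i) * exp (- y 0) \<and>
    (\<forall>\<omega>\<in>space M - E. \<forall>f\<in>I. (\<Sum>i=1..n. c0 f (Z i \<omega>)) \<le>
       n * ((\<integral>z. c0 f z \<partial>Q) + (1 / a 0) * (4 * v 0)) + y 0 / (1 / a 0))"
  proof (rule exp_tail_union)
    have eq: "c0 f = (\<lambda>p. c 0 (p 0)) (\<lambda>i\<in>{..0}. j i f)" for f by (auto simp: c0_def)
    show "finite (c0 ` I)" "card (c0 ` I) \<le> (\<Prod>i\<le>0. m i)"
      by (rule card_image_paths[where \<Psi> = "\<lambda>p. c 0 (p 0)" and j = j and \<psi> = c0, OF eq jm]; assumption)+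
    show "1 / a 0 * a 0 \<le> 1" "0 < 1 / a 0" using a(1)[of 0] by simp_all
  qed (use cb c0v in \<open>auto simp: c0_def\<close>)
  then obtain E0 where E0: "E0 \<in> sets M" "prob E0 \<le> real (\<Prod>i\<le>0. m i) * exp (- y 0)"
    "\<And>\<omega> f. \<omega> \<in> space M - E0 \<Longrightarrow> f \<in> I \<Longrightarrow> (\<Sum>i=1..n. c0 f (Z i \<omega>)) \<le>
       n * ((\<integral>z. c0 f z \<partial>Q) + (1 / a 0) * (4 * v 0)) + y 0 / (1 / a 0)"
    by blast
  have path: "Bex (sets M) (\<lambda>E. prob E \<le> real (\<Prod>i\<le>Suc k. m i) * exp (- y (Suc k)) \<and>
    (\<forall>\<omega>\<in>space M - E. \<forall>f\<in>I. (\<Sum>i=1..n. pa k f (Z i \<omega>)) \<le>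
       n * ((\<integral>z. pa k f z \<partial>Q) + (1 / (2 * a k)) * (4 * v k)) + y (Suc k) / (1 / (2 * a k))))"
    "Bex (sets M) (\<lambda>E. prob E \<le> real (\<Prod>i\<le>Suc k. m i) * exp (- y (Suc k)) \<and>
    (\<forall>\<omega>\<in>space M - E. \<forall>f\<in>I. (\<Sum>i=1..n. pb k f (Z i \<omega>)) \<le>
       n * ((\<integral>z. pb k f z \<partial>Q) + (1 / (2 * a k)) * v k) + y (Suc k) / (1 / (2 * a k))))" for k
  proof -
    \<comment> \<open>\<open>BB\<close> is \<open>B\<close> as a function of the index path, the
      form in which paths can be counted.\<close>
    define BB :: "nat \<Rightarrow> (nat \<Rightarrow> nat) \<Rightarrow> 'z \<Rightarrow> real"
      where "BB k p z = of_bool (\<forall>i\<le>k. \<Delta> i (p i) z \<le> a i)" for k p z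
    let ?\<Psi>a = "\<lambda>p z. (c (Suc k) (p (Suc k)) z - c k (p k) z) * BB (Suc k) p z"
    let ?\<Psi>b = "\<lambda>p z. \<Delta> k (p k) z * (BB k p z - BB (Suc k) p z)"
    have Beq: "B k' f = BB k' (\<lambda>i\<in>{..Suc k}. j i f)" if "k' \<le> Suc k" for k' f
      using that by (auto simp: B_def BB_def fun_eq_iff)
    have eqa: "pa k f = ?\<Psi>a (\<lambda>i\<in>{..Suc k}. j i f)" for f
      by (simp add: pa_def fun_eq_iff Beq)
    have eqb: "pb k f = ?\<Psi>b (\<lambda>i\<in>{..Suc k}. j i f)" for f
      by (simp add: pb_def fun_eq_iff Beq)
    have l: "0 < 1 / (2 * a k)" "1 / (2 * a k) * (2 * a k) \<le> 1" using a(1)[of k] by simp_all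
    show "Bex (sets M) (\<lambda>E. prob E \<le> real (\<Prod>i\<le>Suc k. m i) * exp (- y (Suc k)) \<and>
    (\<forall>\<omega>\<in>space M - E. \<forall>f\<in>I. (\<Sum>i=1..n. pa k f (Z i \<omega>)) \<le>
       n * ((\<integral>z. pa k f z \<partial>Q) + (1 / (2 * a k)) * (4 * v k)) + y (Suc k) / (1 / (2 * a k))))"
      by (rule exp_tail_union[OF card_image_paths[where \<Psi> = ?\<Psi>a and j = j and \<psi> = "pa k", OF eqa jm] pam pab l pav])
    show "Bex (sets M) (\<lambda>E. prob E \<le> real (\<Prod>i\<le>Suc k. m i) * exp (- y (Suc k)) \<and>
    (\<forall>\<omega>\<in>space M - E. \<forall>f\<in>I. (\<Sum>i=1..n. pb k f (Z i \<omega>)) \<le>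
       n * ((\<integral>z. pb k f z \<partial>Q) + (1 / (2 * a k)) * v k) + y (Suc k) / (1 / (2 * a k))))"
      by (rule exp_tail_union[OF card_image_paths[where \<Psi> = ?\<Psi>b and j = j and \<psi> = "pb k", OF eqb jm] pbm pbb l pbv])
  qed
  obtain Ea where Ea: "\<And>k. Ea k \<in> sets M" "\<And>k. prob (Ea k) \<le> real (\<Prod>i\<le>Suc k. m i) * exp (- y (Suc k))"
    "\<And>k \<omega> f. \<omega> \<in> space M - Ea k \<Longrightarrow> f \<in> I \<Longrightarrow> (\<Sum>i=1..n. pa k f (Z i \<omega>)) \<le>
       n * ((\<integral>z. pa k f z \<partial>Q) + (1 / (2 * a k)) * (4 * v k)) + y (Suc k) / (1 / (2 * a k))"
    using path(1) unfolding Bex_def by metis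
  obtain Eb where Eb: "\<And>k. Eb k \<in> sets M" "\<And>k. prob (Eb k) \<le> real (\<Prod>i\<le>Suc k. m i) * exp (- y (Suc k))"
    "\<And>k \<omega> f. \<omega> \<in> space M - Eb k \<Longrightarrow> f \<in> I \<Longrightarrow> (\<Sum>i=1..n. pb k f (Z i \<omega>)) \<le>
       n * ((\<integral>z. pb k f z \<partial>Q) + (1 / (2 * a k)) * v k) + y (Suc k) / (1 / (2 * a k))"
    using path(2) unfolding Bex_def by metis
  define E where "E = E0 \<union> ((\<Union>k<K. Ea k) \<union> (\<Union>k<K. Eb k))"
  have Em: "E \<in> sets M" unfolding E_def using E0 Ea Eb by auto
  have "prob E \<le> prob E0 + (prob (\<Union>k<K. Ea k) + prob (\<Union>k<K. Eb k))"
    unfolding E_def using E0(1) Ea(1) Eb(1)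
    by (intro order_trans[OF measure_Un_le] add_left_mono measure_Un_le) auto
  also have "\<dots> \<le> exp (- L) * (1/2) + ((\<Sum>k<K. exp (- L) * (1/2) ^ Suc (Suc k)) + (\<Sum>k<K. exp (- L) * (1/2) ^ Suc (Suc k)))"
  proof (intro add_mono)
    show "prob E0 \<le> exp (- L) * (1/2)" using order_trans[OF E0(2) cardexp[of 0]] by simp
    show "prob (\<Union>k<K. Ea k) \<le> (\<Sum>k<K. exp (- L) * (1/2) ^ Suc (Suc k))"
      by (rule order_trans[OF finite_measure_subadditive_finite sum_mono])
        (use Ea(1) order_trans[OF Ea(2) cardexp] in auto)
    show "prob (\<Union>k<K. Eb k) \<le> (\<Sum>k<K. exp (- L) * (1/2) ^ Suc (Suc k))"
      by (rule order_trans[OF finite_measure_subadditive_finite sum_mono])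
        (use Eb(1) order_trans[OF Eb(2) cardexp] in auto)
  qed
  also have "\<dots> = exp (- L) * (1/2 + (1/2) * (\<Sum>k<K. (1/2) ^ k))"
  proof -
    have "(\<Sum>k<K. exp (- L) * (1/2) ^ Suc (Suc k)) = exp (- L) / 4 * (\<Sum>k<K. (1/2) ^ k)"
      unfolding sum_distrib_left by (rule sum.cong) simp_all
    then show ?thesis by (simp add: algebra_simps)
  qed
  also have "\<dots> \<le> exp (- L) * 2"
  proof (intro mult_left_mono)
    have "(\<Sum>k<K. (1/2::real) ^ k) \<le> 2" by (simp add: sum_gp_strict)
    then show "1/2 + (1/2) * (\<Sum>k<K. (1/2::real) ^ k) \<le> 2" by simp
  qed simp
  finally have Ep: "prob E \<le> 2 * exp (- L)" by simp
  have main: "(\<Sum>i=1..n. \<phi> f (Z i \<omega>)) \<le>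
       n * (\<integral>z. \<phi> f z \<partial>Q) + (4 * n * v 0 / a 0 + a 0 * y 0)
       + (\<Sum>k<K. 11 * n * v k / a k + 4 * a k * y (Suc k)) + 2 * n * a K"
    if \<omega>: "\<omega> \<in> space M - E" and f: "f \<in> I" for \<omega> f
  proof -
    define S where "S g = (\<Sum>i=1..n. g (Z i \<omega>))" for g :: "'z \<Rightarrow> real"
    have tele: "\<phi> f z = c0 f z + (\<Sum>k<K. pa k f z + (\<phi> f z - c k (j k f) z) * (B k f z - B (Suc k) f z))
        + (\<phi> f z - c K (j K f) z) * B K f z" if z: "z \<in> space Q" for z
      using chaining_telescope[of "\<lambda>k. B k f z" "\<phi> f z" "\<lambda>k. c k (j k f) z" K] B0[OF f z]
      by (simp add: c0_def pa_def)
    have rem: "\<bar>(\<phi> f z - c k (j k f) z) * (B k f z - B (Suc k) f z)\<bar> \<le> pb k f z" if z: "z \<in> space Q" for z k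
      unfolding pb_def abs_mult using near[OF f z, of k] Ble[of k f z] by (intro mult_mono) auto
    have last: "\<bar>(\<phi> f z - c K (j K f) z) * B K f z\<bar> \<le> a K" if z: "z \<in> space Q" for z
    proof (cases "B K f z = 0")
      case True then show ?thesis using a(1)[of K] by simp
    next
      case False
      then show ?thesis using near[OF f z, of K] BD[OF False, of K] B01[of K f z] by auto
    qed
    have up: "\<phi> f z \<le> c0 f z + (\<Sum>k<K. pa k f z + pb k f z) + a K" if z: "z \<in> space Q" for z
    proof -
      have "(\<Sum>k<K. pa k f z + (\<phi> f z - c k (j k f) z) * (B k f z - B (Suc k) f z)) \<le> (\<Sum>k<K. pa k f z + pb k f z)"
        by (intro sum_mono add_left_mono) (use rem[OF z] abs_le_D1 in blast)
      then show ?thesis using tele[OF z] last[OF z] by linarith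
    qed
    \<comment> \<open>This lower bound is only integrated: it turns the summed means of the links
      back into the mean of \<open>\<phi> f\<close>, at the price of a second bias and a second
      \<open>a K\<close>.\<close>
    have low: "c0 f z + (\<Sum>k<K. pa k f z - pb k f z) - a K \<le> \<phi> f z" if z: "z \<in> space Q" for z
    proof -
      have "(\<Sum>k<K. pa k f z - pb k f z) \<le> (\<Sum>k<K. pa k f z + (\<phi> f z - c k (j k f) z) * (B k f z - B (Suc k) f z))"
      proof (intro sum_mono)
        fix k show "pa k f z - pb k f z \<le> pa k f z + (\<phi> f z - c k (j k f) z) * (B k f z - B (Suc k) f z)"
          using rem[OF z, of k] by linarith
      qed
      then show ?thesis using tele[OF z] last[OF z] by linarith
    qed
    have ipa: "integrable Q (pa k f)" and ipb: "integrable Q (pb k f)" for k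
      by (rule integrable_bdd[OF pam pab[OF f]], assumption) (rule integrable_bdd[OF pbm pbb[OF f]], assumption)
    have ic0: "integrable Q (c0 f)"
      by (rule integrable_bdd[OF c0m, of _ "a 0"]) (use cb[OF f] in \<open>auto simp: c0_def\<close>)
    have i\<phi>: "integrable Q (\<phi> f)"
    proof (rule integrable_bdd[OF \<phi>m[OF f], of "2 * a 0"])
      fix z assume z: "z \<in> space Q"
      show "\<bar>\<phi> f z\<bar> \<le> 2 * a 0" using near[OF f z, of 0] cb[OF f z, of 0] \<Delta>b[OF f z, of 0] by linarith
    qed
    have "(\<integral>z. c0 f z + (\<Sum>k<K. pa k f z - pb k f z) - a K \<partial>Q) \<le> (\<integral>z. \<phi> f z \<partial>Q)"
      by (rule integral_mono) (use ic0 ipa ipb i\<phi> low in auto)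
    then have low': "(\<integral>z. c0 f z \<partial>Q) + (\<Sum>k<K. (\<integral>z. pa k f z \<partial>Q) - (\<integral>z. pb k f z \<partial>Q)) - a K \<le> (\<integral>z. \<phi> f z \<partial>Q)"
      using ic0 ipa ipb by (simp add: Q.prob_space)
    have "S (\<phi> f) \<le> (\<Sum>i=1..n. c0 f (Z i \<omega>) + (\<Sum>k<K. pa k f (Z i \<omega>) + pb k f (Z i \<omega>)) + a K)"
      unfolding S_def using up Z_space \<omega> by (intro sum_mono) auto
    also have "\<dots> = S (c0 f) + (\<Sum>k<K. S (pa k f) + S (pb k f)) + n * a K"
      unfolding S_def by (simp add: sum.distrib sum.swap[of _ "{Suc 0..n}" "{..<K}"])
    also have "\<dots> \<le> (n * (\<integral>z. c0 f z \<partial>Q) + 4 * n * v 0 / a 0 + a 0 * y 0)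
       + (\<Sum>k<K. n * ((\<integral>z. pa k f z \<partial>Q) - (\<integral>z. pb k f z \<partial>Q)) + (11 * n * v k / a k + 4 * a k * y (Suc k))) + n * a K"
    proof (rule add_mono[OF add_mono[OF _ sum_mono] order_refl])
      show "S (c0 f) \<le> n * (\<integral>z. c0 f z \<partial>Q) + 4 * n * v 0 / a 0 + a 0 * y 0"
        using E0(3)[OF _ f, of \<omega>] \<omega> by (simp add: S_def E_def algebra_simps)
      fix k assume k: "k \<in> {..<K}"
      have 1: "S (pa k f) \<le> n * (\<integral>z. pa k f z \<partial>Q) + 2 * (n * v k / a k) + 2 * (a k * y (Suc k))"
        using Ea(3)[OF _ f, of \<omega> k] \<omega> k by (simp add: S_def E_def algebra_simps)
      have 2: "S (pb k f) \<le> n * (\<integral>z. pb k f z \<partial>Q) + (n * v k / a k) / 2 + 2 * (a k * y (Suc k))"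
        using Eb(3)[OF _ f, of \<omega> k] \<omega> k by (simp add: S_def E_def algebra_simps)
      have 3: "n * (\<integral>z. pb k f z \<partial>Q) \<le> 4 * (n * v k / a k)"
        using mult_left_mono[OF bias[OF f, of k], of n] by (simp add: mult.left_commute)
      have 4: "0 \<le> n * v k / a k" using v0[OF f, of k] a(1)[of k] by simp
      \<comment> \<open>To match \<open>low\<close> the mean of \<open>pb\<close> is wanted with a
        minus sign; the exchange costs twice the bias, that is 8. With 2 and 1/2 from the
        exponential bounds the total stays below 11.\<close>
      have "S (pa k f) + S (pb k f) \<le> n * (\<integral>z. pa k f z \<partial>Q) - n * (\<integral>z. pb k f z \<partial>Q) + (11 * (n * v k / a k) + 4 * (a k * y (Suc k)))"
      proof -
        define r t where "r = n * v k / a k" and "t = a k * y (Suc k)"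
        show ?thesis using 1 2 3 4 unfolding r_def[symmetric] t_def[symmetric] by linarith
      qed
      then show "S (pa k f) + S (pb k f) \<le> n * ((\<integral>z. pa k f z \<partial>Q) - (\<integral>z. pb k f z \<partial>Q)) + (11 * n * v k / a k + 4 * a k * y (Suc k))"
        by (simp add: right_diff_distrib)
    qed
    also have "\<dots> = n * ((\<integral>z. c0 f z \<partial>Q) + (\<Sum>k<K. (\<integral>z. pa k f z \<partial>Q) - (\<integral>z. pb k f z \<partial>Q)) - a K)
       + (4 * n * v 0 / a 0 + a 0 * y 0) + (\<Sum>k<K. 11 * n * v k / a k + 4 * a k * y (Suc k)) + 2 * n * a K"
      by (simp add: sum.distrib sum_subtractf sum_distrib_left algebra_simps)
    also have "\<dots> \<le> n * (\<integral>z. \<phi> f z \<partial>Q)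
       + (4 * n * v 0 / a 0 + a 0 * y 0) + (\<Sum>k<K. 11 * n * v k / a k + 4 * a k * y (Suc k)) + 2 * n * a K"
      using mult_left_mono[OF low', of n] by simp
    finally show ?thesis by (simp add: S_def)
  qed
  show ?thesis using Em Ep main by blast
qed

section \<open>The regression model\<close>

lemma Lq_norm_2_le_iff:
  assumes "0 \<le> \<delta>"
  shows "Lq_norm N 2 g \<le> ennreal \<delta> \<longleftrightarrow> (\<integral>\<^sup>+ x. ennreal ((g x)\<^sup>2) \<partial>N) \<le> ennreal (\<delta>\<^sup>2)"
proof -
  define I where "I = (\<integral>\<^sup>+ x. ennreal ((g x)\<^sup>2) \<partial>N)"
  have eq: "Lq_norm N 2 g = (if I = \<infinity> then \<infinity> else ennreal (enn2real I powr (1 / 2)))"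
    by (simp add: Lq_norm_def I_def Let_def)
  show ?thesis
  proof (cases I)
    case (real r)
    have "r powr (1 / 2) \<le> \<delta> \<longleftrightarrow> r \<le> \<delta>\<^sup>2"
      using real(1) assms by (simp add: powr_half_sqrt real_sqrt_le_iff' sqrt_le_D real_le_lsqrt)
    then show ?thesis using real assms by (simp add: eq I_def[symmetric])
  next
    case top
    then show ?thesis by (simp add: eq I_def[symmetric] top_unique)
  qed
qed

lemma nn_integral_powr_le_of_Lq_norm_le:
  assumes "0 < q" "0 \<le> t" "Lq_norm N q g \<le> ennreal t"
  shows "(\<integral>\<^sup>+ x. ennreal (\<bar>g x\<bar> powr q) \<partial>N) \<le> ennreal (t powr q)"
proof -
  define I where "I = (\<integral>\<^sup>+ x. ennreal (\<bar>g x\<bar> powr q) \<partial>N)"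
  have eq: "Lq_norm N q g = (if I = \<infinity> then \<infinity> else ennreal (enn2real I powr (1 / q)))"
    by (simp add: Lq_norm_def I_def Let_def)
  have "I \<le> ennreal (t powr q)"
  proof (cases I)
    case (real r)
    then have "r powr (1 / q) \<le> t" using assms by (simp add: eq)
    then have "(r powr (1 / q)) powr q \<le> t powr q" using assms by (intro powr_mono2) auto
    then have "r \<le> t powr q" using real(1) assms(1) by (simp add: powr_powr)
    then show ?thesis using real by (simp add: ennreal_leI)
  next
    case top
    then show ?thesis using assms by (simp add: eq top_unique)
  qed
  then show ?thesis by (simp add: I_def)
qed

lemma square_integral_le:
  fixes g :: "'a \<Rightarrow> real"
  assumes "(\<integral>\<^sup>+ x. ennreal ((g x)\<^sup>2) \<partial>N) \<le> ennreal r" "0 \<le> r"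
  shows "(\<integral>x. (g x)\<^sup>2 \<partial>N) \<le> r"
  using assms by (rule integral_real_bounded[rotated])

text \<open>The setting for a nondegenerate class: \<Phi> > 0 makes every term of the rate positive.
  The metric space enters as the measurable space \<open>B\<close>, and the case \<Phi> = 0 is
  settled in the theorem itself.\<close>

locale lse_setup =
  fixes M :: "'w measure" and B :: "'x measure" and P X Y Xs Ys f0 F
    and \<Phi> A \<sigma> \<alpha> s q C\<^sub>0 :: real
  assumes model: "regression_model M B X Y Xs Ys f0"
    and P_def: "P = distr M B X"
    and F_meas: "F \<subseteq> borel_measurable B"
    and F_bdd: "\<And>f x. f \<in> F \<Longrightarrow> x \<in> space B \<Longrightarrow> \<bar>f x\<bar> \<le> \<Phi>"
    and \<Phi>_pos: "0 < \<Phi>" and A_pos: "0 < A" and \<sigma>_pos: "0 < \<sigma>"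
    and entropy: "\<And>\<zeta>. 0 < \<zeta> \<Longrightarrow> \<exists>N. bracketing_number P \<zeta> F = enat N \<and> ln (real N) \<le> A * \<zeta> powr (- \<alpha>)"
    and f0_F: "f0 \<in> F"
    and cond_var: "AE \<omega> in M. nn_cond_exp M (vimage_algebra (space M) X B)
          (\<lambda>\<omega>. ennreal ((Y \<omega> - f0 (X \<omega>))\<^sup>2)) \<omega> \<le> ennreal (\<sigma>\<^sup>2)"
    and envelope_meas: "\<And>\<delta>. 0 < \<delta> \<Longrightarrow> local_envelope P F f0 \<delta> \<in> borel_measurable B"
    and envelope_Lq: "\<And>\<delta>. 0 < \<delta> \<Longrightarrow>
          Lq_norm M q (\<lambda>\<omega>. (\<bar>Y \<omega> - f0 (X \<omega>)\<bar> + \<Phi>) * local_envelope P F f0 \<delta> (X \<omega>))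
            \<le> ennreal (C\<^sub>0 * \<Phi>\<^sup>2 * \<delta> powr s)"
    and params: "0 \<le> \<alpha>" "\<alpha> < 2" "0 \<le> s" "s \<le> 1" "2 \<le> q" "0 < C\<^sub>0"
begin

sublocale prob_space M
  using model by (simp add: regression_model_def)

abbreviation N where "N \<equiv> B \<Otimes>\<^sub>M (borel :: real measure)"

definition Q where "Q = distr M N (\<lambda>\<omega>. (X \<omega>, Y \<omega>))"

lemma X_measurable [measurable]: "X \<in> measurable M B"
  and Y_integrable: "integrable M Y"
  and f0_measurable [measurable]: "f0 \<in> borel_measurable B"
  using model by (auto simp: regression_model_def)

lemma Y_measurable [measurable]: "Y \<in> borel_measurable M"
  using Y_integrable by auto

lemma F_measurable: "f \<in> F \<Longrightarrow> f \<in> borel_measurable B"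
  using F_meas by auto

lemma sets_Q [measurable_cong, simp]: "sets Q = sets N" by (simp add: Q_def)
lemma space_Q: "space Q = space B \<times> UNIV" by (simp add: Q_def space_pair_measure)
lemma sets_P [measurable_cong, simp]: "sets P = sets B" by (simp add: P_def)
lemma space_P [simp]: "space P = space B" by (simp add: P_def)

lemma iid_sample:
  assumes "1 \<le> n"
  shows "iid_sample M Q (\<lambda>i \<omega>. (Xs i \<omega>, Ys i \<omega>)) n"
proof
  have "indep_vars (\<lambda>_. N) (\<lambda>i \<omega>. (Xs i \<omega>, Ys i \<omega>)) {1..n}"
    by (rule indep_vars_subset[of _ _ "{1..}"]) (use model in \<open>auto simp: regression_model_def\<close>)
  then show "indep_vars (\<lambda>_. Q) (\<lambda>i \<omega>. (Xs i \<omega>, Ys i \<omega>)) {1..n}"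
    by (simp add: indep_vars_def2 space_Q space_pair_measure
      cong: measurable_cong_sets)
  show "distr M Q (\<lambda>\<omega>. (Xs i \<omega>, Ys i \<omega>)) = Q" if "i \<in> {1..n}" for i
    using model that unfolding regression_model_def
    by (metis (no_types, lifting) Q_def atLeastAtMost_iff distr_cong sets_Q)
qed (use assms in auto)

definition resid :: "'x \<times> real \<Rightarrow> real" where "resid z = snd z - f0 (fst z)"

lemma resid_measurable [measurable]: "resid \<in> borel_measurable N"
  unfolding resid_def by measurable

section \<open>Moments of the noise under the sampling law\<close>

lemma nn_integral_Q:
  "h \<in> borel_measurable N \<Longrightarrow> (\<integral>\<^sup>+ z. h z \<partial>Q) = (\<integral>\<^sup>+ \<omega>. h (X \<omega>, Y \<omega>) \<partial>M)"
  unfolding Q_def by (rule nn_integral_distr) measurable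

lemma nn_integral_P:
  "h \<in> borel_measurable B \<Longrightarrow> (\<integral>\<^sup>+ x. h x \<partial>P) = (\<integral>\<^sup>+ \<omega>. h (X \<omega>) \<partial>M)"
  unfolding P_def by (rule nn_integral_distr) measurable

lemma cond_subalgebra: "finite_measure_subalgebra M (vimage_algebra (space M) X B)"
proof
  have "X \<in> space M \<rightarrow> space B" using measurable_space[OF X_measurable] by auto
  then show "subalgebra M (vimage_algebra (space M) X B)"
    using measurable_sets[OF X_measurable]
    by (auto simp: subalgebra_def sets_vimage_algebra2)
qed

lemma comp_X_measurable:
  "g \<in> measurable B K \<Longrightarrow> (\<lambda>\<omega>. g (X \<omega>)) \<in> measurable (vimage_algebra (space M) X B) K"
  by (rule measurable_compose[OF measurable_vimage_algebra1])
    (use measurable_space[OF X_measurable] in auto)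

text \<open>The function of the covariate is pulled through the conditional expectation, whose
  nonnegative version asks for no integrability. This carries L2 distances under \<open>P\<close>
  over to noise-weighted ones under \<open>Q\<close> while noise and covariate may be
  dependent.\<close>

lemma resid_second_moment:
  assumes [measurable]: "g \<in> borel_measurable B"
  shows "(\<integral>\<^sup>+ z. ennreal ((resid z * g (fst z))\<^sup>2) \<partial>Q) \<le> ennreal (\<sigma>\<^sup>2) * (\<integral>\<^sup>+ x. ennreal ((g x)\<^sup>2) \<partial>P)"
proof -
  interpret sub: finite_measure_subalgebra M "vimage_algebra (space M) X B" by (rule cond_subalgebra)
  let ?C = "nn_cond_exp M (vimage_algebra (space M) X B) (\<lambda>\<omega>. ennreal ((Y \<omega> - f0 (X \<omega>))\<^sup>2))"
  have "(\<integral>\<^sup>+ z. ennreal ((resid z * g (fst z))\<^sup>2) \<partial>Q) = (\<integral>\<^sup>+ \<omega>. ennreal ((g (X \<omega>))\<^sup>2) * ennreal ((Y \<omega> - f0 (X \<omega>))\<^sup>2) \<partial>M)"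
    by (subst nn_integral_Q)
      (auto simp: resid_def power_mult_distrib ennreal_mult[symmetric] mult.commute)
  also have "\<dots> = (\<integral>\<^sup>+ \<omega>. ennreal ((g (X \<omega>))\<^sup>2) * ?C \<omega> \<partial>M)"
    by (rule sub.nn_cond_exp_intg[symmetric], rule comp_X_measurable) measurable
  also have "\<dots> \<le> (\<integral>\<^sup>+ \<omega>. ennreal (\<sigma>\<^sup>2) * ennreal ((g (X \<omega>))\<^sup>2) \<partial>M)"
    by (rule nn_integral_mono_AE, use cond_var in eventually_elim)
      (subst (2) mult.commute, rule mult_left_mono, simp_all)
  also have "\<dots> = ennreal (\<sigma>\<^sup>2) * (\<integral>\<^sup>+ x. ennreal ((g x)\<^sup>2) \<partial>P)"
    by (subst nn_integral_P) (auto simp: nn_integral_cmult)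
  finally show ?thesis .
qed

text \<open>The weight is the Lipschitz factor of the gain in \<open>gain_lipschitz\<close>, so
  bracket widths for \<open>F\<close> become widths for the gains. The constant bounds 8 \<sigma>^2
  + 32 \<Phi>^2, which comes from (a + b)^2 \<le> 2 a^2 + 2 b^2.\<close>

lemma weighted_second_moment:
  assumes [measurable]: "g \<in> borel_measurable B"
    and g: "(\<integral>\<^sup>+ x. ennreal ((g x)\<^sup>2) \<partial>P) \<le> ennreal r" "0 \<le> r"
  shows "(\<integral>\<^sup>+ z. ennreal (((2 * \<bar>resid z\<bar> + 4 * \<Phi>) * g (fst z))\<^sup>2) \<partial>Q) \<le> ennreal (32 * (\<sigma> + \<Phi>)\<^sup>2 * r)"
proof -
  have "(\<integral>\<^sup>+ z. ennreal (((2 * \<bar>resid z\<bar> + 4 * \<Phi>) * g (fst z))\<^sup>2) \<partial>Q)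
      \<le> (\<integral>\<^sup>+ z. 8 * ennreal ((resid z * g (fst z))\<^sup>2) + ennreal (32 * \<Phi>\<^sup>2) * ennreal ((g (fst z))\<^sup>2) \<partial>Q)"
  proof (rule nn_integral_mono)
    fix z
    have "(2 * \<bar>resid z\<bar> + 4 * \<Phi>)\<^sup>2 \<le> 8 * (resid z)\<^sup>2 + 32 * \<Phi>\<^sup>2"
      using sum_squares_bound[of "2 * \<bar>resid z\<bar>" "4 * \<Phi>"] by (simp add: power2_sum power_mult_distrib)
    then have "((2 * \<bar>resid z\<bar> + 4 * \<Phi>) * g (fst z))\<^sup>2 \<le> (8 * (resid z)\<^sup>2 + 32 * \<Phi>\<^sup>2) * (g (fst z))\<^sup>2"
      unfolding power_mult_distrib by (rule mult_right_mono) simp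
    also have "\<dots> = 8 * (resid z * g (fst z))\<^sup>2 + 32 * \<Phi>\<^sup>2 * (g (fst z))\<^sup>2"
      by (simp add: power_mult_distrib algebra_simps)
    finally have "ennreal (((2 * \<bar>resid z\<bar> + 4 * \<Phi>) * g (fst z))\<^sup>2) \<le> ennreal \<dots>" by (rule ennreal_leI)
    also have "\<dots> = 8 * ennreal ((resid z * g (fst z))\<^sup>2) + ennreal (32 * \<Phi>\<^sup>2) * ennreal ((g (fst z))\<^sup>2)"
      by (simp add: ennreal_plus ennreal_mult)
    finally show "ennreal (((2 * \<bar>resid z\<bar> + 4 * \<Phi>) * g (fst z))\<^sup>2) \<le> \<dots>" .
  qed
  also have "\<dots> = 8 * (\<integral>\<^sup>+ z. ennreal ((resid z * g (fst z))\<^sup>2) \<partial>Q) + ennreal (32 * \<Phi>\<^sup>2) * (\<integral>\<^sup>+ z. ennreal ((g (fst z))\<^sup>2) \<partial>Q)"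
    by (simp add: nn_integral_add nn_integral_cmult)
  also have "(\<integral>\<^sup>+ z. ennreal ((g (fst z))\<^sup>2) \<partial>Q) = (\<integral>\<^sup>+ x. ennreal ((g x)\<^sup>2) \<partial>P)"
    by (simp add: nn_integral_Q nn_integral_P)
  also have "8 * (\<integral>\<^sup>+ z. ennreal ((resid z * g (fst z))\<^sup>2) \<partial>Q) + ennreal (32 * \<Phi>\<^sup>2) * (\<integral>\<^sup>+ x. ennreal ((g x)\<^sup>2) \<partial>P)
      \<le> 8 * (ennreal (\<sigma>\<^sup>2) * ennreal r) + ennreal (32 * \<Phi>\<^sup>2) * ennreal r"
    by (intro add_mono mult_left_mono order_trans[OF resid_second_moment] g) auto
  also have "\<dots> = ennreal ((8 * \<sigma>\<^sup>2 + 32 * \<Phi>\<^sup>2) * r)"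
    using g(2) by (simp add: ennreal_mult distrib_right mult.assoc)
  also have "\<dots> \<le> ennreal (32 * (\<sigma> + \<Phi>)\<^sup>2 * r)"
    using g(2) \<Phi>_pos \<sigma>_pos by (intro ennreal_leI mult_right_mono) (auto simp: power2_sum)
  finally show ?thesis .
qed

text \<open>A bounded \<open>g\<close> passes through the conditional expectation of
  \<open>Y\<close>, which is \<open>f0 (X \<omega>)\<close>. Boundedness makes the product
  integrable, as the model states only that \<open>Y\<close> is.\<close>

lemma resid_orthogonal:
  assumes [measurable]: "g \<in> borel_measurable B" and g: "\<And>x. x \<in> space B \<Longrightarrow> \<bar>g x\<bar> \<le> K"
  shows "integrable Q (\<lambda>z. resid z * g (fst z))" "(\<integral>z. resid z * g (fst z) \<partial>Q) = 0"
proof -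
  interpret sub: finite_measure_subalgebra M "vimage_algebra (space M) X B" by (rule cond_subalgebra)
  let ?C = "real_cond_exp M (vimage_algebra (space M) X B) Y"
  have XS: "\<omega> \<in> space M \<Longrightarrow> X \<omega> \<in> space B" for \<omega> using measurable_space[OF X_measurable] .
  have i1: "integrable M (\<lambda>\<omega>. g (X \<omega>) * Y \<omega>)"
  proof (rule Bochner_Integration.integrable_bound[of _ "\<lambda>\<omega>. K * Y \<omega>"])
    show "AE \<omega> in M. norm (g (X \<omega>) * Y \<omega>) \<le> norm (K * Y \<omega>)"
    proof (rule AE_I2)
      fix \<omega> assume "\<omega> \<in> space M"
      then have "\<bar>g (X \<omega>)\<bar> \<le> \<bar>K\<bar>" using g[OF XS] by fastforce
      then show "norm (g (X \<omega>) * Y \<omega>) \<le> norm (K * Y \<omega>)" by (simp add: abs_mult mult_right_mono)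
    qed
  qed (use Y_integrable in auto)
  have gf: "\<bar>g x * f0 x\<bar> \<le> K * \<Phi>" if "x \<in> space B" for x
    using mult_mono[OF g[OF that] F_bdd[OF f0_F that]] g[OF that] by (auto simp: abs_mult)
  have i2: "integrable M (\<lambda>\<omega>. g (X \<omega>) * f0 (X \<omega>))"
    by (rule integrable_const_bound[of _ "K * \<Phi>"]) (use gf XS in auto)
  have "(\<integral>\<omega>. g (X \<omega>) * Y \<omega> \<partial>M) = (\<integral>\<omega>. g (X \<omega>) * ?C \<omega> \<partial>M)"
    by (rule sub.real_cond_exp_intg(2)[OF i1, symmetric]) (auto intro: comp_X_measurable)
  also have "\<dots> = (\<integral>\<omega>. g (X \<omega>) * f0 (X \<omega>) \<partial>M)"
    by (rule integral_cong_AE) (use model in \<open>auto simp: regression_model_def\<close>)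
  finally have eq: "(\<integral>\<omega>. g (X \<omega>) * Y \<omega> \<partial>M) = (\<integral>\<omega>. g (X \<omega>) * f0 (X \<omega>) \<partial>M)" .
  have e: "resid (X \<omega>, Y \<omega>) * g (fst (X \<omega>, Y \<omega>)) = g (X \<omega>) * Y \<omega> - g (X \<omega>) * f0 (X \<omega>)" for \<omega>
    by (simp add: resid_def algebra_simps)
  show "integrable Q (\<lambda>z. resid z * g (fst z))"
    unfolding Q_def by (subst integrable_distr_eq) (use i1 i2 in \<open>auto simp: e simp del: fst_conv\<close>)
  show "(\<integral>z. resid z * g (fst z) \<partial>Q) = 0"
    unfolding Q_def by (subst integral_distr) (use i1 i2 eq in \<open>auto simp: e simp del: fst_conv\<close>)
qed

lemma bracketing_family:
  assumes "0 < \<zeta>"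
  obtains m gL gU where "1 \<le> m" "real m \<le> exp (A * \<zeta> powr (- \<alpha>))"
    "\<And>i. gL i \<in> borel_measurable B" "\<And>i. gU i \<in> borel_measurable B"
    "\<And>i. i < m \<Longrightarrow> (\<integral>\<^sup>+ x. ennreal ((gU i x - gL i x)\<^sup>2) \<partial>P) \<le> ennreal (\<zeta>\<^sup>2)"
    "\<And>f. f \<in> F \<Longrightarrow> \<exists>i<m. \<forall>x\<in>space B. gL i x \<le> f x \<and> f x \<le> gU i x"
proof -
  from entropy[OF assms] obtain m where m: "bracketing_number P \<zeta> F = enat m" "ln (real m) \<le> A * \<zeta> powr (- \<alpha>)"
    by blast
  let ?S = "{enat m | m. 1 \<le> m \<and> bracketing_cover P \<zeta> F m}"
  \<comment> \<open>An infimum over the empty set would be \<infinity> in \<open>enat\<close>, so a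
    finite bracketing number is attained by a cover.\<close>
  have "?S \<noteq> {}"
  proof
    assume "?S = {}"
    then have "bracketing_number P \<zeta> F = \<infinity>" by (simp only: bracketing_number_def Inf_enat_def if_True simp_thms)
    then show False using m(1) by simp
  qed
  then have "Inf ?S \<in> ?S" by (auto simp: Inf_enat_def intro: LeastI)
  then have "enat m \<in> ?S" using m(1) by (simp add: bracketing_number_def)
  then have m1: "1 \<le> m" and "bracketing_cover P \<zeta> F m" by auto
  then obtain gL gU where g: "\<And>j. j < m \<Longrightarrow> gL j \<in> borel_measurable P" "\<And>j. j < m \<Longrightarrow> gU j \<in> borel_measurable P"
    "\<And>j. j < m \<Longrightarrow> Lq_norm P 2 (\<lambda>x. gU j x - gL j x) \<le> ennreal \<zeta>"
    "\<And>f. f \<in> F \<Longrightarrow> \<exists>j<m. \<forall>x\<in>space P. gL j x \<le> f x \<and> f x \<le> gU j x"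
    unfolding bracketing_cover_def by blast
  \<comment> \<open>Zero functions beyond \<open>m\<close> make measurability unconditional in the
    index, as the chaining bound asks.\<close>
  define gL' where "gL' i = (if i < m then gL i else (\<lambda>_. 0))" for i
  define gU' where "gU' i = (if i < m then gU i else (\<lambda>_. 0))" for i
  have me: "real m \<le> exp (A * \<zeta> powr (- \<alpha>))" 
  proof -
    have "real m = exp (ln (real m))" using m1 by simp
    also have "\<dots> \<le> exp (A * \<zeta> powr (- \<alpha>))" using m(2) by simp
    finally show ?thesis .
  qed
  show thesis
  proof (rule that[of m gL' gU', OF m1 me])
    show "gL' i \<in> borel_measurable B" "gU' i \<in> borel_measurable B" for i
      using g(1,2)[of i] by (auto simp: gL'_def gU'_def cong: measurable_cong_sets)
    show "(\<integral>\<^sup>+ x. ennreal ((gU' i x - gL' i x)\<^sup>2) \<partial>P) \<le> ennreal (\<zeta>\<^sup>2)" if "i < m" for i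
      using g(3)[OF that] that assms by (simp add: gL'_def gU'_def Lq_norm_2_le_iff)
    show "\<exists>i<m. \<forall>x\<in>space B. gL' i x \<le> f x \<and> f x \<le> gU' i x" if "f \<in> F" for f
      using g(4)[OF that] by (auto simp: gL'_def gU'_def)
  qed
qed

end

section \<open>Deviation of the truncated loss\<close>

text \<open>Compared with the differentiated geometric series. The weight \<open>k + 2\<close>
  stands for the \<open>k + 2\<close> levels of entropy accumulated by a path up to level
  \<open>k + 1\<close>.\<close>

lemma weighted_geometric_sum_le:
  fixes x :: real
  assumes "0 \<le> x" "x < 1"
  shows "(\<Sum>k<K. real (k + 2) * x ^ k) \<le> 2 / (1 - x)\<^sup>2"
proof -
  have sm: "(\<lambda>k. real (Suc k) * x ^ k) sums (1 / (1 - x)\<^sup>2)"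
    using geometric_deriv_sums[of x] assms by simp
  have "(\<Sum>k<K. real (k + 2) * x ^ k) \<le> (\<Sum>k<K. 2 * (real (Suc k) * x ^ k))"
  proof (rule sum_mono)
    fix k
    have "real (k + 2) * x ^ k \<le> (2 * real (Suc k)) * x ^ k"
      using assms by (intro mult_right_mono) auto
    then show "real (k + 2) * x ^ k \<le> 2 * (real (Suc k) * x ^ k)" by (simp only: mult.assoc)
  qed
  also have "\<dots> = 2 * (\<Sum>k<K. real (Suc k) * x ^ k)" by (simp add: sum_distrib_left)
  also have "(\<Sum>k<K. real (Suc k) * x ^ k) \<le> (\<Sum>k. real (Suc k) * x ^ k)"
    by (rule sum_le_suminf[OF sums_summable[OF sm]]) (use assms in auto)
  also have "\<dots> = 1 / (1 - x)\<^sup>2" using sm by (simp add: sums_iff)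
  finally show ?thesis by simp
qed

lemma geometric_sum_le:
  fixes x :: real
  assumes "0 \<le> x" "x < 1"
  shows "(\<Sum>k<K. x ^ k) \<le> 1 / (1 - x)"
  using sum_le_suminf[OF summable_geometric[of x], of "{..<K}"] suminf_geometric[of x] assms by simp

text \<open>Common ratio of the variance terms and the sup terms along the chain.\<close>

definition chain_ratio :: "real \<Rightarrow> real" where "chain_ratio \<alpha> = 2 powr (\<alpha> / 2 - 1)"
text \<open>Coefficient of the variance terms. The outer 4 is 32 / 8, from
  \<open>weighted_second_moment\<close> and the top threshold \<open>8 * T\<close>; the inner 4 and
  11 are those of the chaining bound at level 0 and at the links.\<close>

definition chain_const1 :: "real \<Rightarrow> real"
  where "chain_const1 \<alpha> = 4 * (4 + 11 / (1 - chain_ratio \<alpha>))"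
text \<open>Coefficient of the sup terms. The 8 is the top threshold in units of \<open>T\<close>,
  the 2 counts level 0 and the final remainder, and 32 is the link coefficient 4 times the bound 4
  on 2^\<alpha> times the 2 of \<open>weighted_geometric_sum_le\<close>.\<close>

definition chain_const2 :: "real \<Rightarrow> real"
  where "chain_const2 \<alpha> = 8 * (2 + 32 / (1 - chain_ratio \<alpha>)\<^sup>2)"

lemma chain_ratio_bounds: "\<alpha> < 2 \<Longrightarrow> 0 < chain_ratio \<alpha> \<and> chain_ratio \<alpha> < 1"
  using powr_less_mono[of "\<alpha> / 2 - 1" 0 2] by (simp add: chain_ratio_def)

lemma chain_const_pos: "\<alpha> < 2 \<Longrightarrow> 0 < chain_const1 \<alpha> \<and> 0 < chain_const2 \<alpha>"
  using chain_ratio_bounds[of \<alpha>] unfolding chain_const1_def chain_const2_def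
  by (auto intro!: mult_pos_pos add_pos_nonneg)

context lse_setup
begin

definition local_class :: "real \<Rightarrow> ('x \<Rightarrow> real) set" where
  "local_class \<delta> = {f \<in> F. Lq_norm P 2 (\<lambda>x. f x - f0 x) \<le> ennreal \<delta>}"

text \<open>Twice this function dominates the absolute gain of every member of the local class. It
  does not depend on \<open>f\<close>, so truncating by it leaves the bracket count
  unchanged.\<close>

definition loss_envelope :: "real \<Rightarrow> 'x \<times> real \<Rightarrow> real" where
  "loss_envelope \<delta> z = (\<bar>resid z\<bar> + \<Phi>) * local_envelope P F f0 \<delta> (fst z)"

text \<open>The decrease of the squared loss at \<open>z = (x, y)\<close> when \<open>f0\<close> is replaced by \<open>f\<close>.\<close>

definition gain :: "('x \<Rightarrow> real) \<Rightarrow> 'x \<times> real \<Rightarrow> real" where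
  "gain f z = 2 * resid z * (f (fst z) - f0 (fst z)) - (f (fst z) - f0 (fst z))\<^sup>2"

lemma gain_measurable [measurable]:
  assumes [measurable]: "f \<in> borel_measurable B"
  shows "gain f \<in> borel_measurable N"
  unfolding gain_def by measurable

lemma loss_envelope_measurable:
  assumes "0 < \<delta>"
  shows "loss_envelope \<delta> \<in> borel_measurable N"
proof -
  note [measurable] = envelope_meas[OF assms]
  show ?thesis unfolding loss_envelope_def by measurable
qed

lemma
  assumes "x \<in> space B"
  shows envelope_ge: "f \<in> local_class \<delta> \<Longrightarrow> \<bar>f x - f0 x\<bar> \<le> local_envelope P F f0 \<delta> x"
    and envelope_nonneg: "0 \<le> local_envelope P F f0 \<delta> x"
    and envelope_le: "local_envelope P F f0 \<delta> x \<le> 2 * \<Phi>"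
proof -
  let ?S = "{\<bar>f x - f0 x\<bar> | f. f \<in> F \<and> Lq_norm P 2 (\<lambda>y. f y - f0 y) \<le> ennreal \<delta>}"
  have bd: "t \<le> 2 * \<Phi>" if "t \<in> ?S" for t
  proof -
    from that obtain f where f: "f \<in> F" "t = \<bar>f x - f0 x\<bar>" by auto
    show ?thesis using F_bdd[OF f(1) assms] F_bdd[OF f0_F assms] f(2) by linarith
  qed
  then have bdd: "bdd_above ?S" by (meson bdd_aboveI)
  have "Lq_norm P 2 (\<lambda>y. f0 y - f0 y) \<le> ennreal \<delta>" by (simp add: Lq_norm_def)
  \<comment> \<open>\<open>f0\<close> keeps the set nonempty, without which the real
    \<open>Sup\<close> would carry no information.\<close>
  then have mem: "0 \<in> ?S" using f0_F by (auto intro!: exI[of _ f0])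
  show "\<bar>f x - f0 x\<bar> \<le> local_envelope P F f0 \<delta> x" if "f \<in> local_class \<delta>"
    unfolding local_envelope_def
    by (rule cSup_upper[OF _ bdd]) (use that in \<open>auto simp: local_class_def\<close>)
  show "0 \<le> local_envelope P F f0 \<delta> x"
    unfolding local_envelope_def by (rule cSup_upper[OF mem bdd])
  show "local_envelope P F f0 \<delta> x \<le> 2 * \<Phi>"
    unfolding local_envelope_def by (rule cSup_least) (use mem bd in auto)
qed

lemma gain_diff: "gain f z - gain g z = (f (fst z) - g (fst z)) * (2 * resid z - (f (fst z) - f0 (fst z)) - (g (fst z) - f0 (fst z)))"
  by (simp add: gain_def algebra_simps power2_eq_square)

lemma gain_lipschitz:
  assumes "\<bar>f (fst z) - f0 (fst z)\<bar> \<le> e" "\<bar>g (fst z) - f0 (fst z)\<bar> \<le> e" "e \<le> 2 * \<Phi>"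
  shows "\<bar>gain f z - gain g z\<bar> \<le> (2 * \<bar>resid z\<bar> + 4 * \<Phi>) * \<bar>f (fst z) - g (fst z)\<bar>"
proof -
  have "\<bar>2 * resid z - (f (fst z) - f0 (fst z)) - (g (fst z) - f0 (fst z))\<bar> \<le> 2 * \<bar>resid z\<bar> + 4 * \<Phi>"
    using assms by linarith
  then show ?thesis unfolding gain_diff abs_mult
    by (subst mult.commute) (rule mult_right_mono, auto)
qed

text \<open>The first bound serves truncation: with \<open>e\<close> the local envelope its right
  side is twice \<open>loss_envelope\<close>. The second keeps the distance to \<open>f0\<close> and
  has the form needed by \<open>weighted_second_moment\<close>.\<close>

lemma gain_bound:
  assumes "\<bar>f (fst z) - f0 (fst z)\<bar> \<le> e" "e \<le> 2 * \<Phi>"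
  shows "\<bar>gain f z\<bar> \<le> 2 * ((\<bar>resid z\<bar> + \<Phi>) * e)"
    and "\<bar>gain f z\<bar> \<le> (2 * \<bar>resid z\<bar> + 4 * \<Phi>) * \<bar>f (fst z) - f0 (fst z)\<bar>"
proof -
  have eq: "gain f z = (2 * resid z - (f (fst z) - f0 (fst z))) * (f (fst z) - f0 (fst z))"
    by (simp add: gain_def algebra_simps power2_eq_square)
  have 1: "\<bar>2 * resid z - (f (fst z) - f0 (fst z))\<bar> \<le> 2 * \<bar>resid z\<bar> + 2 * \<Phi>" using assms by linarith
  have "\<bar>gain f z\<bar> \<le> (2 * \<bar>resid z\<bar> + 2 * \<Phi>) * e"
    unfolding eq abs_mult using 1 assms(1) \<Phi>_pos by (intro mult_mono) auto
  then show "\<bar>gain f z\<bar> \<le> 2 * ((\<bar>resid z\<bar> + \<Phi>) * e)" by (simp add: algebra_simps)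
  show "\<bar>gain f z\<bar> \<le> (2 * \<bar>resid z\<bar> + 4 * \<Phi>) * \<bar>f (fst z) - f0 (fst z)\<bar>"
    unfolding eq abs_mult using 1 \<Phi>_pos by (intro mult_right_mono) auto
qed

text \<open>Over the ball of radius \<delta> the truncated gains have second moment of order
  (\<sigma> + \<Phi>)^2 \<delta>^2 and sup norm of order \<open>T\<close>. The two error terms are
  those of a single Bernstein bound with exponent \<open>R\<close>; chaining has cost only
  constants. \<open>T\<close> stays free until the rate is inserted.\<close>

lemma truncated_gain_tail:
  assumes n: "1 \<le> n" and \<delta>: "0 < \<delta>" and L: "0 \<le> L" and T: "0 < T"
    and R_def: "R = L + 1 + A * \<delta> powr (- \<alpha>)"
  shows "\<exists>E\<in>sets M. prob E \<le> 2 * exp (- L) \<and>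
    (\<forall>\<omega>\<in>space M - E. \<forall>f\<in>local_class \<delta>.
      (\<Sum>i=1..n. gain f (Xs i \<omega>, Ys i \<omega>) * of_bool (loss_envelope \<delta> (Xs i \<omega>, Ys i \<omega>) \<le> T))
      \<le> n * (\<integral>z. gain f z * of_bool (loss_envelope \<delta> z \<le> T) \<partial>Q)
        + chain_const1 \<alpha> * n * (\<sigma> + \<Phi>)\<^sup>2 * \<delta>\<^sup>2 / T + chain_const2 \<alpha> * T * R)"
proof -
  interpret iid_sample M Q "\<lambda>i \<omega>. (Xs i \<omega>, Ys i \<omega>)" n by (rule iid_sample[OF n])
  define env where "env = local_envelope P F f0 \<delta>"
  have env_m [measurable]: "env \<in> borel_measurable B" unfolding env_def by (rule envelope_meas[OF \<delta>])
  note [measurable] = loss_envelope_measurable[OF \<delta>]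
  define t :: "'x \<times> real \<Rightarrow> real" where "t z = of_bool (loss_envelope \<delta> z \<le> T)" for z
  have t_m [measurable]: "t \<in> borel_measurable N" unfolding t_def by measurable
  define H where "H = A * \<delta> powr (- \<alpha>)"
  have H0: "0 < H" unfolding H_def using A_pos \<delta> by simp
  define u where "u = 2 powr \<alpha>"
  \<comment> \<open>The positive solution of \<open>1 / (4 * w) = w * u\<close>, which balances the
    two series.\<close>
  define w where "w = 2 powr (- (1 + \<alpha> / 2))"
  define x where "x = chain_ratio \<alpha>"
  have x: "0 < x" "x < 1" using chain_ratio_bounds[of \<alpha>] params by (auto simp: x_def)
  have u: "1 \<le> u" "u \<le> 4"
    using params powr_mono[of 0 \<alpha> 2] powr_mono[of \<alpha> 2 2] by (auto simp: u_def)
  have w: "0 < w" "w \<le> 1" "1 \<le> 4 * w" "1 / (4 * w) = x" "w * u = x"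
  proof -
    show "0 < w" by (simp add: w_def)
    show "w \<le> 1" using powr_mono[of "- (1 + \<alpha> / 2)" 0 2] params by (simp add: w_def)
    have w4: "4 * w = 2 powr (1 - \<alpha> / 2)"
      using powr_add[of 2 2 "- (1 + \<alpha> / 2)"] by (simp add: w_def)
    show "1 \<le> 4 * w" unfolding w4 using powr_mono[of 0 "1 - \<alpha> / 2" 2] params by simp
    show "1 / (4 * w) = x" unfolding w4 x_def chain_ratio_def
      by (subst powr_minus_divide[symmetric]) simp
    show "w * u = x" unfolding w_def u_def x_def chain_ratio_def
      by (subst powr_add[symmetric]) (simp add: field_simps)
  qed
  define zeta where "zeta k = \<delta> / 2 ^ k" for k :: nat
  have zeta: "0 < zeta k" for k using \<delta> by (simp add: zeta_def)
  have zeta_H: "A * zeta k powr (- \<alpha>) = H * u ^ k" for k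
  proof -
    have "zeta k powr (- \<alpha>) = \<delta> powr (- \<alpha>) / (2 ^ k) powr (- \<alpha>)"
      unfolding zeta_def using \<delta> by (simp add: powr_divide)
    also have "(2 ^ k :: real) powr (- \<alpha>) = inverse (u ^ k)"
      by (simp add: powr_realpow[symmetric] powr_powr u_def powr_minus mult.commute)
    finally show ?thesis by (simp add: H_def field_simps)
  qed
  define cov where "cov k m gL gU \<longleftrightarrow> real m \<le> exp (H * u ^ k) \<and>
      (\<forall>i. gL i \<in> borel_measurable B) \<and> (\<forall>i. gU i \<in> borel_measurable B) \<and>
      (\<forall>i<m. (\<integral>\<^sup>+ x. ennreal ((gU i x - gL i x)\<^sup>2) \<partial>P) \<le> ennreal ((zeta k)\<^sup>2)) \<and>
      (\<forall>f\<in>F. \<exists>i<m. \<forall>x\<in>space B. gL i x \<le> f x \<and> f x \<le> gU i x)"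
    for k m and gL gU :: "nat \<Rightarrow> 'x \<Rightarrow> real"
  have "\<exists>m gL gU. cov k m gL gU" for k
    by (rule bracketing_family[OF zeta[of k]], unfold zeta_H cov_def) blast
  then have "\<forall>k. \<exists>m gL gU. cov k m gL gU" by blast
  from choice[OF this] obtain m where "\<forall>k. \<exists>gL gU. cov k (m k) gL gU" by blast
  from choice[OF this] obtain gL where "\<forall>k. \<exists>gU. cov k (m k) (gL k) gU" by blast
  from choice[OF this] obtain gU where cov: "\<And>k. cov k (m k) (gL k) (gU k)" by blast
  have m: "\<And>k. real (m k) \<le> exp (H * u ^ k)"
    and gL [measurable]: "\<And>k i. gL k i \<in> borel_measurable B"
    and gU [measurable]: "\<And>k i. gU k i \<in> borel_measurable B"
    and width: "\<And>k i. i < m k \<Longrightarrow> (\<integral>\<^sup>+ x. ennreal ((gU k i x - gL k i x)\<^sup>2) \<partial>P) \<le> ennreal ((zeta k)\<^sup>2)"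
    and cover: "\<And>k f. f \<in> F \<Longrightarrow> \<exists>i<m k. \<forall>x\<in>space B. gL k i x \<le> f x \<and> f x \<le> gU k i x"
    using cov unfolding cov_def by blast+
  define j where "j k f = (SOME i. i < m k \<and> (\<forall>x\<in>space B. gL k i x \<le> f x \<and> f x \<le> gU k i x))" for k f
  have j: "j k f < m k" "\<And>x. x \<in> space B \<Longrightarrow> gL k (j k f) x \<le> f x \<and> f x \<le> gU k (j k f) x" if "f \<in> F" for k f
  proof -
    have "j k f < m k \<and> (\<forall>x\<in>space B. gL k (j k f) x \<le> f x \<and> f x \<le> gU k (j k f) x)"
      unfolding j_def by (rule someI_ex[OF cover[OF that]])
    then show "j k f < m k" "\<And>x. x \<in> space B \<Longrightarrow> gL k (j k f) x \<le> f x \<and> f x \<le> gU k (j k f) x"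
      by blast+
  qed
  \<comment> \<open>Brackets are clipped to the band of half-width \<open>env\<close> around
    \<open>f0\<close>. The local class lives in that band, so clipped brackets remain valid, their
    widths do not grow, and on the truncation set the weighted widths become bounded in terms of
    \<open>T\<close>.\<close>
  define clip where "clip g x = max (f0 x - env x) (min (f0 x + env x) (g x))" for g :: "'x \<Rightarrow> real" and x
  define l where "l k i = clip (gL k i)" for k i
  define r where "r k i = clip (gU k i)" for k i
  have clip_m: "clip g \<in> borel_measurable B" if [measurable]: "g \<in> borel_measurable B" for g
    unfolding clip_def by measurable
  have lm [measurable]: "l k i \<in> borel_measurable B" and rm [measurable]: "r k i \<in> borel_measurable B" for k i
    unfolding l_def r_def by (auto intro!: clip_m)
  have env: "0 \<le> env x" "env x \<le> 2 * \<Phi>" if "x \<in> space B" for x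
    unfolding env_def using envelope_nonneg[OF that] envelope_le[OF that] by auto
  have clip_f0: "\<bar>clip g x - f0 x\<bar> \<le> env x" if "x \<in> space B" for g x
    using env[OF that] by (auto simp: clip_def)
  have clip_width: "\<bar>r k i x - l k i x\<bar> \<le> \<bar>gU k i x - gL k i x\<bar>" for k i x
    by (auto simp: l_def r_def clip_def)
  have LC: "f \<in> F" "\<And>x. x \<in> space B \<Longrightarrow> \<bar>f x - f0 x\<bar> \<le> env x"
    "(\<integral>\<^sup>+ x. ennreal ((f x - f0 x)\<^sup>2) \<partial>P) \<le> ennreal (\<delta>\<^sup>2)" if "f \<in> local_class \<delta>" for f
    using that envelope_ge[of _ f \<delta>] \<delta> by (auto simp: local_class_def env_def Lq_norm_2_le_iff)
  have bracket: "l k (j k f) x \<le> f x" "f x \<le> r k (j k f) x" if "f \<in> local_class \<delta>" "x \<in> space B" for k f x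
    using j(2)[OF LC(1)[OF that(1)] that(2), of k] LC(2)[OF that]
    by (auto simp: l_def r_def clip_def)
  define c where "c k i z = gain (l k i) z * t z" for k i z
  define \<Delta> where "\<Delta> k i z = (2 * \<bar>resid z\<bar> + 4 * \<Phi>) * (r k i (fst z) - l k i (fst z)) * t z" for k i z
  define \<phi> where "\<phi> f z = gain f z * t z" for f z
  \<comment> \<open>On the truncation set a clipped width is at most \<open>2 * env\<close>, which
    with the weight \<open>2 * \<bar>resid z\<bar> + 4 * \<Phi>\<close> gives at most 8 T; clipped
    gains are at most 2 T there.\<close>
  define a where "a k = 8 * T * w ^ k" for k :: nat
  define v where "v k = 32 * (\<sigma> + \<Phi>)\<^sup>2 * (zeta k)\<^sup>2" for k
  define h where "h k = H * u ^ k" for k :: nat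
  define y where "y k = L + real (Suc k) + (\<Sum>i\<le>k. h i)" for k
  have t01: "t z = 0 \<or> t z = 1" for z by (auto simp: t_def of_bool_def)
  have tT: "(\<bar>resid z\<bar> + \<Phi>) * env (fst z) \<le> T" if "t z \<noteq> 0" for z
    using that by (auto simp: t_def loss_envelope_def env_def split: if_splits)
  have fstB: "fst z \<in> space B" if "z \<in> space Q" for z using that by (auto simp: space_Q)
  have T8: "a 0 = 8 * T" by (simp add: a_def)
  have \<Delta>abs: "\<bar>\<Delta> k i z\<bar> \<le> \<bar>(2 * \<bar>resid z\<bar> + 4 * \<Phi>) * (gU k i (fst z) - gL k i (fst z))\<bar>" for k i z
  proof -
    have "\<bar>\<Delta> k i z\<bar> \<le> \<bar>2 * \<bar>resid z\<bar> + 4 * \<Phi>\<bar> * \<bar>r k i (fst z) - l k i (fst z)\<bar>"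
      using t01[of z] by (auto simp: \<Delta>_def abs_mult)
    also have "\<dots> \<le> \<bar>2 * \<bar>resid z\<bar> + 4 * \<Phi>\<bar> * \<bar>gU k i (fst z) - gL k i (fst z)\<bar>"
      by (intro mult_left_mono clip_width) simp
    finally show ?thesis by (simp add: abs_mult)
  qed
  have near: "\<bar>\<phi> f z - c k (j k f) z\<bar> \<le> \<Delta> k (j k f) z" if f: "f \<in> local_class \<delta>" and z: "z \<in> space Q" for f k z
  proof -
    note B = fstB[OF z]
    have "\<bar>gain f z - gain (l k (j k f)) z\<bar> \<le> (2 * \<bar>resid z\<bar> + 4 * \<Phi>) * \<bar>f (fst z) - l k (j k f) (fst z)\<bar>"
      by (rule gain_lipschitz[where e = "env (fst z)" and z = z and f = f, OF LC(2)[OF f B] _ env(2)[OF B]]) (simp add: l_def clip_f0[OF B])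
    also have "\<dots> \<le> (2 * \<bar>resid z\<bar> + 4 * \<Phi>) * (r k (j k f) (fst z) - l k (j k f) (fst z))"
      using bracket[OF f B, of k] \<Phi>_pos by (intro mult_left_mono) auto
    finally have 1: "\<bar>gain f z - gain (l k (j k f)) z\<bar> \<le> \<dots>" .
    show ?thesis using t01[of z] 1 by (auto simp: \<phi>_def c_def \<Delta>_def)
  qed
  have cb: "\<bar>c k i z\<bar> \<le> a 0" if z: "z \<in> space Q" for k i z
  proof (cases "t z = 0")
    case True then show ?thesis using T by (simp add: c_def T8)
  next
    case False
    note B = fstB[OF z]
    have "\<bar>gain (l k i) z\<bar> \<le> 2 * ((\<bar>resid z\<bar> + \<Phi>) * env (fst z))"
      by (rule gain_bound(1)[where e = "env (fst z)" and z = z, OF _ env(2)[OF B]]) (simp add: l_def clip_f0[OF B])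
    then show ?thesis using tT[OF False] T t01[of z] False by (auto simp: c_def T8)
  qed
  have \<Delta>b: "\<Delta> k i z \<le> a 0" if z: "z \<in> space Q" for k i z
  proof (cases "t z = 0")
    case True then show ?thesis using T by (simp add: \<Delta>_def T8)
  next
    case False
    note B = fstB[OF z]
    have "r k i (fst z) - l k i (fst z) \<le> 2 * env (fst z)"
      using clip_f0[OF B, of "gU k i"] clip_f0[OF B, of "gL k i"] by (simp add: l_def r_def)
    then have "(2 * \<bar>resid z\<bar> + 4 * \<Phi>) * (r k i (fst z) - l k i (fst z)) \<le> (2 * \<bar>resid z\<bar> + 4 * \<Phi>) * (2 * env (fst z))"
      using \<Phi>_pos by (intro mult_left_mono) auto
    also have "\<dots> \<le> (4 * (\<bar>resid z\<bar> + \<Phi>)) * (2 * env (fst z))"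
      using env(1)[OF B] by (intro mult_right_mono) auto
    also have "\<dots> = 8 * ((\<bar>resid z\<bar> + \<Phi>) * env (fst z))" by (simp add: algebra_simps)
    also have "\<dots> \<le> 8 * T" using tT[OF False] by (intro mult_left_mono) auto
    finally show ?thesis using t01[of z] False by (auto simp: \<Delta>_def T8)
  qed
  have \<Delta>v: "(\<integral>z. (\<Delta> k (j k f) z)\<^sup>2 \<partial>Q) \<le> v k" if f: "f \<in> local_class \<delta>" for f k
  proof (rule square_integral_le)
    have "(\<integral>\<^sup>+ z. ennreal ((\<Delta> k (j k f) z)\<^sup>2) \<partial>Q) \<le>
      (\<integral>\<^sup>+ z. ennreal (((2 * \<bar>resid z\<bar> + 4 * \<Phi>) * (gU k (j k f) (fst z) - gL k (j k f) (fst z)))\<^sup>2) \<partial>Q)"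
      by (intro nn_integral_mono ennreal_leI) (use \<Delta>abs abs_le_square_iff in blast)
    also have "\<dots> \<le> ennreal (v k)"
      unfolding v_def
      by (rule weighted_second_moment[of "\<lambda>x. gU k (j k f) x - gL k (j k f) x"])
        (use width[OF j(1)[OF LC(1)[OF f]], of k] in auto)
    finally show "(\<integral>\<^sup>+ z. ennreal ((\<Delta> k (j k f) z)\<^sup>2) \<partial>Q) \<le> ennreal (v k)" .
  qed (simp add: v_def)
  \<comment> \<open>The width at level 0 and the radius of the local class are both \<delta>, so the
    clipped lower bracket is within 2 \<delta> of \<open>f0\<close>; this is the factor 4 =
    2^2.\<close>
  have c0v: "(\<integral>z. (c 0 (j 0 f) z)\<^sup>2 \<partial>Q) \<le> 4 * v 0" if f: "f \<in> local_class \<delta>" for f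
  proof (rule square_integral_le)
    let ?g = "l 0 (j 0 f)"
    have fm [measurable]: "f \<in> borel_measurable B" using LC(1)[OF f] F_measurable by auto
    have "(\<integral>\<^sup>+ x. ennreal ((?g x - f0 x)\<^sup>2) \<partial>P)
      \<le> (\<integral>\<^sup>+ x. 2 * ennreal ((gU 0 (j 0 f) x - gL 0 (j 0 f) x)\<^sup>2) + 2 * ennreal ((f x - f0 x)\<^sup>2) \<partial>P)"
    proof (rule nn_integral_mono)
      fix x assume "x \<in> space P"
      then have B: "x \<in> space B" by simp
      have "\<bar>?g x - f0 x\<bar> \<le> \<bar>gU 0 (j 0 f) x - gL 0 (j 0 f) x\<bar> + \<bar>f x - f0 x\<bar>"
        using bracket[OF f B, of 0] clip_width[of 0 "j 0 f" x] by linarith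
      from power_mono[OF this, of 2]
      have "(?g x - f0 x)\<^sup>2 \<le> (\<bar>gU 0 (j 0 f) x - gL 0 (j 0 f) x\<bar> + \<bar>f x - f0 x\<bar>)\<^sup>2" by simp
      also have "\<dots> \<le> 2 * (gU 0 (j 0 f) x - gL 0 (j 0 f) x)\<^sup>2 + 2 * (f x - f0 x)\<^sup>2"
        using sum_squares_bound[of "\<bar>gU 0 (j 0 f) x - gL 0 (j 0 f) x\<bar>" "\<bar>f x - f0 x\<bar>"]
        by (simp add: power2_sum)
      finally have "ennreal ((?g x - f0 x)\<^sup>2) \<le> ennreal \<dots>" by (rule ennreal_leI)
      then show "ennreal ((?g x - f0 x)\<^sup>2) \<le> 2 * ennreal ((gU 0 (j 0 f) x - gL 0 (j 0 f) x)\<^sup>2) + 2 * ennreal ((f x - f0 x)\<^sup>2)"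
        by (simp add: ennreal_plus ennreal_mult)
    qed
    also have "\<dots> = 2 * (\<integral>\<^sup>+ x. ennreal ((gU 0 (j 0 f) x - gL 0 (j 0 f) x)\<^sup>2) \<partial>P) + 2 * (\<integral>\<^sup>+ x. ennreal ((f x - f0 x)\<^sup>2) \<partial>P)"
      by (simp add: nn_integral_add nn_integral_cmult)
    also have "\<dots> \<le> 2 * ennreal (\<delta>\<^sup>2) + 2 * ennreal (\<delta>\<^sup>2)"
      using width[OF j(1)[OF LC(1)[OF f]], of 0] LC(3)[OF f]
      by (intro add_mono mult_left_mono) (auto simp: zeta_def)
    also have "\<dots> = ennreal (4 * \<delta>\<^sup>2)"
      by (simp add: ennreal_mult distrib_right[symmetric])
    finally have 1: "(\<integral>\<^sup>+ x. ennreal ((?g x - f0 x)\<^sup>2) \<partial>P) \<le> ennreal (4 * \<delta>\<^sup>2)" .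
    have "(\<integral>\<^sup>+ z. ennreal ((c 0 (j 0 f) z)\<^sup>2) \<partial>Q) \<le>
      (\<integral>\<^sup>+ z. ennreal (((2 * \<bar>resid z\<bar> + 4 * \<Phi>) * (?g (fst z) - f0 (fst z)))\<^sup>2) \<partial>Q)"
    proof (intro nn_integral_mono ennreal_leI)
      fix z assume z: "z \<in> space Q"
      note B = fstB[OF z]
      have "\<bar>gain ?g z\<bar> \<le> (2 * \<bar>resid z\<bar> + 4 * \<Phi>) * \<bar>?g (fst z) - f0 (fst z)\<bar>"
        by (rule gain_bound(2)[where e = "env (fst z)" and z = z, OF _ env(2)[OF B]]) (simp add: l_def clip_f0[OF B])
      also have "\<dots> = \<bar>(2 * \<bar>resid z\<bar> + 4 * \<Phi>) * (?g (fst z) - f0 (fst z))\<bar>"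
        using \<Phi>_pos by (simp add: abs_mult)
      finally have "\<bar>c 0 (j 0 f) z\<bar> \<le> \<bar>(2 * \<bar>resid z\<bar> + 4 * \<Phi>) * (?g (fst z) - f0 (fst z))\<bar>"
        using t01[of z] by (auto simp: c_def)
      then show "(c 0 (j 0 f) z)\<^sup>2 \<le> ((2 * \<bar>resid z\<bar> + 4 * \<Phi>) * (?g (fst z) - f0 (fst z)))\<^sup>2"
        by (simp add: abs_le_square_iff)
    qed
    also have "\<dots> \<le> ennreal (32 * (\<sigma> + \<Phi>)\<^sup>2 * (4 * \<delta>\<^sup>2))"
      by (rule weighted_second_moment[of "\<lambda>x. ?g x - f0 x"]) (use 1 in auto)
    also have "32 * (\<sigma> + \<Phi>)\<^sup>2 * (4 * \<delta>\<^sup>2) = 4 * v 0" by (simp add: v_def zeta_def)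
    finally show "(\<integral>\<^sup>+ z. ennreal ((c 0 (j 0 f) z)\<^sup>2) \<partial>Q) \<le> ennreal (4 * v 0)" .
  qed (simp add: v_def)
  \<comment> \<open>The depth \<open>K\<close> depends on \<open>n\<close> and \<open>R\<close>, but
    it only has to bring the final remainder down to the order of \<open>T * R\<close>; no constant
    depends on it.\<close>
  have aK: "\<exists>K. w ^ K * (2 * n) \<le> R"
  proof -
    have w1: "w < 1" using powr_less_mono[of "- (1 + \<alpha> / 2)" 0 2] params by (simp add: w_def)
    have R0: "0 < R" using L H0 by (simp add: R_def H_def)
    have "0 < R / (2 * n)" using R0 n by simp
    from real_arch_pow_inv[OF this w1] obtain K where "w ^ K < R / (2 * n)" by auto
    then show ?thesis using n by (intro exI[of _ K]) (simp add: field_simps)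
  qed
  then obtain K where K: "w ^ K * (2 * n) \<le> R" by blast
  have chain: "\<exists>E\<in>sets M. prob E \<le> 2 * exp (- L) \<and>
    (\<forall>\<omega>\<in>space M - E. \<forall>f\<in>local_class \<delta>. (\<Sum>i=1..n. \<phi> f (Xs i \<omega>, Ys i \<omega>)) \<le>
       n * (\<integral>z. \<phi> f z \<partial>Q) + (4 * n * v 0 / a 0 + a 0 * y 0)
       + (\<Sum>k<K. 11 * n * v k / a k + 4 * a k * y (Suc k)) + 2 * n * a K)"
  proof (rule chaining_tail[where \<phi> = \<phi> and c = c and \<Delta> = \<Delta> and j = j and m = m and h = h])
    show "\<phi> f \<in> borel_measurable Q" if "f \<in> local_class \<delta>" for f
    proof -
      have [measurable]: "f \<in> borel_measurable B" by (rule F_measurable[OF LC(1)[OF that]])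
      show ?thesis unfolding \<phi>_def by measurable
    qed
    show "c k i \<in> borel_measurable Q" "\<Delta> k i \<in> borel_measurable Q" for k i
      unfolding c_def \<Delta>_def by measurable
    show "j k f < m k" if "f \<in> local_class \<delta>" for f k using j(1) LC(1)[OF that] by blast
    show "real (m k) \<le> exp (h k)" for k using m by (simp add: h_def)
    show a0: "0 < a k" for k using T w by (simp add: a_def)
    have aS: "a (Suc k) = a k * w" for k by (simp add: a_def)
    show "a (Suc k) \<le> a k" for k using mult_left_mono[OF w(2), of "a k"] a0[of k] by (simp add: aS)
    show "a k \<le> 4 * a (Suc k)" for k using mult_left_mono[OF w(3), of "a k"] a0[of k] by (simp add: aS)
    show "v (Suc k) \<le> v k" for k
      unfolding v_def zeta_def using \<delta> by (intro mult_left_mono power_mono divide_left_mono) auto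
    show "y k = L + real (Suc k) + (\<Sum>i\<le>k. h i)" for k by (rule y_def)
  qed (use near cb \<Delta>b \<Delta>v c0v in auto)
  have R0: "0 < R" using L H0 by (simp add: R_def H_def)
  have y0: "y 0 = R" by (simp add: y_def h_def R_def H_def)
  \<comment> \<open>Every \<open>h i\<close> is at most the last one. The factor
    \<open>k + 2\<close> is attained at \<alpha> = 0, where \<open>u\<close> is 1 and the entropies
    do not grow.\<close>
  have ySuc: "y (Suc k) \<le> real (k + 2) * u ^ Suc k * R" for k
  proof -
    have "(\<Sum>i\<le>Suc k. h i) \<le> (\<Sum>i\<le>Suc k. H * u ^ Suc k)"
      unfolding h_def using H0 u by (intro sum_mono mult_left_mono power_increasing) auto
    also have "\<dots> = real (k + 2) * (u ^ Suc k * H)" by simp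
    finally have 1: "(\<Sum>i\<le>Suc k. h i) \<le> real (k + 2) * (u ^ Suc k * H)" .
    have up: "1 \<le> u ^ Suc k" using u(1) by (rule one_le_power)
    have 2: "real (Suc (Suc k)) \<le> real (k + 2) * u ^ Suc k"
      using mult_left_mono[OF up, of "real (k + 2)"] by simp
    have "1 \<le> real (k + 2) * u ^ Suc k" using 2 by linarith
    then have 3: "L \<le> (real (k + 2) * u ^ Suc k) * L"
      using mult_right_mono[OF _ L] by fastforce
    have "y (Suc k) \<le> (real (k + 2) * u ^ Suc k) * L + real (k + 2) * u ^ Suc k + real (k + 2) * (u ^ Suc k * H)"
      unfolding y_def by (intro add_mono 1 2 3)
    also have "\<dots> = real (k + 2) * u ^ Suc k * R" by (simp add: R_def H_def algebra_simps)
    finally show ?thesis .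
  qed
  define V where "V = n * v 0 / a 0"
  have V0: "0 \<le> V" using T by (simp add: V_def v_def T8)
  have vk: "n * v k / a k = V * x ^ k" for k
  proof -
    have "v k = v 0 * (1 / 4) ^ k"
      by (simp add: v_def zeta_def power_divide power_mult_distrib power2_eq_square flip: power_mult)
        (simp add: power_mult_distrib[symmetric])
    then have "n * v k / a k = V * ((1 / 4) ^ k / w ^ k)" by (simp add: V_def a_def)
    also have "(1 / 4) ^ k / w ^ k = x ^ k" unfolding w(4)[symmetric] by (simp add: power_divide[symmetric])
    finally show ?thesis .
  qed
  have ayk: "a k * y (Suc k) \<le> 32 * T * R * (real (k + 2) * x ^ k)" for k
  proof -
    have "a k * y (Suc k) \<le> a k * (real (k + 2) * u ^ Suc k * R)"
      using ySuc[of k] T w by (intro mult_left_mono) (auto simp: a_def)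
    also have "\<dots> = u * (8 * T * R * (real (k + 2) * x ^ k))"
      unfolding w(5)[symmetric] by (simp add: a_def power_mult_distrib algebra_simps)
    also have "\<dots> \<le> 4 * (8 * T * R * (real (k + 2) * x ^ k))"
      using u T R0 x by (intro mult_right_mono) auto
    finally show ?thesis by simp
  qed
  have "(4 * n * v 0 / a 0 + a 0 * y 0) + (\<Sum>k<K. 11 * n * v k / a k + 4 * a k * y (Suc k)) + 2 * n * a K
    \<le> (4 * V + 8 * T * R) + (11 * V * (1 / (1 - x)) + 128 * T * R * (2 / (1 - x)\<^sup>2)) + 8 * T * R"
  proof (intro add_mono)
    show "4 * n * v 0 / a 0 \<le> 4 * V" by (simp add: V_def)
    show "a 0 * y 0 \<le> 8 * T * R" by (simp add: T8 y0)
    have "2 * n * a K = 8 * T * (w ^ K * (2 * n))" by (simp add: a_def)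
    also have "\<dots> \<le> 8 * T * R" using K T by (intro mult_left_mono) auto
    finally show "2 * n * a K \<le> 8 * T * R" .
    have "(\<Sum>k<K. 11 * n * v k / a k + 4 * a k * y (Suc k)) \<le> (\<Sum>k<K. 11 * V * x ^ k + 128 * T * R * (real (k + 2) * x ^ k))"
    proof (rule sum_mono)
      fix k
      have "11 * n * v k / a k = 11 * (n * v k / a k)" by simp
      also have "\<dots> = 11 * V * x ^ k" unfolding vk by simp
      finally have "11 * n * v k / a k = 11 * V * x ^ k" .
      moreover have "4 * a k * y (Suc k) \<le> 128 * T * R * (real (k + 2) * x ^ k)"
        using mult_left_mono[OF ayk[of k], of 4] by (simp add: mult_ac)
      ultimately show "11 * n * v k / a k + 4 * a k * y (Suc k) \<le> 11 * V * x ^ k + 128 * T * R * (real (k + 2) * x ^ k)"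
        by linarith
    qed
    also have "\<dots> = 11 * V * (\<Sum>k<K. x ^ k) + 128 * T * R * (\<Sum>k<K. real (k + 2) * x ^ k)"
      by (simp only: sum.distrib sum_distrib_left)
    also have "\<dots> \<le> 11 * V * (1 / (1 - x)) + 128 * T * R * (2 / (1 - x)\<^sup>2)"
      using V0 T R0 x by (intro add_mono mult_left_mono geometric_sum_le weighted_geometric_sum_le) auto
    finally show "(\<Sum>k<K. 11 * n * v k / a k + 4 * a k * y (Suc k)) \<le> \<dots>" .
  qed
  also have "\<dots> = (4 + 11 / (1 - x)) * V + chain_const2 \<alpha> * T * R"
    unfolding chain_const2_def x_def[symmetric] by (simp add: algebra_simps)
  also have "(4 + 11 / (1 - x)) * V = chain_const1 \<alpha> * n * (\<sigma> + \<Phi>)\<^sup>2 * \<delta>\<^sup>2 / T"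
    unfolding chain_const1_def x_def[symmetric] V_def by (simp add: v_def zeta_def T8)
  finally have dev: "(4 * n * v 0 / a 0 + a 0 * y 0) + (\<Sum>k<K. 11 * n * v k / a k + 4 * a k * y (Suc k)) + 2 * n * a K
    \<le> chain_const1 \<alpha> * n * (\<sigma> + \<Phi>)\<^sup>2 * \<delta>\<^sup>2 / T + chain_const2 \<alpha> * T * R" .
  from chain obtain E where E: "E \<in> sets M" "prob E \<le> 2 * exp (- L)"
    "\<And>\<omega> f. \<omega> \<in> space M - E \<Longrightarrow> f \<in> local_class \<delta> \<Longrightarrow> (\<Sum>i=1..n. \<phi> f (Xs i \<omega>, Ys i \<omega>)) \<le>
       n * (\<integral>z. \<phi> f z \<partial>Q) + (4 * n * v 0 / a 0 + a 0 * y 0)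
       + (\<Sum>k<K. 11 * n * v k / a k + 4 * a k * y (Suc k)) + 2 * n * a K"
    by blast
  show ?thesis
  proof (rule bexI[OF _ E(1)], intro conjI ballI E(2))
    fix \<omega> f assume "\<omega> \<in> space M - E" "f \<in> local_class \<delta>"
    from E(3)[OF this] dev
    show "(\<Sum>i=1..n. gain f (Xs i \<omega>, Ys i \<omega>) * of_bool (loss_envelope \<delta> (Xs i \<omega>, Ys i \<omega>) \<le> T))
      \<le> n * (\<integral>z. gain f z * of_bool (loss_envelope \<delta> z \<le> T) \<partial>Q)
        + chain_const1 \<alpha> * n * (\<sigma> + \<Phi>)\<^sup>2 * \<delta>\<^sup>2 / T + chain_const2 \<alpha> * T * R"
      unfolding \<phi>_def t_def by linarith
  qed
qed

end

section \<open>Estimation error in a shell\<close>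

context lse_setup
begin

lemma loss_envelope_nonneg: "z \<in> space Q \<Longrightarrow> 0 \<le> loss_envelope \<delta> z"
  unfolding loss_envelope_def using envelope_nonneg \<Phi>_pos
  by (intro mult_nonneg_nonneg) (auto simp: space_Q)

text \<open>Where the envelope G exceeds \<open>T\<close>, G \<le> G^q / T^(q - 1); integrating
  trades the \<open>q\<close>-th moment for this power of \<open>T\<close>.\<close>

lemma loss_envelope_tail:
  assumes \<delta>: "0 < \<delta>" and T: "0 < T"
  shows "integrable Q (\<lambda>z. loss_envelope \<delta> z * of_bool (T < loss_envelope \<delta> z))"
    and "(\<integral>z. loss_envelope \<delta> z * of_bool (T < loss_envelope \<delta> z) \<partial>Q)
      \<le> (C\<^sub>0 * \<Phi>\<^sup>2 * \<delta> powr s) powr q / T powr (q - 1)"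
proof -
  define G where "G = loss_envelope \<delta>"
  have G_m [measurable]: "G \<in> borel_measurable N" unfolding G_def by (rule loss_envelope_measurable[OF \<delta>])
  define K where "K = (C\<^sub>0 * \<Phi>\<^sup>2 * \<delta> powr s) powr q"
  have G0: "0 \<le> G z" if "z \<in> space Q" for z using loss_envelope_nonneg[OF that] by (simp add: G_def)
  have "(\<integral>\<^sup>+ \<omega>. ennreal (\<bar>(\<bar>Y \<omega> - f0 (X \<omega>)\<bar> + \<Phi>) * local_envelope P F f0 \<delta> (X \<omega>)\<bar> powr q) \<partial>M) \<le> ennreal K"
    unfolding K_def
    by (rule nn_integral_powr_le_of_Lq_norm_le[OF _ _ envelope_Lq[OF \<delta>]])
      (use params \<Phi>_pos \<delta> in auto)
  moreover have "(\<integral>\<^sup>+ z. ennreal (\<bar>G z\<bar> powr q) \<partial>Q) =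
      (\<integral>\<^sup>+ \<omega>. ennreal (\<bar>(\<bar>Y \<omega> - f0 (X \<omega>)\<bar> + \<Phi>) * local_envelope P F f0 \<delta> (X \<omega>)\<bar> powr q) \<partial>M)"
  proof -
    have "(\<lambda>z. ennreal (\<bar>G z\<bar> powr q)) \<in> borel_measurable N" by measurable
    from nn_integral_Q[OF this] show ?thesis by (simp add: G_def loss_envelope_def resid_def)
  qed
  ultimately have GK: "(\<integral>\<^sup>+ z. ennreal (\<bar>G z\<bar> powr q) \<partial>Q) \<le> ennreal K" by simp
  have "(\<integral>\<^sup>+ z. ennreal (G z * of_bool (T < G z)) \<partial>Q)
      \<le> (\<integral>\<^sup>+ z. ennreal (1 / T powr (q - 1)) * ennreal (\<bar>G z\<bar> powr q) \<partial>Q)"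
  proof (rule nn_integral_mono)
    fix z assume z: "z \<in> space Q"
    have "G z * of_bool (T < G z) \<le> 1 / T powr (q - 1) * (\<bar>G z\<bar> powr q)"
    proof (cases "T < G z")
      case True
      then have "T powr (q - 1) \<le> G z powr (q - 1)" using T params by (intro powr_mono2) auto
      then have "G z * T powr (q - 1) \<le> G z * G z powr (q - 1)" using True T by (intro mult_left_mono) auto
      also have "\<dots> = G z powr q" using True T powr_mult_base[of "G z" "q - 1"] by simp
      finally show ?thesis using True T by (simp add: field_simps)
    qed simp
    then show "ennreal (G z * of_bool (T < G z)) \<le> ennreal (1 / T powr (q - 1)) * ennreal (\<bar>G z\<bar> powr q)"
      by (subst ennreal_mult[symmetric]) (auto intro: ennreal_leI)
  qed
  also have "\<dots> = ennreal (1 / T powr (q - 1)) * (\<integral>\<^sup>+ z. ennreal (\<bar>G z\<bar> powr q) \<partial>Q)"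
    by (rule nn_integral_cmult) measurable
  also have "\<dots> \<le> ennreal (1 / T powr (q - 1)) * ennreal K" by (intro mult_left_mono GK) simp
  also have "\<dots> = ennreal (K / T powr (q - 1))" by (simp add: ennreal_mult[symmetric] K_def)
  finally have le: "(\<integral>\<^sup>+ z. ennreal (G z * of_bool (T < G z)) \<partial>Q) \<le> ennreal (K / T powr (q - 1))" .
  have "(\<integral>\<^sup>+ z. ennreal (G z * of_bool (T < G z)) \<partial>Q) < \<infinity>"
    using le by (rule le_less_trans) simp
  then show "integrable Q (\<lambda>z. loss_envelope \<delta> z * of_bool (T < loss_envelope \<delta> z))"
    unfolding G_def[symmetric] by (intro integrableI_nonneg) (auto intro!: AE_I2 mult_nonneg_nonneg G0)
  show "(\<integral>z. loss_envelope \<delta> z * of_bool (T < loss_envelope \<delta> z) \<partial>Q)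
      \<le> (C\<^sub>0 * \<Phi>\<^sup>2 * \<delta> powr s) powr q / T powr (q - 1)"
    unfolding G_def[symmetric] K_def[symmetric] by (rule integral_real_bounded[OF _ le]) (simp add: K_def)
qed

text \<open>The cross term vanishes by \<open>resid_orthogonal\<close>, since \<open>f - f0\<close>
  is a bounded function of the covariate.\<close>

lemma integral_gain:
  assumes f: "f \<in> F"
  shows "integrable Q (gain f)" "(\<integral>z. gain f z \<partial>Q) = - (\<integral>x. (f x - f0 x)\<^sup>2 \<partial>P)"
    "integrable P (\<lambda>x. (f x - f0 x)\<^sup>2)"
proof -
  have [measurable]: "f \<in> borel_measurable B" by (rule F_measurable[OF f])
  have b: "\<bar>f x - f0 x\<bar> \<le> 2 * \<Phi>" if "x \<in> space B" for x
    using F_bdd[OF f that] F_bdd[OF f0_F that] by linarith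
  have b2: "\<bar>(f x - f0 x)\<^sup>2\<bar> \<le> (2 * \<Phi>)\<^sup>2" if "x \<in> space B" for x
    using power_mono[OF b[OF that], of 2] by simp
  interpret P: prob_space P unfolding P_def by (rule prob_space_distr) simp
  interpret Q: prob_space Q unfolding Q_def by (rule prob_space_distr) simp
  show iP: "integrable P (\<lambda>x. (f x - f0 x)\<^sup>2)"
    by (rule P.integrable_const_bound[of _ "(2 * \<Phi>)\<^sup>2"]) (use b2 in auto)
  have iQ: "integrable Q (\<lambda>z. (f (fst z) - f0 (fst z))\<^sup>2)"
    by (rule Q.integrable_const_bound[of _ "(2 * \<Phi>)\<^sup>2"]) (use b2 in \<open>auto simp: space_Q\<close>)
  have m: "(\<lambda>x. f x - f0 x) \<in> borel_measurable B" by measurable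
  note r = resid_orthogonal[OF m b, simplified]
  have eq: "gain f = (\<lambda>z. 2 * (resid z * (f (fst z) - f0 (fst z))) - (f (fst z) - f0 (fst z))\<^sup>2)"
    by (simp add: gain_def fun_eq_iff)
  show "integrable Q (gain f)" unfolding eq using r(1) iQ by auto
  have "(\<integral>z. gain f z \<partial>Q) = - (\<integral>z. (f (fst z) - f0 (fst z))\<^sup>2 \<partial>Q)"
    unfolding eq using r iQ by simp
  also have "(\<integral>z. (f (fst z) - f0 (fst z))\<^sup>2 \<partial>Q) = (\<integral>\<omega>. (f (X \<omega>) - f0 (X \<omega>))\<^sup>2 \<partial>M)"
    unfolding Q_def by (subst integral_distr) auto
  also have "\<dots> = (\<integral>x. (f x - f0 x)\<^sup>2 \<partial>P)" unfolding P_def by (subst integral_distr) auto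
  finally show "(\<integral>z. gain f z \<partial>Q) = - (\<integral>x. (f x - f0 x)\<^sup>2 \<partial>P)" .
qed

text \<open>An account in units of n \<delta>^2: on the shell the mean of the summed gain is at most
  -1/4, while the chain, the empirical excess over \<open>T\<close> and the mean excess are granted
  1/16 each. The estimator's nonnegative total gain is then impossible outside the exceptional
  events.\<close>

lemma shell_tail:
  assumes n: "1 \<le> n" and \<delta>: "0 < \<delta>" and L: "0 \<le> L" and T: "0 < T"
    and R_def: "R = L + 1 + A * \<delta> powr (- \<alpha>)"
    and small: "chain_const1 \<alpha> * n * (\<sigma> + \<Phi>)\<^sup>2 * \<delta>\<^sup>2 / T + chain_const2 \<alpha> * T * R \<le> n * \<delta>\<^sup>2 / 16"
    and lse: "least_squares_estimator M P Xs Ys F f0 n fhat"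
  shows "prob {\<omega> \<in> space M. ennreal (\<delta> / 2) \<le> Lq_norm P 2 (\<lambda>x. fhat \<omega> x - f0 x) \<and>
      Lq_norm P 2 (\<lambda>x. fhat \<omega> x - f0 x) \<le> ennreal \<delta>}
    \<le> 2 * exp (- L) + 32 / \<delta>\<^sup>2 * ((C\<^sub>0 * \<Phi>\<^sup>2 * \<delta> powr s) powr q / T powr (q - 1))"
    (is "prob ?S \<le> _ + _ * ?K")
proof -
  interpret iid_sample M Q "\<lambda>i \<omega>. (Xs i \<omega>, Ys i \<omega>)" n by (rule iid_sample[OF n])
  interpret Q: prob_space Q by (rule prob_space_Q)
  note [measurable] = loss_envelope_measurable[OF \<delta>]
  define g1 where "g1 z = loss_envelope \<delta> z * of_bool (T < loss_envelope \<delta> z)" for z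
  have g1_m [measurable]: "g1 \<in> borel_measurable Q" unfolding g1_def by measurable
  have g1i: "integrable Q g1" and g1K: "(\<integral>z. g1 z \<partial>Q) \<le> ?K"
    unfolding g1_def by (rule loss_envelope_tail[OF \<delta> T])+
  have g10: "0 \<le> g1 z" if "z \<in> space Q" for z using loss_envelope_nonneg[OF that, of \<delta>] by (simp add: g1_def)
  have n0: "0 < real n" using n by simp
  have d2: "0 < \<delta>\<^sup>2" using \<delta> by simp
  show ?thesis
  proof (cases "\<delta>\<^sup>2 / 32 < ?K")
    \<comment> \<open>If the bound on the mean excess is not small, the right side is at least 1 and
      nothing is left to show.\<close>
    case True
    have "1 = 32 / \<delta>\<^sup>2 * (\<delta>\<^sup>2 / 32)" using d2 by simp
    also have "\<dots> \<le> 32 / \<delta>\<^sup>2 * ?K" using True d2 by (intro mult_left_mono) auto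
    finally have "1 \<le> 32 / \<delta>\<^sup>2 * ?K" .
    moreover have "prob ?S \<le> 1" by simp
    moreover have "0 \<le> 2 * exp (- L)" by simp
    ultimately show ?thesis by linarith
  next
    case False
    then have K: "?K \<le> \<delta>\<^sup>2 / 32" by simp
    obtain E where E: "E \<in> sets M" "prob E \<le> 2 * exp (- L)"
      "\<And>\<omega> f. \<omega> \<in> space M - E \<Longrightarrow> f \<in> local_class \<delta> \<Longrightarrow>
        (\<Sum>i=1..n. gain f (Xs i \<omega>, Ys i \<omega>) * of_bool (loss_envelope \<delta> (Xs i \<omega>, Ys i \<omega>) \<le> T))
        \<le> n * (\<integral>z. gain f z * of_bool (loss_envelope \<delta> z \<le> T) \<partial>Q)
          + chain_const1 \<alpha> * n * (\<sigma> + \<Phi>)\<^sup>2 * \<delta>\<^sup>2 / T + chain_const2 \<alpha> * T * R"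
      using truncated_gain_tail[OF n \<delta> L T R_def] by blast
    \<comment> \<open>\<open>g1\<close> does not depend on \<open>f\<close>, so its sample sum is
      one random variable and needs no uniformity over the class.\<close>
    define W where "W \<omega> = (\<Sum>i=1..n. g1 (Xs i \<omega>, Ys i \<omega>))" for \<omega>
    have each: "integrable M (\<lambda>\<omega>. g1 (Xs i \<omega>, Ys i \<omega>))"
        "(\<integral>\<omega>. g1 (Xs i \<omega>, Ys i \<omega>) \<partial>M) = (\<integral>z. g1 z \<partial>Q)" if i: "i \<in> {1..n}" for i
    proof -
      have "integrable (distr M Q (\<lambda>\<omega>. (Xs i \<omega>, Ys i \<omega>))) g1" using g1i law[OF i] by simp
      then show "integrable M (\<lambda>\<omega>. g1 (Xs i \<omega>, Ys i \<omega>))"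
        by (rule integrable_distr[OF Z_measurable[OF i]])
      have "(\<integral>z. g1 z \<partial>Q) = (\<integral>z. g1 z \<partial>distr M Q (\<lambda>\<omega>. (Xs i \<omega>, Ys i \<omega>)))" by (simp add: law[OF i])
      also have "\<dots> = (\<integral>\<omega>. g1 (Xs i \<omega>, Ys i \<omega>) \<partial>M)"
        by (rule integral_distr[OF Z_measurable[OF i] g1_m])
      finally show "(\<integral>\<omega>. g1 (Xs i \<omega>, Ys i \<omega>) \<partial>M) = (\<integral>z. g1 z \<partial>Q)" by simp
    qed
    have Wi: "integrable M W" unfolding W_def by (rule Bochner_Integration.integrable_sum) (rule each(1))
    have "(\<integral>\<omega>. W \<omega> \<partial>M) = (\<Sum>i=1..n. \<integral>\<omega>. g1 (Xs i \<omega>, Ys i \<omega>) \<partial>M)"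
      unfolding W_def by (rule Bochner_Integration.integral_sum) (rule each(1))
    also have "\<dots> = n * (\<integral>z. g1 z \<partial>Q)" by (simp add: each(2))
    also have "\<dots> \<le> n * ?K" using g1K by (intro mult_left_mono) auto
    finally have WK: "(\<integral>\<omega>. W \<omega> \<partial>M) \<le> n * ?K" .
    have W0: "0 \<le> W \<omega>" if "\<omega> \<in> space M" for \<omega>
      unfolding W_def by (intro sum_nonneg g10 Z_space that)
    define E2 where "E2 = {\<omega> \<in> space M. n * \<delta>\<^sup>2 / 32 \<le> W \<omega>}"
    have E2m: "E2 \<in> sets M" unfolding E2_def using Wi by measurable
    have "prob E2 \<le> (\<integral>\<omega>. W \<omega> \<partial>M) / (n * \<delta>\<^sup>2 / 32)"
      unfolding E2_def
      by (rule integral_Markov_inequality_measure[OF Wi sets.empty_sets])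
        (use W0 n0 d2 in \<open>auto intro!: AE_I2\<close>)
    also have "\<dots> \<le> n * ?K / (n * \<delta>\<^sup>2 / 32)" using WK n0 d2 by (intro divide_right_mono) auto
    also have "\<dots> = 32 / \<delta>\<^sup>2 * ?K" using n0 by (simp add: mult.commute)
    finally have E2p: "prob E2 \<le> 32 / \<delta>\<^sup>2 * ?K" .
    have "?S \<subseteq> E \<union> E2"
    proof
      fix \<omega> assume \<omega>S: "\<omega> \<in> ?S"
      show "\<omega> \<in> E \<union> E2"
      proof (rule ccontr)
        assume not: "\<omega> \<notin> E \<union> E2"
        define f where "f = fhat \<omega>"
        have \<omega>: "\<omega> \<in> space M" using \<omega>S by simp
        have arg: "is_arg_min (\<lambda>f. \<Sum>i=1..n. (Ys i \<omega> - f (Xs i \<omega>))\<^sup>2) (\<lambda>f. f \<in> F) f"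
          using lse \<omega> by (simp add: least_squares_estimator_def f_def)
        then have f: "f \<in> F" by (simp add: is_arg_min_def)
        have fl: "f \<in> local_class \<delta>" using f \<omega>S by (simp add: local_class_def f_def)
        have gain_eq: "gain f (x, y) = (y - f0 x)\<^sup>2 - (y - f x)\<^sup>2" for x y
          by (simp add: gain_def resid_def algebra_simps power2_eq_square)
        have "(\<Sum>i=1..n. (Ys i \<omega> - f (Xs i \<omega>))\<^sup>2) \<le> (\<Sum>i=1..n. (Ys i \<omega> - f0 (Xs i \<omega>))\<^sup>2)"
          using arg f0_F by (auto simp: is_arg_min_linorder)
        then have pos: "0 \<le> (\<Sum>i=1..n. gain f (Xs i \<omega>, Ys i \<omega>))"
          by (simp add: gain_eq sum_subtractf)
        define t :: "'x \<times> real \<Rightarrow> real" where "t z = of_bool (loss_envelope \<delta> z \<le> T)" for z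
        have t_m [measurable]: "t \<in> borel_measurable Q" unfolding t_def by measurable
        have [measurable]: "f \<in> borel_measurable B" by (rule F_measurable[OF f])
        have out: "\<bar>gain f z - gain f z * t z\<bar> \<le> 2 * g1 z" if z: "z \<in> space Q" for z
        proof -
          have x: "fst z \<in> space B" using z by (auto simp: space_Q)
          have "\<bar>gain f z\<bar> \<le> 2 * loss_envelope \<delta> z" unfolding loss_envelope_def
            by (rule gain_bound(1)[where f = f and z = z and e = "local_envelope P F f0 \<delta> (fst z)", OF envelope_ge[OF x fl] envelope_le[OF x]])
          then show ?thesis by (auto simp: g1_def t_def)
        qed
        have "(\<Sum>i=1..n. gain f (Xs i \<omega>, Ys i \<omega>))
          \<le> (\<Sum>i=1..n. gain f (Xs i \<omega>, Ys i \<omega>) * t (Xs i \<omega>, Ys i \<omega>) + 2 * g1 (Xs i \<omega>, Ys i \<omega>))"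
          by (rule sum_mono) (use out[OF Z_space[OF _ \<omega>]] in \<open>fastforce simp: abs_le_iff\<close>)
        also have "\<dots> = (\<Sum>i=1..n. gain f (Xs i \<omega>, Ys i \<omega>) * t (Xs i \<omega>, Ys i \<omega>)) + 2 * W \<omega>"
          by (simp add: W_def sum.distrib sum_distrib_left)
        finally have 1: "0 \<le> (\<Sum>i=1..n. gain f (Xs i \<omega>, Ys i \<omega>) * t (Xs i \<omega>, Ys i \<omega>)) + 2 * W \<omega>"
          using pos by linarith
        have 2: "(\<Sum>i=1..n. gain f (Xs i \<omega>, Ys i \<omega>) * t (Xs i \<omega>, Ys i \<omega>))
          \<le> n * (\<integral>z. gain f z * t z \<partial>Q) + n * \<delta>\<^sup>2 / 16"
        proof -
          have "\<omega> \<in> space M - E" using \<omega> not by simp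
          from E(3)[OF this fl] small show ?thesis unfolding t_def by linarith
        qed
        have 3: "W \<omega> < n * \<delta>\<^sup>2 / 32" using not \<omega> by (simp add: E2_def)
        have it: "integrable Q (\<lambda>z. gain f z * t z)"
          by (rule Bochner_Integration.integrable_bound[OF integral_gain(1)[OF f]])
            (auto simp: t_def abs_mult intro!: AE_I2)
        have "(\<integral>z. gain f z * t z \<partial>Q) \<le> (\<integral>z. gain f z + 2 * g1 z \<partial>Q)"
          by (rule integral_mono[OF it]) (use integral_gain(1)[OF f] g1i out in \<open>auto simp: abs_le_iff algebra_simps\<close>)
        also have "\<dots> = - (\<integral>x. (f x - f0 x)\<^sup>2 \<partial>P) + 2 * (\<integral>z. g1 z \<partial>Q)"
          using integral_gain[OF f] g1i by simp
        finally have 4: "(\<integral>z. gain f z * t z \<partial>Q) \<le> - (\<integral>x. (f x - f0 x)\<^sup>2 \<partial>P) + \<delta>\<^sup>2 / 16"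
          using g1K K by linarith
        define I where "I = (\<integral>x. (f x - f0 x)\<^sup>2 \<partial>P)"
        have I0: "0 \<le> I" unfolding I_def by (intro integral_nonneg_AE) auto
        have "(\<integral>\<^sup>+ x. ennreal ((f x - f0 x)\<^sup>2) \<partial>P) = ennreal I"
          unfolding I_def by (rule nn_integral_eq_integral[OF integral_gain(3)[OF f]]) auto
        then have "Lq_norm P 2 (\<lambda>x. f x - f0 x) \<le> ennreal (sqrt I)"
          using I0 by (subst Lq_norm_2_le_iff) auto
        moreover have "ennreal (\<delta> / 2) \<le> Lq_norm P 2 (\<lambda>x. f x - f0 x)" using \<omega>S by (simp add: f_def)
        ultimately have "ennreal (\<delta> / 2) \<le> ennreal (sqrt I)" by (rule order_trans[rotated])
        then have "\<delta> / 2 \<le> sqrt I" using I0 by simp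
        then have "(\<delta> / 2)\<^sup>2 \<le> I" using I0 \<delta> power_mono[of "\<delta> / 2" "sqrt I" 2] by simp
        then have 5: "\<delta>\<^sup>2 / 4 \<le> I" by (simp add: power_divide)
        have "n * (\<integral>z. gain f z * t z \<partial>Q) \<le> n * (- (3 / 16) * \<delta>\<^sup>2)"
          using 4 5 n0 unfolding I_def by (intro mult_left_mono) auto
        then have 6: "n * (\<integral>z. gain f z * t z \<partial>Q) \<le> - (3 / 16) * (n * \<delta>\<^sup>2)" by (simp add: mult.left_commute)
        have "0 < n * \<delta>\<^sup>2" using n0 d2 by simp
        then show False using 1 2 3 6 by linarith
      qed
    qed
    then have "prob ?S \<le> prob (E \<union> E2)" by (rule finite_measure_mono) (use E(1) E2m in auto)
    also have "\<dots> \<le> prob E + prob E2" by (rule measure_Un_le) (use E(1) E2m in auto)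
    finally show ?thesis using E(2) E2p by linarith
  qed
qed

text \<open>A shell that is met by the class forces at least two brackets at its scale, which bounds the
  entropy from below.\<close>

lemma entropy_lower_bound:
  assumes f: "f \<in> F" and \<delta>: "0 < \<delta>" and far: "ennreal (\<delta> / 2) \<le> Lq_norm P 2 (\<lambda>x. f x - f0 x)"
  shows "1 / 32 \<le> A * \<delta> powr (- \<alpha>)"
proof -
  \<comment> \<open>Any scale below \<delta>/2 rules out a common bracket for \<open>f\<close> and
    \<open>f0\<close>. At \<delta>/4 the entropy bound grows by at most 4^2, and ln 2 \<ge> 1/2,
    whence 1/32.\<close>
  have \<zeta>: "0 < \<delta> / 4" using \<delta> by simp
  obtain m gL gU where m: "1 \<le> m" "real m \<le> exp (A * (\<delta> / 4) powr (- \<alpha>))"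
    and width: "\<And>i. i < m \<Longrightarrow> (\<integral>\<^sup>+ x. ennreal ((gU i x - gL i x)\<^sup>2) \<partial>P) \<le> ennreal ((\<delta> / 4)\<^sup>2)"
    and cover: "\<And>f. f \<in> F \<Longrightarrow> \<exists>i<m. \<forall>x\<in>space B. gL i x \<le> f x \<and> f x \<le> gU i x"
    by (rule bracketing_family[OF \<zeta>]) blast
  have "m \<noteq> 1"
  proof
    assume "m = 1"
    then have in0: "\<forall>x\<in>space B. gL 0 x \<le> f x \<and> f x \<le> gU 0 x" if "f \<in> F" for f
      using cover[OF that] by auto
    have "(\<integral>\<^sup>+ x. ennreal ((f x - f0 x)\<^sup>2) \<partial>P) \<le> (\<integral>\<^sup>+ x. ennreal ((gU 0 x - gL 0 x)\<^sup>2) \<partial>P)"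
    proof (intro nn_integral_mono ennreal_leI)
      fix x assume "x \<in> space P"
      then have "\<bar>f x - f0 x\<bar> \<le> \<bar>gU 0 x - gL 0 x\<bar>" using in0[OF f] in0[OF f0_F] by fastforce
      then show "(f x - f0 x)\<^sup>2 \<le> (gU 0 x - gL 0 x)\<^sup>2" by (simp add: abs_le_square_iff)
    qed
    also have "\<dots> \<le> ennreal ((\<delta> / 4)\<^sup>2)" using width[of 0] \<open>m = 1\<close> by simp
    finally have "Lq_norm P 2 (\<lambda>x. f x - f0 x) \<le> ennreal (\<delta> / 4)" using \<delta> by (subst Lq_norm_2_le_iff) auto
    with far have "ennreal (\<delta> / 2) \<le> ennreal (\<delta> / 4)" by (rule order_trans)
    then show False using \<delta> by simp
  qed
  then have "2 \<le> exp (A * (\<delta> / 4) powr (- \<alpha>))" using m by linarith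
  then have "ln 2 \<le> ln (exp (A * (\<delta> / 4) powr (- \<alpha>)))" by (subst ln_le_cancel_iff) auto
  then have ln2: "ln 2 \<le> A * (\<delta> / 4) powr (- \<alpha>)" by simp
  have "(\<delta> / 4) powr (- \<alpha>) = \<delta> powr (- \<alpha>) * 4 powr \<alpha>"
    using \<delta> by (simp add: powr_divide powr_minus field_simps)
  also have "\<dots> \<le> \<delta> powr (- \<alpha>) * 4 powr 2"
    using params by (intro mult_left_mono powr_mono) auto
  finally have "A * (\<delta> / 4) powr (- \<alpha>) \<le> A * (\<delta> powr (- \<alpha>) * 16)"
    using A_pos by (intro mult_left_mono) auto
  moreover have "1 / 2 \<le> ln (2 :: real)"
  proof -
    have "exp (1 / 2 :: real) \<le> 2" using exp_bound[of "1 / 2 :: real"] by (simp add: power2_eq_square)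
    then have "ln (exp (1 / 2 :: real)) \<le> ln 2" by (subst ln_le_cancel_iff) auto
    then show ?thesis by (simp only: ln_exp)
  qed
  ultimately show ?thesis using ln2 by linarith
qed

end

section \<open>Summation over shells\<close>

text \<open>The power of 1/\<delta> in the truncation error. The third term of the rate has
  \<open>n\<close> to the power \<open>q - 1\<close> over this number.\<close>

definition tail_exponent :: "real \<Rightarrow> real \<Rightarrow> real \<Rightarrow> real" where
  "tail_exponent \<alpha> s q = 2 - q * s + (2 + \<alpha>) * (q - 1)"

text \<open>The first 32 is from Markov's inequality at level n \<delta>^2 / 32, the last factor
  from 1 / T. Here \<open>c\<close> stands for \<open>C\<^sub>0\<close>, and this is how the
  envelope constant enters the final one.\<close>

definition tail_const :: "real \<Rightarrow> real \<Rightarrow> real \<Rightarrow> real" where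
  "tail_const \<alpha> q c = 32 * c powr q * (32 * chain_const2 \<alpha>) powr (q - 1)"

text \<open>1024 = 32 * 32: one factor from the truncation level, the other because the variance
  terms may use n \<delta>^2 / 32.\<close>

definition threshold_const :: "real \<Rightarrow> real" where
  "threshold_const \<alpha> = 1024 * chain_const1 \<alpha> * chain_const2 \<alpha>"

text \<open>The logarithms cost an arbitrarily small power of \<open>D\<close>; \<open>tail_exponent\<close> exceeds \<open>q\<close>
  when \<open>s < 1\<close>, and the loss of \<open>1/10\<close> in the exponent makes up for it when \<open>s = 1\<close>.\<close>

lemma log_terms_absorbed:
  fixes \<alpha> s q c :: real
  assumes "0 \<le> \<alpha>" "\<alpha> < 2" "0 \<le> s" "s \<le> 1" "2 \<le> q"
    and p: "p = q - (if s = 1 then 1 / 10 else 0)"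
  shows "\<exists>D0 C. 1 \<le> D0 \<and> 0 \<le> C \<and> (\<forall>D\<ge>D0. threshold_const \<alpha> * (33 + 32 * (q * ln D)) \<le> D\<^sup>2 \<and>
    2 * D powr (- q) + tail_const \<alpha> q c * (33 + 32 * (q * ln D)) powr (q - 1) * D powr (- tail_exponent \<alpha> s q)
      \<le> C * D powr (- p))"
proof -
  define e where "e = tail_exponent \<alpha> s q - p"
  have "e = q * (1 - s) + \<alpha> * (q - 1) + (if s = 1 then 1 / 10 else 0)"
    by (simp add: e_def p tail_exponent_def algebra_simps)
  moreover have "0 \<le> \<alpha> * (q - 1)" "0 \<le> q * (1 - s)" "s \<noteq> 1 \<Longrightarrow> 0 < q * (1 - s)" using assms by auto
  ultimately have e: "0 < e" by (auto split: if_splits)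
  \<comment> \<open>The logarithm appears to the power \<open>q - 1\<close>, so ln D \<le> D^b / b
    uses up exactly the available gap \<open>e\<close>.\<close>
  define b where "b = e / (q - 1)"
  have b: "0 < b" using e assms by (simp add: b_def)
  have th: "0 \<le> threshold_const \<alpha>"
    using chain_const_pos[OF assms(2)] by (simp add: threshold_const_def)
  have tc: "0 \<le> tail_const \<alpha> q c" by (simp add: tail_const_def)
  define K where "K = (33 + 32 * q / b) powr (q - 1)"
  define D0 where "D0 = max 1 (threshold_const \<alpha> * (33 + 32 * q))"
  have main: "threshold_const \<alpha> * (33 + 32 * (q * ln D)) \<le> D\<^sup>2 \<and>
    2 * D powr (- q) + tail_const \<alpha> q c * (33 + 32 * (q * ln D)) powr (q - 1) * D powr (- tail_exponent \<alpha> s q)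
      \<le> (2 + tail_const \<alpha> q c * K) * D powr (- p)" if "D0 \<le> D" for D
  proof
    have D: "1 \<le> D" "threshold_const \<alpha> * (33 + 32 * q) \<le> D" using that by (auto simp: D0_def)
    have ln0: "0 \<le> ln D" using D by simp
    have "ln D \<le> D" using D ln_le_minus_one[of D] by linarith
    then have "q * ln D \<le> q * D" using assms by (intro mult_left_mono) auto
    then have "33 + 32 * (q * ln D) \<le> (33 + 32 * q) * D" using D by (simp add: algebra_simps)
    then have "threshold_const \<alpha> * (33 + 32 * (q * ln D)) \<le> threshold_const \<alpha> * ((33 + 32 * q) * D)"
      by (rule mult_left_mono[OF _ th])
    also have "\<dots> = (threshold_const \<alpha> * (33 + 32 * q)) * D" by simp
    also have "\<dots> \<le> D * D" using D by (intro mult_right_mono) auto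
    finally show "threshold_const \<alpha> * (33 + 32 * (q * ln D)) \<le> D\<^sup>2" by (simp add: power2_eq_square)
    have Db: "1 \<le> D powr b" using D b by (simp add: ge_one_powr_ge_zero)
    have "ln D \<le> D powr b / b" by (rule ln_powr_bound[OF D(1) b])
    then have "q * ln D \<le> q * (D powr b / b)" using assms by (intro mult_left_mono) auto
    then have "33 + 32 * (q * ln D) \<le> 33 * D powr b + 32 * (q * (D powr b / b))" using Db by linarith
    also have "\<dots> = (33 + 32 * q / b) * D powr b" by (simp add: algebra_simps)
    finally have "33 + 32 * (q * ln D) \<le> (33 + 32 * q / b) * D powr b" .
    moreover have "0 \<le> 33 + 32 * (q * ln D)" using ln0 assms by auto
    ultimately have "(33 + 32 * (q * ln D)) powr (q - 1) \<le> ((33 + 32 * q / b) * D powr b) powr (q - 1)"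
      using assms by (intro powr_mono2) auto
    also have "\<dots> = K * D powr e"
      using assms b by (simp add: powr_mult powr_powr K_def b_def)
    finally have "(33 + 32 * (q * ln D)) powr (q - 1) * D powr (- tail_exponent \<alpha> s q)
        \<le> K * D powr e * D powr (- tail_exponent \<alpha> s q)"
      by (rule mult_right_mono) simp
    also have "\<dots> = K * D powr (- p)" by (simp add: powr_add[symmetric] e_def mult.assoc)
    finally have "tail_const \<alpha> q c * ((33 + 32 * (q * ln D)) powr (q - 1) * D powr (- tail_exponent \<alpha> s q))
        \<le> tail_const \<alpha> q c * (K * D powr (- p))" by (rule mult_left_mono[OF _ tc])
    moreover have "D powr (- q) \<le> D powr (- p)" using D by (intro powr_mono) (auto simp: p)
    ultimately show "2 * D powr (- q) + tail_const \<alpha> q c * (33 + 32 * (q * ln D)) powr (q - 1) * D powr (- tail_exponent \<alpha> s q)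
      \<le> (2 + tail_const \<alpha> q c * K) * D powr (- p)" by (simp add: algebra_simps)
  qed
  have "1 \<le> D0" "0 \<le> 2 + tail_const \<alpha> q c * K" using tc by (auto simp: D0_def K_def)
  with main show ?thesis by blast
qed

context lse_setup
begin

abbreviation rate where "rate \<equiv> lse_rate \<alpha> s q A \<Phi> \<sigma>"

section \<open>Inequalities drawn from the rate\<close>

lemma tail_exponent_pos: "0 < tail_exponent \<alpha> s q"
proof -
  have "tail_exponent \<alpha> s q = q * (1 - s) + \<alpha> * (q - 1) + q"
    by (simp add: tail_exponent_def algebra_simps)
  moreover have "0 \<le> \<alpha> * (q - 1)" "0 \<le> q * (1 - s)" using params by auto
  ultimately show ?thesis using params by linarith
qed

lemma rate_pos: "1 \<le> n \<Longrightarrow> 0 < rate n"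
  unfolding lse_rate_def using A_pos \<Phi>_pos \<sigma>_pos by (subst Min_gr_iff) auto

lemma rate_le1:
  assumes "1 \<le> n"
  shows "(\<sigma> + \<Phi>)\<^sup>2 * A * rate n powr (2 + \<alpha>) \<le> n"
proof -
  have sp: "0 < \<sigma> + \<Phi>" using \<sigma>_pos \<Phi>_pos by simp
  have "rate n \<le> (n / A) powr (1 / (2 + \<alpha>)) / (\<sigma> + \<Phi>) powr (2 / (2 + \<alpha>))"
    unfolding lse_rate_def by (rule Min_le) auto
  then have "rate n powr (2 + \<alpha>) \<le> ((n / A) powr (1 / (2 + \<alpha>)) / (\<sigma> + \<Phi>) powr (2 / (2 + \<alpha>))) powr (2 + \<alpha>)"
    using params rate_pos[OF assms] by (intro powr_mono2) auto
  also have "\<dots> = (n / A) / (\<sigma> + \<Phi>)\<^sup>2"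
  proof -
    have "(x powr (1 / (2 + \<alpha>)) / y powr (2 / (2 + \<alpha>))) powr (2 + \<alpha>) = x / y\<^sup>2"
      if "0 < x" "0 < y" for x y :: real
    proof -
      have "c / (2 + \<alpha>) * (2 + \<alpha>) = c" for c using params by simp
      then show ?thesis using that by (simp only: powr_divide powr_powr powr_one powr_numeral less_imp_le powr_ge_zero)
    qed
    then show ?thesis using sp A_pos assms by simp
  qed
  finally show ?thesis using A_pos sp by (simp add: field_simps)
qed

lemma rate_le3:
  assumes "1 \<le> n"
  shows "A powr (q - 1) * \<Phi> powr (2 * q) * rate n powr tail_exponent \<alpha> s q \<le> n powr (q - 1)"
proof -
  define Z where "Z = A powr (q - 1) * \<Phi> powr (2 * q)"
  have Z: "0 < Z" using A_pos \<Phi>_pos by (simp add: Z_def)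
  define \<kappa> where "\<kappa> = tail_exponent \<alpha> s q"
  have \<kappa>: "0 < \<kappa>" unfolding \<kappa>_def by (rule tail_exponent_pos)
  have eq: "2 + \<alpha> + (2 - q * s) / (q - 1) = \<kappa> / (q - 1)"
    using params by (simp add: \<kappa>_def tail_exponent_def field_simps)
  have "rate n \<le> n powr (1 / (2 + \<alpha> + (2 - q * s) / (q - 1))) / Z powr (1 / \<kappa>)"
    unfolding lse_rate_def Z_def \<kappa>_def tail_exponent_def by (rule Min_le) auto
  also have "\<dots> = n powr ((q - 1) / \<kappa>) / Z powr (1 / \<kappa>)" unfolding eq by simp
  finally have "rate n powr \<kappa> \<le> (n powr ((q - 1) / \<kappa>) / Z powr (1 / \<kappa>)) powr \<kappa>"
    using \<kappa> rate_pos[OF assms] by (intro powr_mono2) auto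
  also have "\<dots> = n powr (q - 1) / Z" using \<kappa> Z by (simp add: powr_divide powr_powr)
  finally have "Z * rate n powr \<kappa> \<le> n powr (q - 1)" using Z by (simp add: pos_le_divide_eq mult.commute)
  then show ?thesis by (simp only: Z_def \<kappa>_def)
qed

text \<open>The choices of \<open>L\<close> and \<open>T\<close> turn the bound of
  \<open>shell_tail\<close> into one in \<open>D\<close> alone: \<open>n\<close>, \<open>A\<close>,
  \<sigma> and \<Phi> are absorbed by the first and third terms of the rate.\<close>

lemma shell_tail_at_rate:
  assumes n: "1 \<le> n" and D: "1 \<le> D"
    and large: "threshold_const \<alpha> * (33 + 32 * (q * ln D)) \<le> D\<^sup>2"
    and lse: "least_squares_estimator M P Xs Ys F f0 n fhat"
    and \<delta>_def: "\<delta> = D / rate n"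
  shows "prob {\<omega> \<in> space M. ennreal (\<delta> / 2) \<le> Lq_norm P 2 (\<lambda>x. fhat \<omega> x - f0 x) \<and>
      Lq_norm P 2 (\<lambda>x. fhat \<omega> x - f0 x) \<le> ennreal \<delta>}
    \<le> 2 * D powr (- q) + tail_const \<alpha> q C\<^sub>0 * (33 + 32 * (q * ln D)) powr (q - 1) * D powr (- tail_exponent \<alpha> s q)"
    (is "prob ?S \<le> _")
proof (cases "?S = {}")
  case True
  show ?thesis unfolding True by (simp add: tail_const_def)
next
  case False
  then obtain \<omega> where "\<omega> \<in> space M" and far: "ennreal (\<delta> / 2) \<le> Lq_norm P 2 (\<lambda>x. fhat \<omega> x - f0 x)" by auto
  then have fF: "fhat \<omega> \<in> F" using lse by (auto simp: least_squares_estimator_def is_arg_min_def)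
  define r where "r = rate n"
  have r: "0 < r" unfolding r_def by (rule rate_pos[OF n])
  have \<delta>: "0 < \<delta>" using D r by (simp add: \<delta>_def r_def)
  have Dr: "D = \<delta> * r" using r by (simp add: \<delta>_def r_def)
  define H where "H = A * \<delta> powr (- \<alpha>)"
  have H: "1 / 32 \<le> H" unfolding H_def by (rule entropy_lower_bound[OF fF \<delta> far])
  \<comment> \<open>Makes \<open>exp (- L)\<close> equal to \<open>D powr (- q)\<close>.\<close>
  define L where "L = q * ln D"
  have L: "0 \<le> L" using params D by (simp add: L_def)
  define \<Lambda> where "\<Lambda> = 33 + 32 * L"
  have \<Lambda>: "0 < \<Lambda>" using L by (simp add: \<Lambda>_def)
  define R where "R = L + 1 + A * \<delta> powr (- \<alpha>)"
  have R: "R \<le> H * \<Lambda>"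
  proof -
    \<comment> \<open>The first term of the rate controls \<open>H\<close>; as 1 \<le> 32 H, the
      summand L + 1 can be charged to it as well, and H + 32 H (L + 1) = H (33 + 32 L).\<close>
    have "1 * (L + 1) \<le> (32 * H) * (L + 1)" using H L by (intro mult_right_mono) auto
    then show ?thesis by (simp add: R_def H_def[symmetric] \<Lambda>_def algebra_simps)
  qed
  have R0: "0 < R" using L H by (simp add: R_def H_def[symmetric])
  have K: "0 < chain_const1 \<alpha>" "0 < chain_const2 \<alpha>" using chain_const_pos[OF params(2)] by auto
  have n0: "0 < real n" using n by simp
  have sp: "0 < (\<sigma> + \<Phi>)\<^sup>2" using \<sigma>_pos \<Phi>_pos by simp
  \<comment> \<open>The largest level that keeps the sup terms within n \<delta>^2 / 32, since a
    larger \<open>T\<close> means a smaller tail term. The variance terms take the other half of the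
    allowance, which is what \<open>large\<close> secures.\<close>
  define T where "T = n * \<delta>\<^sup>2 / (32 * chain_const2 \<alpha> * R)"
  have T: "0 < T" using n0 \<delta> K R0 by (simp add: T_def)
  have n\<delta>: "(\<sigma> + \<Phi>)\<^sup>2 * H * D\<^sup>2 \<le> n * \<delta>\<^sup>2"
  proof -
    have "D\<^sup>2 = D powr 2" using D by (simp add: powr_numeral)
    also have "\<dots> \<le> D powr (2 + \<alpha>)" using D params by (intro powr_mono) auto
    also have "\<dots> = \<delta> powr (2 + \<alpha>) * r powr (2 + \<alpha>)" unfolding Dr using \<delta> r by (simp add: powr_mult)
    finally have "((\<sigma> + \<Phi>)\<^sup>2 * H) * D\<^sup>2 \<le> ((\<sigma> + \<Phi>)\<^sup>2 * H) * (\<delta> powr (2 + \<alpha>) * r powr (2 + \<alpha>))"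
      using H sp by (intro mult_left_mono) auto
    also have "\<dots> = ((\<sigma> + \<Phi>)\<^sup>2 * A * r powr (2 + \<alpha>)) * (\<delta> powr (- \<alpha>) * \<delta> powr (2 + \<alpha>))"
      by (simp add: H_def algebra_simps)
    also have "\<delta> powr (- \<alpha>) * \<delta> powr (2 + \<alpha>) = \<delta>\<^sup>2"
      using \<delta> by (simp add: powr_add[symmetric] powr_numeral)
    also have "((\<sigma> + \<Phi>)\<^sup>2 * A * r powr (2 + \<alpha>)) * \<delta>\<^sup>2 \<le> n * \<delta>\<^sup>2"
      using rate_le1[OF n] unfolding r_def by (intro mult_right_mono) auto
    finally show ?thesis .
  qed
  have small: "chain_const1 \<alpha> * n * (\<sigma> + \<Phi>)\<^sup>2 * \<delta>\<^sup>2 / T + chain_const2 \<alpha> * T * R \<le> n * \<delta>\<^sup>2 / 16"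
  proof -
    have "chain_const2 \<alpha> * T * R = n * \<delta>\<^sup>2 / 32" using K R0 by (simp add: T_def)
    moreover have "chain_const1 \<alpha> * n * (\<sigma> + \<Phi>)\<^sup>2 * \<delta>\<^sup>2 / T = threshold_const \<alpha> * ((\<sigma> + \<Phi>)\<^sup>2 * R) / 32"
      using n0 \<delta> K R0 by (simp add: T_def threshold_const_def)
    moreover have "threshold_const \<alpha> * ((\<sigma> + \<Phi>)\<^sup>2 * R) \<le> n * \<delta>\<^sup>2"
    proof -
      have "threshold_const \<alpha> * ((\<sigma> + \<Phi>)\<^sup>2 * R) \<le> threshold_const \<alpha> * ((\<sigma> + \<Phi>)\<^sup>2 * (H * \<Lambda>))"
        using R K sp by (intro mult_left_mono) (auto simp: threshold_const_def)
      also have "\<dots> = ((\<sigma> + \<Phi>)\<^sup>2 * H) * (threshold_const \<alpha> * \<Lambda>)" by simp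
      also have "\<dots> \<le> ((\<sigma> + \<Phi>)\<^sup>2 * H) * D\<^sup>2"
        using large H sp by (intro mult_left_mono) (auto simp: \<Lambda>_def L_def)
      finally show ?thesis using n\<delta> by linarith
    qed
    ultimately show ?thesis by linarith
  qed
  have "prob ?S \<le> 2 * exp (- L) + 32 / \<delta>\<^sup>2 * ((C\<^sub>0 * \<Phi>\<^sup>2 * \<delta> powr s) powr q / T powr (q - 1))"
    by (rule shell_tail[OF n \<delta> L T R_def small lse])
  also have "exp (- L) = D powr (- q)" using D by (simp add: powr_def L_def)
  also have "32 / \<delta>\<^sup>2 * ((C\<^sub>0 * \<Phi>\<^sup>2 * \<delta> powr s) powr q / T powr (q - 1))
      \<le> tail_const \<alpha> q C\<^sub>0 * \<Lambda> powr (q - 1) * D powr (- tail_exponent \<alpha> s q)"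
  proof -
    define \<kappa> where "\<kappa> = tail_exponent \<alpha> s q"
    have "1 / T powr (q - 1) = (1 / T) powr (q - 1)" using T by (simp add: powr_divide)
    also have "1 / T = 32 * chain_const2 \<alpha> * R / (n * \<delta>\<^sup>2)" by (simp add: T_def)
    also have "\<dots> powr (q - 1) \<le> (32 * chain_const2 \<alpha> * (H * \<Lambda>) / (n * \<delta>\<^sup>2)) powr (q - 1)"
      using R R0 K n0 \<delta> params by (intro powr_mono2 divide_right_mono mult_left_mono) auto
    also have "\<dots> = (32 * chain_const2 \<alpha>) powr (q - 1) * \<Lambda> powr (q - 1) * (A powr (q - 1) * \<delta> powr (- \<alpha> * (q - 1))) / (n powr (q - 1) * \<delta> powr (2 * (q - 1)))"
      using K H \<Lambda> n0 \<delta> A_pos by (simp add: powr_divide powr_mult H_def powr_powr powr_numeral[symmetric] del: powr_numeral)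
    finally have 1: "1 / T powr (q - 1) \<le> \<dots>" .
    have 2: "(C\<^sub>0 * \<Phi>\<^sup>2 * \<delta> powr s) powr q = C\<^sub>0 powr q * \<Phi> powr (2 * q) * \<delta> powr (s * q)"
      using params \<Phi>_pos \<delta> by (simp add: powr_mult powr_powr powr_numeral[symmetric] del: powr_numeral)
    have "32 / \<delta>\<^sup>2 * ((C\<^sub>0 * \<Phi>\<^sup>2 * \<delta> powr s) powr q / T powr (q - 1))
      = (32 / \<delta>\<^sup>2 * (C\<^sub>0 powr q * \<Phi> powr (2 * q) * \<delta> powr (s * q))) * (1 / T powr (q - 1))"
      unfolding 2 by simp
    also have "\<dots> \<le> (32 / \<delta>\<^sup>2 * (C\<^sub>0 powr q * \<Phi> powr (2 * q) * \<delta> powr (s * q))) *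
       ((32 * chain_const2 \<alpha>) powr (q - 1) * \<Lambda> powr (q - 1) * (A powr (q - 1) * \<delta> powr (- \<alpha> * (q - 1))) / (n powr (q - 1) * \<delta> powr (2 * (q - 1))))"
      by (rule mult_left_mono[OF 1]) simp
    also have "\<dots> = tail_const \<alpha> q C\<^sub>0 * \<Lambda> powr (q - 1) * (A powr (q - 1) * \<Phi> powr (2 * q) / n powr (q - 1)) *
       (\<delta> powr (s * q) * \<delta> powr (- \<alpha> * (q - 1)) / (\<delta>\<^sup>2 * \<delta> powr (2 * (q - 1))))"
    proof -
      have "(32 / d2 * (c * ph * ds)) * (k * l * (a * da) / (nn * dd)) = (32 * c * k) * l * (a * ph / nn) * (ds * da / (d2 * dd))"
        for d2 c ph ds k l a da nn dd :: real by (simp add: mult_ac)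
      then show ?thesis unfolding tail_const_def .
    qed
    \<comment> \<open>In order: the envelope moment, the entropy inside 1 / T, Markov's inequality,
      and the factor \<delta>^2 of \<open>T\<close>.\<close>
    also have "\<delta> powr (s * q) * \<delta> powr (- \<alpha> * (q - 1)) / (\<delta>\<^sup>2 * \<delta> powr (2 * (q - 1))) = \<delta> powr (- \<kappa>)"
    proof -
      have "\<delta>\<^sup>2 = \<delta> powr 2" using \<delta> by (simp add: powr_numeral)
      then have "\<delta> powr (s * q) * \<delta> powr (- \<alpha> * (q - 1)) / (\<delta>\<^sup>2 * \<delta> powr (2 * (q - 1)))
        = \<delta> powr (s * q + - \<alpha> * (q - 1) - (2 + 2 * (q - 1)))"
        by (simp only: powr_add powr_diff)
      also have "s * q + - \<alpha> * (q - 1) - (2 + 2 * (q - 1)) = - \<kappa>"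
        by (simp add: \<kappa>_def tail_exponent_def algebra_simps)
      finally show ?thesis .
    qed
    also have "\<delta> powr (- \<kappa>) = r powr \<kappa> * D powr (- \<kappa>)"
      unfolding Dr using \<delta> r by (simp add: powr_mult powr_minus)
    also have "tail_const \<alpha> q C\<^sub>0 * \<Lambda> powr (q - 1) * (A powr (q - 1) * \<Phi> powr (2 * q) / n powr (q - 1)) * (r powr \<kappa> * D powr (- \<kappa>))
      = (tail_const \<alpha> q C\<^sub>0 * \<Lambda> powr (q - 1) * D powr (- \<kappa>)) * (A powr (q - 1) * \<Phi> powr (2 * q) * r powr \<kappa> / n powr (q - 1))"
      by simp
    also have "\<dots> \<le> (tail_const \<alpha> q C\<^sub>0 * \<Lambda> powr (q - 1) * D powr (- \<kappa>)) * 1"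
      using rate_le3[OF n] n0 unfolding r_def \<kappa>_def
      by (intro mult_left_mono) (auto simp: tail_const_def)
    finally show ?thesis by (simp add: \<kappa>_def)
  qed
  finally show ?thesis by (simp add: \<Lambda>_def L_def)
qed

lemma tail_bound:
  assumes n: "1 \<le> n" and lse: "least_squares_estimator M P Xs Ys F f0 n fhat"
    and D0: "1 \<le> D0" and C: "0 \<le> C" and p: "1 \<le> p"
    and shells: "\<And>D. D0 \<le> D \<Longrightarrow> threshold_const \<alpha> * (33 + 32 * (q * ln D)) \<le> D\<^sup>2 \<and>
      2 * D powr (- q) + tail_const \<alpha> q C\<^sub>0 * (33 + 32 * (q * ln D)) powr (q - 1) * D powr (- tail_exponent \<alpha> s q)
      \<le> C * D powr (- p)"
    and D: "0 < D"
  shows "prob {\<omega> \<in> space M. ennreal D \<le> ennreal (rate n) * Lq_norm P 2 (\<lambda>x. fhat \<omega> x - f0 x)}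
    \<le> max (D0 powr p) C * D powr (- p)" (is "prob ?S \<le> _")
proof (cases "D < D0")
  case True
  \<comment> \<open>For small \<open>D\<close> the bound is trivial: \<open>D0 powr p\<close> makes
    it at least 1.\<close>
  have "prob ?S \<le> 1" by simp
  also have "1 = D powr p * D powr (- p)" using D by (simp add: powr_add[symmetric])
  also have "\<dots> \<le> max (D0 powr p) C * D powr (- p)"
  proof (rule mult_right_mono)
    have "D powr p \<le> D0 powr p" using True D p by (intro powr_mono2) auto
    then show "D powr p \<le> max (D0 powr p) C" by simp
  qed simp
  finally show ?thesis .
next
  case False
  then have DD0: "D0 \<le> D" by simp
  define r where "r = rate n"
  have r: "0 < r" unfolding r_def by (rule rate_pos[OF n])
  define Z where "Z \<omega> = Lq_norm P 2 (\<lambda>x. fhat \<omega> x - f0 x)" for \<omega>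
  have Zm [measurable]: "Z \<in> borel_measurable M"
    using lse unfolding Z_def least_squares_estimator_def by auto
  \<comment> \<open>\<open>Dk k\<close> is the outer radius in units of 1 / r; the shell reaches
    down to half of it, so shell 0 starts exactly at \<open>D\<close>.\<close>
  define Dk where "Dk k = D * 2 ^ Suc k" for k :: nat
  define Sh where "Sh k = {\<omega> \<in> space M. ennreal (Dk k / r / 2) \<le> Z \<omega> \<and> Z \<omega> \<le> ennreal (Dk k / r)}" for k
  have Shm: "Sh k \<in> sets M" for k unfolding Sh_def by measurable
  have Dk: "D \<le> Dk k" for k
    using mult_left_mono[OF one_le_power[of "2::real" "Suc k"], of D] D by (simp add: Dk_def)
  \<comment> \<open>p \<ge> 1 lets the shell bounds halve at each step, and starting at 1/2 they sum
    to the bound at \<open>D\<close> itself with no further factor.\<close>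
  have half: "(2 :: real) powr (- p) \<le> 1 / 2" using powr_mono[of "- p" "- 1" 2] p by (simp add: powr_minus)
  have Shp: "prob (Sh k) \<le> C * D powr (- p) * (1 / 2) ^ Suc k" for k
  proof -
    have Dk1: "1 \<le> Dk k" "D0 \<le> Dk k" using Dk[of k] D0 DD0 by linarith+
    have "prob (Sh k) \<le> 2 * Dk k powr (- q) + tail_const \<alpha> q C\<^sub>0 * (33 + 32 * (q * ln (Dk k))) powr (q - 1) * Dk k powr (- tail_exponent \<alpha> s q)"
      unfolding Sh_def Z_def
      by (rule shell_tail_at_rate[OF n Dk1(1) conjunct1[OF shells[OF Dk1(2)]] lse]) (simp add: r_def)
    also have "\<dots> \<le> C * Dk k powr (- p)" using shells[OF Dk1(2)] by blast
    also have "Dk k powr (- p) = D powr (- p) * (2 powr (- p)) ^ Suc k"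
    proof -
      have "(2 ^ Suc k :: real) powr (- p) = (2 powr (- p)) ^ Suc k"
        by (simp add: powr_realpow[symmetric] powr_powr mult.commute del: power_Suc)
      then show ?thesis unfolding Dk_def using D by (simp add: powr_mult del: power_Suc)
    qed
    also have "C * (D powr (- p) * (2 powr (- p)) ^ Suc k) \<le> C * (D powr (- p) * (1 / 2) ^ Suc k)"
      using C half by (intro mult_left_mono power_mono) auto
    finally show ?thesis by simp
  qed
  have sumb: "(\<lambda>k. C * D powr (- p) * (1 / 2) ^ Suc k) sums (C * D powr (- p) * 1)"
    by (rule sums_mult[OF power_half_series])
  have sumS: "summable (\<lambda>k. prob (Sh k))"
    by (rule summable_comparison_test'[OF sums_summable[OF sumb], of 0]) (use Shp in simp)
  have "?S \<subseteq> (\<Union>k. Sh k)"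
  proof
    fix \<omega> assume "\<omega> \<in> ?S"
    then have \<omega>: "\<omega> \<in> space M" and big: "ennreal D \<le> ennreal r * Z \<omega>" by (auto simp: r_def Z_def)
    have fF: "fhat \<omega> \<in> F" using lse \<omega> by (auto simp: least_squares_estimator_def is_arg_min_def)
    \<comment> \<open>The class is bounded and \<open>P\<close> has mass 1, so the error is finite
      and falls into some shell.\<close>
    interpret P: prob_space P unfolding P_def by (rule prob_space_distr) simp
    have "(\<integral>\<^sup>+ x. ennreal ((fhat \<omega> x - f0 x)\<^sup>2) \<partial>P) \<le> (\<integral>\<^sup>+ x. ennreal ((2 * \<Phi>)\<^sup>2) \<partial>P)"
    proof (intro nn_integral_mono ennreal_leI)
      fix x assume "x \<in> space P"
      then have x: "x \<in> space B" by simp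
      have "\<bar>fhat \<omega> x - f0 x\<bar> \<le> 2 * \<Phi>"
        using F_bdd[OF fF x] F_bdd[OF f0_F x] by linarith
      from power_mono[OF this, of 2] show "(fhat \<omega> x - f0 x)\<^sup>2 \<le> (2 * \<Phi>)\<^sup>2" by simp
    qed
    also have "\<dots> = ennreal ((2 * \<Phi>)\<^sup>2)" using P.emeasure_space_1 by simp
    finally have "Z \<omega> \<le> ennreal (2 * \<Phi>)" unfolding Z_def using \<Phi>_pos by (subst Lq_norm_2_le_iff) auto
    then obtain \<rho> where \<rho>: "Z \<omega> = ennreal \<rho>" "0 \<le> \<rho>" by (cases "Z \<omega>") (auto simp: top_unique)
    have "D \<le> r * \<rho>" using big \<rho> r D by (simp add: ennreal_mult[symmetric])
    then have t1: "1 \<le> r * \<rho> / D" using D by simp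
    obtain m where m: "r * \<rho> / D < 2 ^ m" using real_arch_pow[of 2 "r * \<rho> / D"] by auto
    have "\<exists>k<m. (\<forall>i\<le>k. \<not> r * \<rho> / D < 2 ^ i) \<and> r * \<rho> / D < 2 ^ Suc k"
      by (rule ex_least_nat_less[where P = "\<lambda>i. r * \<rho> / D < 2 ^ i", OF m]) (use t1 in simp)
    then obtain k where "\<not> r * \<rho> / D < 2 ^ k" and "r * \<rho> / D < 2 ^ Suc k" by blast
    then have k: "2 ^ k \<le> r * \<rho> / D" "r * \<rho> / D < 2 ^ Suc k" by auto
    have "Dk k / r / 2 \<le> \<rho>" "\<rho> \<le> Dk k / r" using k D r by (auto simp: Dk_def field_simps)
    then have "\<omega> \<in> Sh k" using \<omega> \<rho> by (auto simp: Sh_def intro: ennreal_leI)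
    then show "\<omega> \<in> (\<Union>k. Sh k)" by blast
  qed
  then have "prob ?S \<le> prob (\<Union>k. Sh k)" by (rule finite_measure_mono) (use Shm in auto)
  also have "\<dots> \<le> (\<Sum>k. prob (Sh k))"
    by (rule finite_measure_subadditive_countably[OF _ sumS]) (use Shm in auto)
  also have "\<dots> \<le> (\<Sum>k. C * D powr (- p) * (1 / 2) ^ Suc k)"
    by (rule suminf_le[OF Shp sumS sums_summable[OF sumb]])
  also have "\<dots> = C * D powr (- p)" using sums_unique[OF sumb] by simp
  also have "\<dots> \<le> max (D0 powr p) C * D powr (- p)" by (intro mult_right_mono) auto
  finally show ?thesis .
qed

end

section \<open>Choice of the constant, the degenerate class, and stochastic order\<close>

theorem theorem3p1:
  fixes \<alpha> s q C\<^sub>0 :: real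
  assumes "0 \<le> \<alpha>" "\<alpha> < 2" "0 \<le> s" "s \<le> 1" "2 \<le> q" "0 < C\<^sub>0"
  shows "\<exists>C::real.
    \<forall>(S :: 'x set) d (M :: 'w measure) B P X Y Xs Ys f0 F \<Phi> A \<sigma>.
      Metric_space S d \<and> B = metric_borel S d \<and>
      regression_model M B X Y Xs Ys f0 \<and> P = distr M B X \<and>
      F \<subseteq> borel_measurable B \<and>
      (SUP f\<in>F. SUP x\<in>S. ereal \<bar>f x\<bar>) = ereal \<Phi> \<and>
      0 < A \<and>
      (\<forall>\<zeta>>0. \<exists>N. bracketing_number P \<zeta> F = enat N \<and> ln (real N) \<le> A * \<zeta> powr (- \<alpha>)) \<and>
      f0 \<in> F \<and>
      0 < \<sigma> \<and>
      (AE \<omega> in M. nn_cond_exp M (vimage_algebra (space M) X B)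
          (\<lambda>\<omega>. ennreal ((Y \<omega> - f0 (X \<omega>))\<^sup>2)) \<omega> \<le> ennreal (\<sigma>\<^sup>2)) \<and>
      (\<forall>\<delta>>0. local_envelope P F f0 \<delta> \<in> borel_measurable B \<and>
          Lq_norm M q (\<lambda>\<omega>. (\<bar>Y \<omega> - f0 (X \<omega>)\<bar> + \<Phi>) * local_envelope P F f0 \<delta> (X \<omega>))
            \<le> ennreal (C\<^sub>0 * \<Phi>\<^sup>2 * \<delta> powr s))
      \<longrightarrow>
      (\<forall>n\<ge>1. \<forall>fhat. least_squares_estimator M P Xs Ys F f0 n fhat \<longrightarrow>
         (\<forall>D>0. measure M {\<omega>\<in>space M.
               ennreal (lse_rate \<alpha> s q A \<Phi> \<sigma> n) * Lq_norm P 2 (\<lambda>x. fhat \<omega> x - f0 x) \<ge> ennreal D}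
             \<le> C * D powr (- q + (if s = 1 then 1 / 10 else 0)))) \<and>
      (\<forall>fhat. (\<forall>n\<ge>1. least_squares_estimator M P Xs Ys F f0 n (fhat n)) \<longrightarrow>
         bigO_prob M (\<lambda>n \<omega>. Lq_norm P 2 (\<lambda>x. fhat n \<omega> x - f0 x))
           (\<lambda>n. inverse (lse_rate \<alpha> s q A \<Phi> \<sigma> n)))"
proof -
  define p where "p = q - (if s = 1 then 1 / 10 else 0)"
  have p1: "1 \<le> p" using assms by (simp add: p_def)
  have p_eq: "- q + (if s = 1 then 1 / 10 else 0) = - p" by (simp add: p_def)
  from log_terms_absorbed[OF assms(1-5) p_def, of C\<^sub>0]
  obtain D0 C1 where D0: "1 \<le> D0" and C1: "0 \<le> C1"
    and shells: "\<And>D. D0 \<le> D \<Longrightarrow> threshold_const \<alpha> * (33 + 32 * (q * ln D)) \<le> D\<^sup>2 \<and>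
      2 * D powr (- q) + tail_const \<alpha> q C\<^sub>0 * (33 + 32 * (q * ln D)) powr (q - 1) * D powr (- tail_exponent \<alpha> s q)
      \<le> C1 * D powr (- p)" by blast
  define C where "C = max (D0 powr p) C1"
  have C: "0 < C" using D0 by (auto simp: C_def less_max_iff_disj)
  show ?thesis
    unfolding p_eq
  proof (intro exI[of _ C] allI impI, elim conjE)
    fix S :: "'x set" and d and M :: "'w measure" and B P X Y Xs Ys f0 F \<Phi> A \<sigma>
    assume metric: "Metric_space S d" and B: "B = metric_borel S d"
      and model: "regression_model M B X Y Xs Ys f0" and P: "P = distr M B X"
      and F_meas: "F \<subseteq> borel_measurable B"
      and sup: "(SUP f\<in>F. SUP x\<in>S. ereal \<bar>f x\<bar>) = ereal \<Phi>"
      and A: "0 < A"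
      and entropy: "\<forall>\<zeta>>0. \<exists>N. bracketing_number P \<zeta> F = enat N \<and> ln (real N) \<le> A * \<zeta> powr (- \<alpha>)"
      and f0: "f0 \<in> F"
      and \<sigma>: "0 < \<sigma>"
      and var: "AE \<omega> in M. nn_cond_exp M (vimage_algebra (space M) X B)
          (\<lambda>\<omega>. ennreal ((Y \<omega> - f0 (X \<omega>))\<^sup>2)) \<omega> \<le> ennreal (\<sigma>\<^sup>2)"
      and env: "\<forall>\<delta>>0. local_envelope P F f0 \<delta> \<in> borel_measurable B \<and>
          Lq_norm M q (\<lambda>\<omega>. (\<bar>Y \<omega> - f0 (X \<omega>)\<bar> + \<Phi>) * local_envelope P F f0 \<delta> (X \<omega>))
            \<le> ennreal (C\<^sub>0 * \<Phi>\<^sup>2 * \<delta> powr s)"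
    have "{U. openin (Metric_space.mtopology S d) U} \<subseteq> Pow S"
      using Metric_space.topspace_mtopology[OF metric] openin_subset[of "Metric_space.mtopology S d"] by auto
    then have spB: "space B = S" by (simp add: B metric_borel_def space_measure_of)
    have bdd: "\<bar>f x\<bar> \<le> \<Phi>" if "f \<in> F" "x \<in> space B" for f x
    proof -
      have "ereal \<bar>f x\<bar> \<le> (SUP x\<in>S. ereal \<bar>f x\<bar>)" using that spB by (intro SUP_upper) auto
      also have "\<dots> \<le> (SUP f\<in>F. SUP x\<in>S. ereal \<bar>f x\<bar>)" using that by (intro SUP_upper)
      also have "\<dots> = ereal \<Phi>" by (rule sup)
      finally show ?thesis by simp
    qed
    interpret M: prob_space M using model by (simp add: regression_model_def)
    have X: "X \<in> measurable M B" using model by (simp add: regression_model_def)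
    \<comment> \<open>A probability space has a point, hence so has the covariate space, and \<Phi>
      bounds an absolute value there.\<close>
    obtain \<omega>0 where "\<omega>0 \<in> space M" using M.not_empty by blast
    then have "X \<omega>0 \<in> space B" by (rule measurable_space[OF X])
    from bdd[OF f0 this] have \<Phi>: "0 \<le> \<Phi>" by linarith
    \<comment> \<open>\<open>pos\<close> prepares the stochastic order. At \<Phi> = 0 division by
      zero makes the rate 0 and its inverse 0 as well, so the event there is empty only because the
      error vanishes.\<close>
    have main: "measure M {\<omega>\<in>space M. ennreal D \<le> ennreal (lse_rate \<alpha> s q A \<Phi> \<sigma> n) * Lq_norm P 2 (\<lambda>x. fhat \<omega> x - f0 x)}
        \<le> C * D powr (- p)"
      and pos: "(\<forall>\<omega>\<in>space M. Lq_norm P 2 (\<lambda>x. fhat \<omega> x - f0 x) = 0) \<or> 0 < lse_rate \<alpha> s q A \<Phi> \<sigma> n"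
      if n: "1 \<le> n" and lse: "least_squares_estimator M P Xs Ys F f0 n fhat" and D: "0 < D" for n fhat D
    proof -
      have "measure M {\<omega>\<in>space M. ennreal D \<le> ennreal (lse_rate \<alpha> s q A \<Phi> \<sigma> n) * Lq_norm P 2 (\<lambda>x. fhat \<omega> x - f0 x)}
          \<le> C * D powr (- p) \<and>
        ((\<forall>\<omega>\<in>space M. Lq_norm P 2 (\<lambda>x. fhat \<omega> x - f0 x) = 0) \<or> 0 < lse_rate \<alpha> s q A \<Phi> \<sigma> n)"
      proof (cases "\<Phi> = 0")
        case True
        have zero: "Lq_norm P 2 (\<lambda>x. fhat \<omega> x - f0 x) = 0" if "\<omega> \<in> space M" for \<omega>
        proof -
          have fF: "fhat \<omega> \<in> F" using lse that by (auto simp: least_squares_estimator_def is_arg_min_def)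
          have "(\<integral>\<^sup>+ x. ennreal ((fhat \<omega> x - f0 x)\<^sup>2) \<partial>P) = (\<integral>\<^sup>+ x. 0 \<partial>P)"
          proof (rule nn_integral_cong)
            fix x assume "x \<in> space P"
            then have x: "x \<in> space B" by (simp add: P)
            from bdd[OF f0 x] bdd[OF fF x] True show "ennreal ((fhat \<omega> x - f0 x)\<^sup>2) = 0" by simp
          qed
          then have "Lq_norm P 2 (\<lambda>x. fhat \<omega> x - f0 x) \<le> ennreal 0" by (subst Lq_norm_2_le_iff) auto
          then show ?thesis by simp
        qed
        then have none: "{\<omega>\<in>space M. ennreal D \<le> ennreal (lse_rate \<alpha> s q A \<Phi> \<sigma> n) * Lq_norm P 2 (\<lambda>x. fhat \<omega> x - f0 x)} = {}"
          using D by auto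
        show ?thesis unfolding none using C zero by simp
      next
        case False
        interpret lse_setup M B P X Y Xs Ys f0 F \<Phi> A \<sigma> \<alpha> s q C\<^sub>0
          by unfold_locales (use model P F_meas bdd A entropy f0 \<sigma> var env \<Phi> False assms in auto)
        show ?thesis
          using tail_bound[OF n lse D0 C1 p1 shells D] rate_pos[OF n] by (simp add: C_def)
      qed
      then show "measure M {\<omega>\<in>space M. ennreal D \<le> ennreal (lse_rate \<alpha> s q A \<Phi> \<sigma> n) * Lq_norm P 2 (\<lambda>x. fhat \<omega> x - f0 x)}
          \<le> C * D powr (- p)"
        and "(\<forall>\<omega>\<in>space M. Lq_norm P 2 (\<lambda>x. fhat \<omega> x - f0 x) = 0) \<or> 0 < lse_rate \<alpha> s q A \<Phi> \<sigma> n"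
        by blast+
    qed
    have "bigO_prob M (\<lambda>n \<omega>. Lq_norm P 2 (\<lambda>x. fhat n \<omega> x - f0 x)) (\<lambda>n. inverse (lse_rate \<alpha> s q A \<Phi> \<sigma> n))"
      if lse: "\<forall>n\<ge>1. least_squares_estimator M P Xs Ys F f0 n (fhat n)" for fhat
      unfolding bigO_prob_def
    proof (intro allI impI)
      fix \<eta> :: real assume \<eta>: "0 < \<eta>"
      \<comment> \<open>As p \<ge> 1 and K \<ge> 1, the tail bound at \<open>K\<close> is at most C
        / K, hence at most \<eta>.\<close>
      define K where "K = max 1 (C / \<eta>)"
      have K: "1 \<le> K" "C / \<eta> \<le> K" by (auto simp: K_def)
      have "K powr (- p) \<le> K powr (- 1)" using K p1 by (intro powr_mono) auto
      then have "C * K powr (- p) \<le> C * inverse K" using C K by (simp add: powr_minus)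
      also have "\<dots> \<le> \<eta>" using K \<eta> by (simp add: field_simps)
      finally have CK: "C * K powr (- p) \<le> \<eta>" .
      show "\<exists>K>0. \<exists>N. \<forall>n\<ge>N. measure M {\<omega>\<in>space M. ennreal (K * inverse (lse_rate \<alpha> s q A \<Phi> \<sigma> n)) < Lq_norm P 2 (\<lambda>x. fhat n \<omega> x - f0 x)} \<le> \<eta>"
      proof (intro exI[of _ K] conjI exI[of _ 1] allI impI)
        show "0 < K" using K by simp
        fix n :: nat assume n: "1 \<le> n"
        define r where "r = lse_rate \<alpha> s q A \<Phi> \<sigma> n"
        define Z where "Z \<omega> = Lq_norm P 2 (\<lambda>x. fhat n \<omega> x - f0 x)" for \<omega>
        have lse_n: "least_squares_estimator M P Xs Ys F f0 n (fhat n)" using lse n by blast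
        have Zm [measurable]: "Z \<in> borel_measurable M"
          using lse_n unfolding Z_def least_squares_estimator_def by auto
        have tail: "measure M {\<omega>\<in>space M. ennreal K \<le> ennreal r * Z \<omega>} \<le> C * K powr (- p)"
          unfolding r_def Z_def by (rule main[OF n lse_n]) (use K in simp)
        have "{\<omega>\<in>space M. ennreal (K * inverse r) < Z \<omega>} \<subseteq> {\<omega>\<in>space M. ennreal K \<le> ennreal r * Z \<omega>}"
        proof
          fix \<omega> assume "\<omega> \<in> {\<omega>\<in>space M. ennreal (K * inverse r) < Z \<omega>}"
          then have \<omega>: "\<omega> \<in> space M" and Z: "ennreal (K * inverse r) < Z \<omega>" by auto
          have r: "0 < r" using pos[OF n lse_n, of 1] \<omega> Z by (auto simp: r_def Z_def)
          have "ennreal K = ennreal r * ennreal (K * inverse r)"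
            using r K by (simp add: ennreal_mult[symmetric])
          also have "\<dots> \<le> ennreal r * Z \<omega>" using Z by (intro mult_left_mono) auto
          finally show "\<omega> \<in> {\<omega>\<in>space M. ennreal K \<le> ennreal r * Z \<omega>}" using \<omega> by simp
        qed
        then have "measure M {\<omega>\<in>space M. ennreal (K * inverse r) < Z \<omega>} \<le> measure M {\<omega>\<in>space M. ennreal K \<le> ennreal r * Z \<omega>}"
          by (rule M.finite_measure_mono) measurable
        with tail CK show "measure M {\<omega>\<in>space M. ennreal (K * inverse (lse_rate \<alpha> s q A \<Phi> \<sigma> n)) < Lq_norm P 2 (\<lambda>x. fhat n \<omega> x - f0 x)} \<le> \<eta>"
          unfolding r_def Z_def by linarith
      qed
    qed
    with main show "(\<forall>n\<ge>1. \<forall>fhat. least_squares_estimator M P Xs Ys F f0 n fhat \<longrightarrow>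
         (\<forall>D>0. measure M {\<omega>\<in>space M.
               ennreal (lse_rate \<alpha> s q A \<Phi> \<sigma> n) * Lq_norm P 2 (\<lambda>x. fhat \<omega> x - f0 x) \<ge> ennreal D}
             \<le> C * D powr (- p))) \<and>
      (\<forall>fhat. (\<forall>n\<ge>1. least_squares_estimator M P Xs Ys F f0 n (fhat n)) \<longrightarrow>
         bigO_prob M (\<lambda>n \<omega>. Lq_norm P 2 (\<lambda>x. fhat n \<omega> x - f0 x))
           (\<lambda>n. inverse (lse_rate \<alpha> s q A \<Phi> \<sigma> n)))"
      by blast
  qed
qed

end
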